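(* Let $d\ge1$ and suppose the kernels $k(z,w)=1+\sum_{|a|\ge1}k_az^a\overline{w}^a$ and $\ell(z,w)=1+\sum_{|a|\ge1}\ell_az^a\overline{w}^a$ (with $a\in\mathbb{N}^d$) are diagonal and holomorphic on a domain $\Omega\subseteq\mathbb{C}^d$ with $\mathbf{0}\in\Omega$. If there is a formal Shimorin certificate for $(k,\ell)$, then $(k,\ell)$ is a complete Carathéodory pair.
   Context: A kernel on a non-empty set $X$ is a function $k:X\times X\to\mathbb{C}$ such that $[k(z_i,z_j)]_{i,j=1}^n$ is positive semi-definite for all finite choices of points; $\mathcal{H}_k$ is the reproducing kernel Hilbert space. A function $\Phi:X\to\mathbb{M}_J$ (complex $J\times J$ matrices) is a contractive multiplier from $\mathcal{H}_k\otimes\mathbb{C}^J$ to $\mathcal{H}_\ell\otimes\mathbb{C}^J$ if $f\mapsto\Phi f$ maps the first space into the second with operator norm at most one. A domain is open, connected and non-empty. $\mathbb{N}$ includes $0$; $|a|=\sum a_j$; for $a,b\in\mathbb{N}^d$, $a\le b$ means $a_i\le b_i$ for all $i$. A diagonal holomorphic kernel on a domain $\Omega\ni\mathbf{0}$ is a kernel $f$ on $\Omega$, holomorphic in $z$ and conjugate holomorphic in $w$, whose power series at $\mathbf{0}$ has the form $\sum_{a\in\mathbb{N}^d}f_az^a\overline{w}^a$ with all $f_a>0$; we identify it with the formal power series $f(x)=\sum_af_ax^a$. A formal Shimorin certificate for $(k,\ell)$ is a formal power series $t(x)=\sum_{|a|>0}t_ax^a$ with $t_a\ge0$ for all $a$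 such that the formal power series $g=\ell(1-t)$ and $h=1-k(1-t)$ have non-negative coefficients. A non-empty set $F\subseteq\mathbb{N}^d$ is co-invariant if $b\in F$ and $a\le b$ imply $a\in F$. $(k,\ell)$ is a complete Carathéodory pair if for every positive integer $J$, every finite co-invariant $\varnothing\ne F\subseteq\mathbb{N}^d$ and every $\{c_a:a\in F\}\subseteq\mathbb{M}_J$, the block matrix $C$ indexed by $F\times F$ with blocks $C_{a,b}=c_{b-a}\sqrt{k_a/\ell_b}$ if $b\ge a$ and $C_{a,b}=\mathbf{0}$ otherwise is a contraction if and only if there exist $\{c_a:a\in\mathbb{N}^d\setminus F\}\subseteq\mathbb{M}_J$ such that $\Phi(z)=\sum_{a\in\mathbb{N}^d}z^a\otimes c_a^*$ is a contractive multiplier from $\mathcal{H}_k\otimes\mathbb{C}^J$ to $\mathcal{H}_\ell\otimes\mathbb{C}^J$. *)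

theory Defs
  imports "HOL-Analysis.Analysis"
begin

section \<open>Kernels and reproducing kernel Hilbert spaces\<close>

definition psd_matrix :: "nat \<Rightarrow> (nat \<Rightarrow> nat \<Rightarrow> complex) \<Rightarrow> bool" where
  "psd_matrix n A \<longleftrightarrow>
     (\<forall>v. (\<Sum>i<n. \<Sum>j<n. cnj (v i) * A i j * v j) \<in> \<real> \<and>
          0 \<le> Re (\<Sum>i<n. \<Sum>j<n. cnj (v i) * A i j * v j))"

definition kernel_on :: "'x set \<Rightarrow> ('x \<Rightarrow> 'x \<Rightarrow> complex) \<Rightarrow> bool" where
  "kernel_on X k \<longleftrightarrow> X \<noteq> {} \<and>
     (\<forall>n z. (\<forall>i<n. z i \<in> X) \<longrightarrow> psd_matrix n (\<lambda>i j. k (z i) (z j)))"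

text \<open>
  Functions on \<open>X\<close> are represented by functions on the whole type that vanish off \<open>X\<close>; in
  particular \<open>kernel_fun X k w\<close> is the function \<open>k(\<cdot>, w)\<close> on \<open>X\<close>.
\<close>

definition kernel_fun :: "'x set \<Rightarrow> ('x \<Rightarrow> 'x \<Rightarrow> complex) \<Rightarrow> 'x \<Rightarrow> 'x \<Rightarrow> complex" where
  "kernel_fun X k w = (\<lambda>z. if z \<in> X then k z w else 0)"

text \<open>
  \<open>H\<close> with inner product \<open>ip\<close> (linear in the first argument) is a Hilbert space of functions on
  \<open>X\<close> with reproducing kernel \<open>k\<close>. The values of \<open>ip\<close> outside \<open>H \<times> H\<close> are irrelevant.
\<close>

locale is_rkhs =
  fixes X :: "'x set" and k :: "'x \<Rightarrow> 'x \<Rightarrow> complex"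
    and H :: "('x \<Rightarrow> complex) set"
    and ip :: "('x \<Rightarrow> complex) \<Rightarrow> ('x \<Rightarrow> complex) \<Rightarrow> complex"
  assumes vanish_off: "f \<in> H \<Longrightarrow> x \<notin> X \<Longrightarrow> f x = 0"
    and zero_mem: "(\<lambda>_. 0) \<in> H"
    and add_mem: "f \<in> H \<Longrightarrow> g \<in> H \<Longrightarrow> (\<lambda>x. f x + g x) \<in> H"
    and scale_mem: "f \<in> H \<Longrightarrow> (\<lambda>x. c * f x) \<in> H"
    and ip_add: "f \<in> H \<Longrightarrow> g \<in> H \<Longrightarrow> h \<in> H \<Longrightarrow> ip (\<lambda>x. f x + g x) h = ip f h + ip g h"
    and ip_scale: "f \<in> H \<Longrightarrow> g \<in> H \<Longrightarrow> ip (\<lambda>x. c * f x) g = c * ip f g"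
    and ip_commute: "f \<in> H \<Longrightarrow> g \<in> H \<Longrightarrow> ip g f = cnj (ip f g)"
    and ip_nonneg: "f \<in> H \<Longrightarrow> 0 \<le> Re (ip f f)"
    and ip_definite: "f \<in> H \<Longrightarrow> ip f f = 0 \<Longrightarrow> f = (\<lambda>_. 0)"
    and complete: "(\<And>n. s n \<in> H) \<Longrightarrow>
        (\<And>e. e > 0 \<Longrightarrow> \<exists>M. \<forall>m\<ge>M. \<forall>n\<ge>M.
           sqrt (Re (ip (\<lambda>x. s m x - s n x) (\<lambda>x. s m x - s n x))) < e) \<Longrightarrow>
        \<exists>f\<in>H. (\<lambda>n. sqrt (Re (ip (\<lambda>x. s n x - f x) (\<lambda>x. s n x - f x)))) \<longlonglongrightarrow> 0"
    and kernel_mem: "w \<in> X \<Longrightarrow> kernel_fun X k w \<in> H"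
    and reproducing: "f \<in> H \<Longrightarrow> w \<in> X \<Longrightarrow> f w = ip f (kernel_fun X k w)"

text \<open>
  For a kernel, such a space exists (Moore--Aronszajn, \<open>is_rkhs_rkhs\<close> below); \<open>H\<close> and the
  restriction of \<open>ip\<close> to it are uniquely determined by \<open>k\<close>.
\<close>

definition rkhs_space_ip ::
    "'x set \<Rightarrow> ('x \<Rightarrow> 'x \<Rightarrow> complex) \<Rightarrow>
     ('x \<Rightarrow> complex) set \<times> (('x \<Rightarrow> complex) \<Rightarrow> ('x \<Rightarrow> complex) \<Rightarrow> complex)" where
  "rkhs_space_ip X k = (SOME p. is_rkhs X k (fst p) (snd p))"

definition rkhs :: "'x set \<Rightarrow> ('x \<Rightarrow> 'x \<Rightarrow> complex) \<Rightarrow> ('x \<Rightarrow> complex) set" where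
  "rkhs X k = fst (rkhs_space_ip X k)"

definition rkhs_ip ::
    "'x set \<Rightarrow> ('x \<Rightarrow> 'x \<Rightarrow> complex) \<Rightarrow> ('x \<Rightarrow> complex) \<Rightarrow> ('x \<Rightarrow> complex) \<Rightarrow> complex" where
  "rkhs_ip X k = snd (rkhs_space_ip X k)"

definition rkhs_norm :: "'x set \<Rightarrow> ('x \<Rightarrow> 'x \<Rightarrow> complex) \<Rightarrow> ('x \<Rightarrow> complex) \<Rightarrow> real" where
  "rkhs_norm X k f = sqrt (Re (rkhs_ip X k f f))"

section \<open>Contractive multipliers\<close>

text \<open>
  The size \<open>J\<close> of the matrices is a bound variable of the definitions below, so vectors in
  \<open>\<complex>\<^sup>J\<close> and \<open>J \<times> J\<close> matrices are functions of indices \<open>i, j < J\<close> (other values are never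
  used). Elements of \<open>H \<otimes> \<complex>\<^sup>J\<close> are \<open>J\<close>-tuples of elements of \<open>H\<close>.
\<close>

definition tensor_space ::
    "'x set \<Rightarrow> ('x \<Rightarrow> 'x \<Rightarrow> complex) \<Rightarrow> nat \<Rightarrow> (nat \<Rightarrow> 'x \<Rightarrow> complex) set" where
  "tensor_space X k J = {f. \<forall>j<J. f j \<in> rkhs X k}"

definition tensor_norm ::
    "'x set \<Rightarrow> ('x \<Rightarrow> 'x \<Rightarrow> complex) \<Rightarrow> nat \<Rightarrow> (nat \<Rightarrow> 'x \<Rightarrow> complex) \<Rightarrow> real" where
  "tensor_norm X k J f = sqrt (\<Sum>j<J. (rkhs_norm X k (f j))\<^sup>2)"

definition mult_op ::
    "'x set \<Rightarrow> nat \<Rightarrow> ('x \<Rightarrow> nat \<Rightarrow> nat \<Rightarrow> complex) \<Rightarrow>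
     (nat \<Rightarrow> 'x \<Rightarrow> complex) \<Rightarrow> nat \<Rightarrow> 'x \<Rightarrow> complex" where
  "mult_op X J \<Phi> f = (\<lambda>i z. if z \<in> X then \<Sum>j<J. \<Phi> z i j * f j z else 0)"

definition contractive_multiplier ::
    "'x set \<Rightarrow> ('x \<Rightarrow> 'x \<Rightarrow> complex) \<Rightarrow> ('x \<Rightarrow> 'x \<Rightarrow> complex) \<Rightarrow> nat \<Rightarrow>
     ('x \<Rightarrow> nat \<Rightarrow> nat \<Rightarrow> complex) \<Rightarrow> bool" where
  "contractive_multiplier X k l J \<Phi> \<longleftrightarrow>
     (\<forall>f \<in> tensor_space X k J.
        mult_op X J \<Phi> f \<in> tensor_space X l J \<and>
        tensor_norm X l J (mult_op X J \<Phi> f) \<le> tensor_norm X k J f)"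

section \<open>Diagonal holomorphic kernels\<close>

definition mpow :: "complex ^ 'n \<Rightarrow> nat ^ 'n \<Rightarrow> complex" where
  "mpow z a = (\<Prod>i\<in>UNIV. (z $ i) ^ (a $ i))"

definition holomorphic_on_vec :: "(complex ^ 'n \<Rightarrow> complex) \<Rightarrow> (complex ^ 'n) set \<Rightarrow> bool" where
  "holomorphic_on_vec f \<Omega> \<longleftrightarrow>
     (\<forall>z\<in>\<Omega>. \<exists>f'. (f has_derivative f') (at z) \<and> (\<forall>c v. f' (c *s v) = c * f' v))"

definition is_domain :: "(complex ^ 'n) set \<Rightarrow> bool" where
  "is_domain \<Omega> \<longleftrightarrow> open \<Omega> \<and> connected \<Omega> \<and> \<Omega> \<noteq> {}"

text \<open>
  \<open>f\<close> is a diagonal holomorphic kernel on \<open>\<Omega>\<close> whose power series at \<open>0\<close> has the coefficients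
  \<open>fc\<close>. The series is only required to represent \<open>f\<close> near \<open>(0, 0)\<close>.
\<close>

definition diagonal_holomorphic_kernel ::
    "(complex ^ 'n) set \<Rightarrow> (complex ^ 'n \<Rightarrow> complex ^ 'n \<Rightarrow> complex) \<Rightarrow>
     (nat ^ 'n \<Rightarrow> real) \<Rightarrow> bool" where
  "diagonal_holomorphic_kernel \<Omega> f fc \<longleftrightarrow>
     is_domain \<Omega> \<and> 0 \<in> \<Omega> \<and> kernel_on \<Omega> f \<and>
     (\<forall>w\<in>\<Omega>. holomorphic_on_vec (\<lambda>z. f z w) \<Omega>) \<and>
     (\<forall>z\<in>\<Omega>. holomorphic_on_vec (\<lambda>w. cnj (f z w)) \<Omega>) \<and>
     (\<exists>r>0. ball 0 r \<subseteq> \<Omega> \<and> (\<forall>z\<in>ball 0 r. \<forall>w\<in>ball 0 r.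
        ((\<lambda>a. complex_of_real (fc a) * mpow z a * cnj (mpow w a)) has_sum f z w) UNIV)) \<and>
     (\<forall>a. fc a > 0)"

section \<open>Formal power series and Shimorin certificates\<close>

text \<open>
  A formal power series in the variables \<open>x\<^sub>i\<close>, \<open>i :: 'n\<close>, is its family of coefficients.
  The order on \<open>nat ^ 'n\<close> is componentwise.
\<close>

type_synonym 'n mps = "nat ^ 'n \<Rightarrow> real"

definition mps_one :: "('n::finite) mps" where
  "mps_one = (\<lambda>a. if a = 0 then 1 else 0)"

definition mps_minus :: "('n::finite) mps \<Rightarrow> 'n mps \<Rightarrow> 'n mps" where
  "mps_minus f g = (\<lambda>a. f a - g a)"

definition mps_mult :: "('n::finite) mps \<Rightarrow> 'n mps \<Rightarrow> 'n mps" where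
  "mps_mult f g = (\<lambda>a. \<Sum>b | b \<le> a. f b * g (a - b))"

lemma finite_multiindex_le: "finite {b. b \<le> (a :: nat ^ 'n::finite)}"
proof -
  have "{b. b \<le> a} \<subseteq> vec_lambda ` (PiE UNIV (\<lambda>i. {..a $ i}))"
  proof
    fix b assume "b \<in> {b. b \<le> a}"
    then have "vec_nth b \<in> PiE UNIV (\<lambda>i. {..a $ i})" by (auto simp: less_eq_vec_def)
    then show "b \<in> vec_lambda ` (PiE UNIV (\<lambda>i. {..a $ i}))"
      by (metis image_eqI vec_nth_inverse)
  qed
  then show ?thesis by (rule finite_subset) (auto intro!: finite_imageI finite_PiE)
qed

definition shimorin_certificate :: "('n::finite) mps \<Rightarrow> 'n mps \<Rightarrow> 'n mps \<Rightarrow> bool" where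
  "shimorin_certificate kc lc t \<longleftrightarrow>
     t 0 = 0 \<and> (\<forall>a. t a \<ge> 0) \<and>
     (\<forall>a. mps_mult lc (mps_minus mps_one t) a \<ge> 0) \<and>
     (\<forall>a. mps_minus mps_one (mps_mult kc (mps_minus mps_one t)) a \<ge> 0)"

section \<open>Complete Caratheodory pairs\<close>

definition co_invariant :: "(nat ^ 'n::finite) set \<Rightarrow> bool" where
  "co_invariant F \<longleftrightarrow> F \<noteq> {} \<and> (\<forall>b\<in>F. \<forall>a. a \<le> b \<longrightarrow> a \<in> F)"

definition contraction_matrix :: "'i set \<Rightarrow> ('i \<Rightarrow> 'i \<Rightarrow> complex) \<Rightarrow> bool" where
  "contraction_matrix I A \<longleftrightarrow>
     (\<forall>v. sqrt (\<Sum>p\<in>I. (cmod (\<Sum>q\<in>I. A p q * v q))\<^sup>2) \<le> sqrt (\<Sum>q\<in>I. (cmod (v q))\<^sup>2))"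

text \<open>The block matrix is indexed by pairs (index of the block, index inside the block).\<close>

definition caratheodory_matrix ::
    "('n::finite) mps \<Rightarrow> 'n mps \<Rightarrow> (nat ^ 'n \<Rightarrow> nat \<Rightarrow> nat \<Rightarrow> complex) \<Rightarrow>
     (nat ^ 'n) \<times> nat \<Rightarrow> (nat ^ 'n) \<times> nat \<Rightarrow> complex" where
  "caratheodory_matrix kc lc c = (\<lambda>(a, i) (b, j).
     if a \<le> b then c (b - a) i j * complex_of_real (sqrt (kc a / lc b)) else 0)"

text \<open>
  \<open>kc\<close> and \<open>lc\<close> are the power series coefficients of \<open>k\<close> and \<open>l\<close>. The family \<open>c'\<close> below is the
  extension of \<open>c\<close> from \<open>F\<close> to all multi-indices. That \<open>\<Phi> z = \<Sum>\<^sub>a z\<^sup>a c'\<^sub>a\<^sup>*\<close> is a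
  function on \<open>\<Omega>\<close> includes the (unconditional, entrywise) convergence of the series at every point
  of \<open>\<Omega>\<close>.
\<close>

definition complete_caratheodory_pair ::
    "(complex ^ 'n::finite) set \<Rightarrow>
     (complex ^ 'n \<Rightarrow> complex ^ 'n \<Rightarrow> complex) \<Rightarrow> 'n mps \<Rightarrow>
     (complex ^ 'n \<Rightarrow> complex ^ 'n \<Rightarrow> complex) \<Rightarrow> 'n mps \<Rightarrow> bool" where
  "complete_caratheodory_pair \<Omega> k kc l lc \<longleftrightarrow>
     (\<forall>J\<ge>1. \<forall>F. finite F \<and> co_invariant F \<longrightarrow>
       (\<forall>c. contraction_matrix (F \<times> {..<J}) (caratheodory_matrix kc lc c) \<longleftrightarrow>
         (\<exists>c' \<Phi>. (\<forall>a\<in>F. c' a = c a) \<and>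
            (\<forall>z\<in>\<Omega>. \<forall>i<J. \<forall>j<J.
               ((\<lambda>a. mpow z a * cnj (c' a j i)) has_sum \<Phi> z i j) UNIV) \<and>
            contractive_multiplier \<Omega> k l J \<Phi>)))"

section \<open>Existence of the reproducing kernel Hilbert space\<close>

locale semi_ip =
  fixes V :: "'v set" and add :: "'v \<Rightarrow> 'v \<Rightarrow> 'v" and scl :: "complex \<Rightarrow> 'v \<Rightarrow> 'v"
    and Q :: "'v \<Rightarrow> 'v \<Rightarrow> complex"
  assumes add_in: "u \<in> V \<Longrightarrow> v \<in> V \<Longrightarrow> add u v \<in> V"
    and scl_in: "u \<in> V \<Longrightarrow> scl c u \<in> V"
    and Q_add: "u \<in> V \<Longrightarrow> v \<in> V \<Longrightarrow> w \<in> V \<Longrightarrow> Q (add u v) w = Q u w + Q v w"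
    and Q_scl: "u \<in> V \<Longrightarrow> v \<in> V \<Longrightarrow> Q (scl c u) v = c * Q u v"
    and Q_comm: "u \<in> V \<Longrightarrow> v \<in> V \<Longrightarrow> Q v u = cnj (Q u v)"
    and Q_nonneg: "u \<in> V \<Longrightarrow> 0 \<le> Re (Q u u)"
begin

definition nrm where "nrm v = sqrt (Re (Q v v))"
definition sub where "sub u v = add u (scl (-1) v)"

lemma sub_in: "u \<in> V \<Longrightarrow> v \<in> V \<Longrightarrow> sub u v \<in> V"
  by (simp add: sub_def add_in scl_in)

lemma Q_add_r: "u \<in> V \<Longrightarrow> v \<in> V \<Longrightarrow> w \<in> V \<Longrightarrow> Q w (add u v) = Q w u + Q w v"
  by (metis Q_add Q_comm add_in complex_cnj_add)

lemma Q_scl_r: "u \<in> V \<Longrightarrow> v \<in> V \<Longrightarrow> Q u (scl c v) = cnj c * Q u v"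
  by (metis Q_comm Q_scl scl_in complex_cnj_mult)

lemma Q_sub: "u \<in> V \<Longrightarrow> v \<in> V \<Longrightarrow> w \<in> V \<Longrightarrow> Q (sub u v) w = Q u w - Q v w"
  by (simp add: sub_def Q_add Q_scl scl_in)

lemma Q_sub_r: "u \<in> V \<Longrightarrow> v \<in> V \<Longrightarrow> w \<in> V \<Longrightarrow> Q w (sub u v) = Q w u - Q w v"
  by (simp add: sub_def Q_add_r Q_scl_r scl_in)

lemma nrm_nonneg: "v \<in> V \<Longrightarrow> 0 \<le> nrm v"
  by (simp add: nrm_def Q_nonneg)

lemma nrm_sq: "v \<in> V \<Longrightarrow> (nrm v)\<^sup>2 = Re (Q v v)"
  by (simp add: nrm_def Q_nonneg)

lemma Q_self: "v \<in> V \<Longrightarrow> Q v v = complex_of_real ((nrm v)\<^sup>2)"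
  using Q_comm[of v v] by (simp add: nrm_sq complex_eq_iff)

lemma quadratic:
  assumes "u \<in> V" "v \<in> V"
  shows "(nrm u)\<^sup>2 - 2 * s * (cmod (Q u v))\<^sup>2 + s\<^sup>2 * (cmod (Q u v))\<^sup>2 * (nrm v)\<^sup>2 \<ge> 0"
proof -
  define q where "q = Q u v"
  define w where "w = add u (scl (- (of_real s) * q) v)"
  have wV: "w \<in> V" using assms by (simp add: w_def add_in scl_in)
  have vu: "Q v u = cnj q" using assms by (simp add: q_def Q_comm[of u v])
  have "Q w w = Q u u - of_real s * cnj q * q - of_real s * q * cnj q
      + of_real s * q * of_real s * cnj q * Q v v"
    using assms vu unfolding w_def
    by (simp add: Q_add Q_add_r Q_scl Q_scl_r add_in scl_in q_def[symmetric] algebra_simps)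
  also have "\<dots> = complex_of_real ((nrm u)\<^sup>2 - 2 * s * (cmod q)\<^sup>2 + s\<^sup>2 * (cmod q)\<^sup>2 * (nrm v)\<^sup>2)"
  proof -
    have "q * cnj q = complex_of_real ((cmod q)\<^sup>2)"
      by (simp add: complex_norm_square[symmetric])
    then show ?thesis using Q_self assms
      by (simp add: algebra_simps power2_eq_square flip: of_real_mult)
        (simp add: mult.assoc[symmetric])
  qed
  finally have "Re (Q w w) = (nrm u)\<^sup>2 - 2 * s * (cmod q)\<^sup>2 + s\<^sup>2 * (cmod q)\<^sup>2 * (nrm v)\<^sup>2"
    by (simp only: Re_complex_of_real)
  then show ?thesis using Q_nonneg[OF wV] by (simp add: q_def)
qed

lemma cauchy_schwarz:
  assumes "u \<in> V" "v \<in> V"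
  shows "cmod (Q u v) \<le> nrm u * nrm v"
proof -
  have "(cmod (Q u v))\<^sup>2 \<le> (nrm u)\<^sup>2 * (nrm v)\<^sup>2"
  proof (cases "nrm v = 0")
    case True
    have "cmod (Q u v) = 0"
    proof (rule ccontr)
      assume nz: "cmod (Q u v) \<noteq> 0"
      have "(nrm u)\<^sup>2 - 2 * (((nrm u)\<^sup>2 + 1) / (cmod (Q u v))\<^sup>2) * (cmod (Q u v))\<^sup>2 \<ge> 0"
        using quadratic[OF assms, of "((nrm u)\<^sup>2 + 1) / (cmod (Q u v))\<^sup>2"] True by simp
      then have "(nrm u)\<^sup>2 - 2 * ((nrm u)\<^sup>2 + 1) \<ge> 0" using nz by simp
      then show False using zero_le_power2[of "nrm u"] by (smt (verit))
    qed
    then show ?thesis by simp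
  next
    case False
    have "(nrm u)\<^sup>2 - (cmod (Q u v))\<^sup>2 / (nrm v)\<^sup>2 \<ge> 0"
      using quadratic[OF assms, of "1 / (nrm v)\<^sup>2"] False
      by (simp add: power2_eq_square)
    then show ?thesis using False by (simp add: field_simps)
  qed
  then have "(cmod (Q u v))\<^sup>2 \<le> (nrm u * nrm v)\<^sup>2" by (simp add: power_mult_distrib)
  then show ?thesis
    using assms by (auto intro!: power2_le_imp_le mult_nonneg_nonneg nrm_nonneg)
qed

lemma nrm_add:
  assumes "u \<in> V" "v \<in> V"
  shows "nrm (add u v) \<le> nrm u + nrm v"
proof -
  have "(nrm (add u v))\<^sup>2 = Re (Q u u) + Re (Q u v) + Re (Q v u) + Re (Q v v)"
    using assms by (simp add: nrm_sq add_in Q_add Q_add_r)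
  also have "\<dots> = (nrm u)\<^sup>2 + 2 * Re (Q u v) + (nrm v)\<^sup>2"
    using assms by (simp add: nrm_sq Q_comm[of u v])
  also have "\<dots> \<le> (nrm u)\<^sup>2 + 2 * (nrm u * nrm v) + (nrm v)\<^sup>2"
    using cauchy_schwarz[OF assms] complex_Re_le_cmod[of "Q u v"] by linarith
  also have "\<dots> = (nrm u + nrm v)\<^sup>2" by (simp add: power2_eq_square algebra_simps)
  finally show ?thesis
    using assms by (auto intro!: power2_le_imp_le add_nonneg_nonneg nrm_nonneg)
qed

lemma nrm_scl: "v \<in> V \<Longrightarrow> nrm (scl c v) = cmod c * nrm v"
proof -
  assume v: "v \<in> V"
  have "Q (scl c v) (scl c v) = (c * cnj c) * Q v v"
    using v by (simp add: Q_scl Q_scl_r scl_in)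
  also have "\<dots> = complex_of_real ((cmod c)\<^sup>2 * (nrm v)\<^sup>2)"
    using v by (simp add: Q_self complex_norm_square[symmetric])
  finally show ?thesis using v
    by (simp add: nrm_def[of "scl c v"] real_sqrt_mult nrm_nonneg del: of_real_mult)
qed

lemma nrm_sub_sq:
  assumes "u \<in> V" "v \<in> V"
  shows "(nrm (sub u v))\<^sup>2 = Re (Q u u) - 2 * Re (Q u v) + Re (Q v v)"
  using assms by (simp add: nrm_sq sub_in Q_sub Q_sub_r Q_comm[of u v])

lemma nrm_sub_tri:
  assumes "u \<in> V" "v \<in> V" "w \<in> V"
  shows "nrm (sub u w) \<le> nrm (sub u v) + nrm (sub v w)"
proof -
  have "Q (sub u w) (sub u w) = Q (add (sub u v) (sub v w)) (add (sub u v) (sub v w))"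
    using assms by (simp add: sub_in Q_sub Q_sub_r Q_add Q_add_r add_in algebra_simps)
  then have "nrm (sub u w) = nrm (add (sub u v) (sub v w))" by (simp add: nrm_def)
  then show ?thesis using nrm_add assms by (simp add: sub_in)
qed

lemma nrm_sub_comm: "u \<in> V \<Longrightarrow> v \<in> V \<Longrightarrow> nrm (sub u v) = nrm (sub v u)"
  by (simp add: nrm_def sub_in Q_sub Q_sub_r algebra_simps)

lemma nrm_le_sub: "u \<in> V \<Longrightarrow> v \<in> V \<Longrightarrow> nrm u \<le> nrm (sub u v) + nrm v"
proof -
  assume uv: "u \<in> V" "v \<in> V"
  have "Q u u = Q (add (sub u v) v) (add (sub u v) v)"
    using uv by (simp add: sub_in Q_sub Q_sub_r Q_add Q_add_r add_in algebra_simps)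
  then have "nrm u = nrm (add (sub u v) v)" by (simp add: nrm_def)
  then show ?thesis using nrm_add uv by (simp add: sub_in)
qed

definition cau :: "(nat \<Rightarrow> 'v) \<Rightarrow> bool" where
  "cau s \<longleftrightarrow> (\<forall>n. s n \<in> V) \<and> (\<forall>e>0. \<exists>M. \<forall>m\<ge>M. \<forall>n\<ge>M. nrm (sub (s m) (s n)) < e)"

lemma cauV: "cau s \<Longrightarrow> s n \<in> V" by (simp add: cau_def)

lemma cauD: "cau s \<Longrightarrow> e > 0 \<Longrightarrow> \<exists>M. \<forall>m\<ge>M. \<forall>n\<ge>M. nrm (sub (s m) (s n)) < e"
  by (simp add: cau_def)

lemma cau_bounded:
  assumes "cau s"
  obtains B where "B > 0" "eventually (\<lambda>n. nrm (s n) \<le> B) sequentially"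
proof -
  obtain M where M: "\<And>m n. m \<ge> M \<Longrightarrow> n \<ge> M \<Longrightarrow> nrm (sub (s m) (s n)) < 1"
    using cauD[OF assms, of 1] by auto
  have "nrm (s n) \<le> 1 + nrm (s M)" if "n \<ge> M" for n
    using nrm_le_sub[of "s n" "s M"] M[of n M] that cauV[OF assms] by force
  then have "eventually (\<lambda>n. nrm (s n) \<le> 1 + nrm (s M)) sequentially"
    by (auto simp: eventually_sequentially)
  moreover have "1 + nrm (s M) > 0" using nrm_nonneg[OF cauV[OF assms], of M] by simp
  ultimately show ?thesis using that by blast
qed

lemma cau_const: "v \<in> V \<Longrightarrow> cau (\<lambda>_. v)"
  by (simp add: cau_def nrm_def Q_sub Q_sub_r sub_in)

lemma cau_scl: "cau s \<Longrightarrow> cau (\<lambda>n. scl c (s n))"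
proof -
  assume s: "cau s"
  have eq: "nrm (sub (scl c (s m)) (scl c (s n))) = cmod c * nrm (sub (s m) (s n))" for m n
  proof -
    have "Q (sub (scl c (s m)) (scl c (s n))) (sub (scl c (s m)) (scl c (s n)))
       = Q (scl c (sub (s m) (s n))) (scl c (sub (s m) (s n)))"
      using cauV[OF s] by (simp add: sub_in scl_in Q_sub Q_sub_r Q_scl Q_scl_r algebra_simps)
    then show ?thesis using nrm_scl cauV[OF s] by (simp add: nrm_def[of "sub (scl _ _) _"]
        nrm_def[of "scl c (sub _ _)", symmetric] sub_in)
  qed
  have "\<exists>M. \<forall>m\<ge>M. \<forall>n\<ge>M. cmod c * nrm (sub (s m) (s n)) < e" if "e > 0" for e
  proof -
    have "e / (cmod c + 1) > 0" using that by (simp add: add_nonneg_pos)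
    then obtain M where M: "\<And>m n. m \<ge> M \<Longrightarrow> n \<ge> M \<Longrightarrow> nrm (sub (s m) (s n)) < e / (cmod c + 1)"
      using cauD[OF s] by blast
    have "cmod c * nrm (sub (s m) (s n)) < e" if "m \<ge> M" "n \<ge> M" for m n
    proof -
      have "cmod c * nrm (sub (s m) (s n)) \<le> (cmod c + 1) * nrm (sub (s m) (s n))"
        using nrm_nonneg cauV[OF s] by (simp add: sub_in mult_right_mono)
      also have "\<dots> < (cmod c + 1) * (e / (cmod c + 1))"
        using M[OF that] by (intro mult_strict_left_mono) (auto simp: add_nonneg_pos)
      also have "\<dots> = e" using norm_ge_zero[of c] by (simp add: field_simps add_nonneg_eq_0_iff)
      finally show ?thesis .
    qed
    then show ?thesis by blast
  qed
  then show ?thesis using cauV[OF s] by (simp add: cau_def scl_in eq)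
qed

lemma cau_add: "cau s \<Longrightarrow> cau t \<Longrightarrow> cau (\<lambda>n. add (s n) (t n))"
proof -
  assume s: "cau s" and t: "cau t"
  have le: "nrm (sub (add (s m) (t m)) (add (s n) (t n)))
      \<le> nrm (sub (s m) (s n)) + nrm (sub (t m) (t n))" for m n
  proof -
    have "Q (sub (add (s m) (t m)) (add (s n) (t n))) (sub (add (s m) (t m)) (add (s n) (t n)))
      = Q (add (sub (s m) (s n)) (sub (t m) (t n))) (add (sub (s m) (s n)) (sub (t m) (t n)))"
      using cauV[OF s] cauV[OF t]
      by (simp add: sub_in add_in Q_sub Q_sub_r Q_add Q_add_r algebra_simps)
    then have "nrm (sub (add (s m) (t m)) (add (s n) (t n)))
       = nrm (add (sub (s m) (s n)) (sub (t m) (t n)))" by (simp add: nrm_def)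
    then show ?thesis using nrm_add cauV[OF s] cauV[OF t] by (simp add: sub_in)
  qed
  have "\<exists>M. \<forall>m\<ge>M. \<forall>n\<ge>M. nrm (sub (add (s m) (t m)) (add (s n) (t n))) < e" if e: "e > 0" for e
  proof -
    obtain M1 where M1: "\<And>m n. m \<ge> M1 \<Longrightarrow> n \<ge> M1 \<Longrightarrow> nrm (sub (s m) (s n)) < e / 2"
      using cauD[OF s half_gt_zero[OF e]] by blast
    obtain M2 where M2: "\<And>m n. m \<ge> M2 \<Longrightarrow> n \<ge> M2 \<Longrightarrow> nrm (sub (t m) (t n)) < e / 2"
      using cauD[OF t half_gt_zero[OF e]] by blast
    have "nrm (sub (add (s m) (t m)) (add (s n) (t n))) < e" if "m \<ge> max M1 M2" "n \<ge> max M1 M2" for m n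
    proof -
      have "nrm (sub (s m) (s n)) < e / 2" "nrm (sub (t m) (t n)) < e / 2"
        using M1 M2 that by auto
      with le[of m n] show ?thesis by linarith
    qed
    then show ?thesis by blast
  qed
  then show ?thesis using cauV[OF s] cauV[OF t] by (simp add: cau_def add_in)
qed

lemma cau_sub: "cau s \<Longrightarrow> cau t \<Longrightarrow> cau (\<lambda>n. sub (s n) (t n))"
  by (simp add: sub_def cau_add cau_scl)

lemma Q_convergent:
  assumes s: "cau s" and t: "cau t"
  shows "convergent (\<lambda>n. Q (s n) (t n))"
proof -
  obtain B where B: "B > 0" "eventually (\<lambda>n. nrm (s n) \<le> B) sequentially"
    using cau_bounded[OF s] by blast
  obtain C where C: "C > 0" "eventually (\<lambda>n. nrm (t n) \<le> C) sequentially"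
    using cau_bounded[OF t] by blast
  have "Cauchy (\<lambda>n. Q (s n) (t n))"
  proof (rule metric_CauchyI)
    fix e :: real assume e: "e > 0"
    obtain M0 where M0: "\<And>n. n \<ge> M0 \<Longrightarrow> nrm (s n) \<le> B" "\<And>n. n \<ge> M0 \<Longrightarrow> nrm (t n) \<le> C"
      using eventually_conj[OF B(2) C(2)] by (auto simp: eventually_sequentially)
    obtain M1 where M1: "\<And>m n. m \<ge> M1 \<Longrightarrow> n \<ge> M1 \<Longrightarrow> nrm (sub (s m) (s n)) < e / (2 * C)"
      using cauD[OF s, of "e/(2 * C)"] e C by auto
    obtain M2 where M2: "\<And>m n. m \<ge> M2 \<Longrightarrow> n \<ge> M2 \<Longrightarrow> nrm (sub (t m) (t n)) < e / (2 * B)"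
      using cauD[OF t, of "e/(2 * B)"] e B by auto
    have "dist (Q (s m) (t m)) (Q (s n) (t n)) < e"
      if "m \<ge> max M0 (max M1 M2)" "n \<ge> max M0 (max M1 M2)" for m n
    proof -
      note sV = cauV[OF s] and tV = cauV[OF t]
      have "Q (s m) (t m) - Q (s n) (t n) = Q (sub (s m) (s n)) (t m) + Q (s n) (sub (t m) (t n))"
        using sV tV by (simp add: Q_sub Q_sub_r)
      then have "dist (Q (s m) (t m)) (Q (s n) (t n))
          \<le> cmod (Q (sub (s m) (s n)) (t m)) + cmod (Q (s n) (sub (t m) (t n)))"
        by (simp add: dist_norm norm_triangle_ineq)
      also have "\<dots> \<le> nrm (sub (s m) (s n)) * nrm (t m) + nrm (s n) * nrm (sub (t m) (t n))"
        using sV tV by (intro add_mono cauchy_schwarz) (auto simp: sub_in)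
      also have "\<dots> \<le> nrm (sub (s m) (s n)) * C + B * nrm (sub (t m) (t n))"
        using M0 that sV tV
        by (intro add_mono mult_left_mono mult_right_mono) (auto simp: sub_in nrm_nonneg)
      also have "\<dots> < e / (2 * C) * C + B * (e / (2 * B))"
        using M1 M2 that B C
        by (intro add_strict_mono mult_strict_left_mono mult_strict_right_mono) auto
      also have "\<dots> = e" using B C by simp
      finally show ?thesis .
    qed
    then show "\<exists>M. \<forall>m\<ge>M. \<forall>n\<ge>M. dist (Q (s m) (t m)) (Q (s n) (t n)) < e" by blast
  qed
  then show ?thesis by (rule Cauchy_convergent)
qed

lemma Q_lim_zero:
  assumes s: "cau s" and t: "cau t" and z: "\<And>v. v \<in> V \<Longrightarrow> (\<lambda>n. Q (s n) v) \<longlonglongrightarrow> 0"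
  shows "(\<lambda>n. Q (s n) (t n)) \<longlonglongrightarrow> 0"
proof (rule LIMSEQ_I)
  fix e :: real assume e: "e > 0"
  note sV = cauV[OF s] and tV = cauV[OF t]
  obtain B where B: "B > 0" "eventually (\<lambda>n. nrm (s n) \<le> B) sequentially"
    using cau_bounded[OF s] by blast
  obtain M0 where M0: "\<And>n. n \<ge> M0 \<Longrightarrow> nrm (s n) \<le> B"
    using B(2) by (auto simp: eventually_sequentially)
  obtain M where M: "\<And>m n. m \<ge> M \<Longrightarrow> n \<ge> M \<Longrightarrow> nrm (sub (t m) (t n)) < e / (2 * B)"
    using cauD[OF t, of "e/(2 * B)"] e B by auto
  obtain M1 where M1: "\<And>n. n \<ge> M1 \<Longrightarrow> cmod (Q (s n) (t M)) < e / 2"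
    using LIMSEQ_D[OF z[OF tV[of M]], of "e/2"] e by auto
  have "norm (Q (s n) (t n) - 0) < e" if "n \<ge> max M0 (max M M1)" for n
  proof -
    have "Q (s n) (t n) = Q (s n) (sub (t n) (t M)) + Q (s n) (t M)"
      using sV tV by (simp add: Q_sub_r)
    then have "cmod (Q (s n) (t n)) \<le> cmod (Q (s n) (sub (t n) (t M))) + cmod (Q (s n) (t M))"
      by (simp add: norm_triangle_ineq)
    also have "\<dots> \<le> nrm (s n) * nrm (sub (t n) (t M)) + cmod (Q (s n) (t M))"
      using sV tV by (intro add_mono cauchy_schwarz) (auto simp: sub_in)
    also have "\<dots> \<le> B * nrm (sub (t n) (t M)) + cmod (Q (s n) (t M))"
      using M0 that sV tV by (intro add_mono mult_right_mono) (auto simp: sub_in nrm_nonneg)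
    also have "\<dots> < B * (e / (2 * B)) + e / 2"
      using M[of n M] M1 that B by (intro add_strict_mono mult_strict_left_mono) auto
    also have "\<dots> = e" using B by simp
    finally show ?thesis by simp
  qed
  then show "\<exists>no. \<forall>n\<ge>no. norm (Q (s n) (t n) - 0) < e" by blast
qed

end

text \<open>
  Formal finite combinations \<open>\<Sum> c\<^sub>i k(\<cdot>, x\<^sub>i)\<close> are lists of pairs \<open>(c\<^sub>i, x\<^sub>i)\<close>; \<open>H\<close> consists of the
  pointwise limits of Cauchy sequences of such combinations.
\<close>

definition pre_ip :: "('x \<Rightarrow> 'x \<Rightarrow> complex) \<Rightarrow> (complex \<times> 'x) list \<Rightarrow> (complex \<times> 'x) list \<Rightarrow> complex"
  where "pre_ip k xs ys = (\<Sum>(d, y)\<leftarrow>ys. \<Sum>(c, x)\<leftarrow>xs. cnj d * k y x * c)"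

lemma pre_ip_nth:
  "pre_ip k xs ys = (\<Sum>j<length ys. \<Sum>i<length xs.
     cnj (fst (ys ! j)) * k (snd (ys ! j)) (snd (xs ! i)) * fst (xs ! i))"
  by (simp add: pre_ip_def sum_list_sum_nth case_prod_unfold atLeast0LessThan)

lemma psd_herm:
  assumes "psd_matrix n A" "i < n" "j < n"
  shows "A j i = cnj (A i j)"
proof -
  define S where "S v = (\<Sum>i<n. \<Sum>j<n. cnj (v i) * A i j * v j)" for v
  have ImS: "Im (S v) = 0" for v
    using assms(1) by (auto simp: psd_matrix_def S_def complex_is_Real_iff)
  have diag: "S (\<lambda>p. if p = i then c else 0) = cnj c * A i i * c" if "i < n" for i c
  proof -
    have "S (\<lambda>p. if p = i then c else 0) =
       (\<Sum>p<n. \<Sum>q<n. if p = i then (if q = i then cnj c * A i i * c else 0) else 0)"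
      unfolding S_def by (intro sum.cong) auto
    also have "\<dots> = (\<Sum>p<n. if p = i then cnj c * A i i * c else 0)"
      using that by (intro sum.cong) auto
    finally show ?thesis using that by simp
  qed
  have ImD: "Im (A i i) = 0" if "i < n" for i
    using ImS[of "\<lambda>p. if p = i then 1 else 0"] diag[OF that, of 1] by simp
  show ?thesis
  proof (cases "i = j")
    case True
    then show ?thesis using ImD[OF assms(2)] by (simp add: complex_eq_iff)
  next
    case False
    have two: "S (\<lambda>p. if p = i then a else if p = j then b else 0) =
        cnj a * A i i * a + cnj a * A i j * b + cnj b * A j i * a + cnj b * A j j * b" for a b
    proof -
      have inner: "(\<Sum>q<n. c * A p q * (if q = i then a else if q = j then b else 0))
          = c * A p i * a + c * A p j * b" for c p
      proof -
        have "(\<Sum>q<n. c * A p q * (if q = i then a else if q = j then b else 0))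
           = (\<Sum>q<n. (if q = i then c * A p i * a else 0) + (if q = j then c * A p j * b else 0))"
          using False by (intro sum.cong) auto
        then show ?thesis using assms by (simp add: sum.distrib)
      qed
      have "S (\<lambda>p. if p = i then a else if p = j then b else 0) =
        (\<Sum>p<n. (if p = i then cnj a * A i i * a + cnj a * A i j * b else 0)
              + (if p = j then cnj b * A j i * a + cnj b * A j j * b else 0))"
        unfolding S_def inner using False by (intro sum.cong) auto
      then show ?thesis using assms by (simp add: sum.distrib algebra_simps)
    qed
    have "Im (A i j) + Im (A j i) = 0"
      using ImS[of "\<lambda>p. if p = i then 1 else if p = j then 1 else 0"] ImD assms
      unfolding two by simp
    moreover have "Re (A i j) - Re (A j i) = 0"
      using ImS[of "\<lambda>p. if p = i then 1 else if p = j then \<i> else 0"] ImD assms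
      unfolding two by simp
    ultimately show ?thesis by (simp add: complex_eq_iff)
  qed
qed

lemma kernel_on_herm:
  assumes "kernel_on X k" "x \<in> X" "y \<in> X"
  shows "k y x = cnj (k x y)"
proof -
  define z where "z i = (if i = (0::nat) then x else y)" for i
  have "\<forall>i<2. z i \<in> X" using assms by (simp add: z_def)
  then have "psd_matrix 2 (\<lambda>i j. k (z i) (z j))"
    using assms(1) unfolding kernel_on_def by blast
  from psd_herm[OF this, of 0 1] show ?thesis by (simp add: z_def)
qed

lemma semi_ip_pre:
  assumes "kernel_on X k"
  shows "semi_ip {xs. snd ` set xs \<subseteq> X} (@) (\<lambda>c. map (map_prod ((*) c) id)) (pre_ip k)"
proof
  fix u v w :: "(complex \<times> 'a) list"
  show "pre_ip k (u @ v) w = pre_ip k u w + pre_ip k v w"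
    by (simp add: pre_ip_def sum_list_addf case_prod_unfold)
next
  fix u v :: "(complex \<times> 'a) list" and c
  show "pre_ip k (map (map_prod ((*) c) id) u) v = c * pre_ip k u v"
    by (simp add: pre_ip_def sum_list_const_mult[symmetric] case_prod_unfold o_def algebra_simps)
next
  fix u v :: "(complex \<times> 'a) list" assume "u \<in> {xs. snd ` set xs \<subseteq> X}" "v \<in> {xs. snd ` set xs \<subseteq> X}"
  then have "cnj (k (snd (v ! j)) (snd (u ! i))) = k (snd (u ! i)) (snd (v ! j))"
    if "i < length u" "j < length v" for i j
    using kernel_on_herm[OF assms, of "snd (v ! j)" "snd (u ! i)"] that by (force)
  then show "pre_ip k v u = cnj (pre_ip k u v)"
    unfolding pre_ip_nth cnj_sum
    by (subst sum.swap) (auto intro!: sum.cong)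
next
  fix u :: "(complex \<times> 'a) list" assume "u \<in> {xs. snd ` set xs \<subseteq> X}"
  then have "\<forall>i<length u. snd (u ! i) \<in> X" by (auto simp: image_subset_iff)
  then have "psd_matrix (length u) (\<lambda>i j. k (snd (u ! i)) (snd (u ! j)))"
    using assms[unfolded kernel_on_def, THEN conjunct2, rule_format, of "length u" "\<lambda>i. snd (u ! i)"]
    by blast
  then show "0 \<le> Re (pre_ip k u u)"
    by (simp add: psd_matrix_def pre_ip_nth)
qed force+

lemma kernel_on_imp_ex_rkhs:
  assumes ker: "kernel_on X k"
  shows "\<exists>H ip. is_rkhs X k H ip"
proof -
  define V where "V = {xs :: (complex \<times> 'a) list. snd ` set xs \<subseteq> X}"
  interpret P: semi_ip V "(@)" "\<lambda>c. map (map_prod ((*) c) id)" "pre_ip k"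
    using semi_ip_pre[OF ker] by (simp add: V_def)
  let ?scl = "\<lambda>c. map (map_prod ((*) (c::complex)) (id :: 'a \<Rightarrow> 'a))"
  have deltaV: "[(1, z)] \<in> V" if "z \<in> X" for z using that by (simp add: V_def)
  have nilV: "[] \<in> V" by (simp add: V_def)
  define pt where "pt s = (\<lambda>z. if z \<in> X then lim (\<lambda>n. pre_ip k (s n) [(1, z)]) else 0)" for s
  have pt_lim: "(\<lambda>n. pre_ip k (s n) [(1, z)]) \<longlonglongrightarrow> pt s z" if "P.cau s" "z \<in> X" for s z
    using P.Q_convergent[OF that(1) P.cau_const[OF deltaV[OF that(2)]]] that(2)
    by (simp add: pt_def convergent_LIMSEQ_iff)
  define H where "H = pt ` {s. P.cau s}"
  define rep where "rep f = (SOME s. P.cau s \<and> pt s = f)" for f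
  have rep: "P.cau (rep f) \<and> pt (rep f) = f" if "f \<in> H" for f
  proof -
    have "\<exists>s. P.cau s \<and> pt s = f" using that unfolding H_def by blast
    then show ?thesis unfolding rep_def by (rule someI_ex)
  qed
  define ip where "ip f g = lim (\<lambda>n. pre_ip k (rep f n) (rep g n))" for f g
  have weak: "(\<lambda>n. pre_ip k (s n) v) \<longlonglongrightarrow> 0" if s: "P.cau s" and z: "pt s = (\<lambda>_. 0)" and v: "v \<in> V" for s v
    using v
  proof (induction v)
    case Nil
    then show ?case by (simp add: pre_ip_def)
  next
    case (Cons p v)
    obtain d y where p: "p = (d, y)" by (cases p)
    from Cons have y: "y \<in> X" and v: "v \<in> V" by (auto simp: V_def p)
    have eq: "pre_ip k u (p # v) = cnj d * pre_ip k u [(1, y)] + pre_ip k u v" for u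
      by (simp add: pre_ip_def p sum_list_const_mult[symmetric] case_prod_unfold algebra_simps)
    have "(\<lambda>n. cnj d * pre_ip k (s n) [(1, y)] + pre_ip k (s n) v) \<longlonglongrightarrow> cnj d * pt s y + 0"
      by (intro tendsto_intros pt_lim s y Cons.IH v)
    then show ?case by (simp add: eq z)
  qed
  have pt_add: "pt (\<lambda>n. s n @ t n) = (\<lambda>z. pt s z + pt t z)" if "P.cau s" "P.cau t" for s t
  proof
    fix z show "pt (\<lambda>n. s n @ t n) z = pt s z + pt t z"
    proof (cases "z \<in> X")
      case True
      have "(\<lambda>n. pre_ip k (s n @ t n) [(1, z)]) \<longlonglongrightarrow> pt s z + pt t z"
        using tendsto_add[OF pt_lim[OF that(1) True] pt_lim[OF that(2) True]]
        by (simp add: P.Q_add P.cauV[OF that(1)] P.cauV[OF that(2)] deltaV[OF True])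
      then show ?thesis
        using LIMSEQ_unique pt_lim[OF P.cau_add[OF that] True] by blast
    qed (simp add: pt_def)
  qed
  have pt_scl: "pt (\<lambda>n. ?scl c (s n)) = (\<lambda>z. c * pt s z)" if "P.cau s" for s c
  proof
    fix z show "pt (\<lambda>n. ?scl c (s n)) z = c * pt s z"
    proof (cases "z \<in> X")
      case True
      have "(\<lambda>n. pre_ip k (?scl c (s n)) [(1, z)]) \<longlonglongrightarrow> c * pt s z"
        using tendsto_mult_left[OF pt_lim[OF that True], of c]
        by (simp add: P.Q_scl P.cauV[OF that(1)] deltaV[OF True])
      then show ?thesis
        using LIMSEQ_unique pt_lim[OF P.cau_scl[OF that] True] by blast
    qed (simp add: pt_def)
  qed
  have pt_sub: "pt (\<lambda>n. P.sub (s n) (t n)) = (\<lambda>z. pt s z - pt t z)" if "P.cau s" "P.cau t" for s t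
    using pt_add[OF that(1) P.cau_scl[OF that(2), of "-1"]] pt_scl[OF that(2), of "-1"]
    by (simp add: P.sub_def)
  have pt_H: "pt s \<in> H" if "P.cau s" for s using that by (simp add: H_def)
  have ip_lim: "(\<lambda>n. pre_ip k (s n) (t n)) \<longlonglongrightarrow> ip (pt s) (pt t)" if s: "P.cau s" and t: "P.cau t" for s t
  proof -
    define s' where "s' = rep (pt s)"
    define t' where "t' = rep (pt t)"
    have s': "P.cau s'" "pt s' = pt s" and t': "P.cau t'" "pt t' = pt t"
      using rep[OF pt_H[OF s]] rep[OF pt_H[OF t]] by (auto simp: s'_def t'_def)
    have 1: "(\<lambda>n. pre_ip k (P.sub (s n) (s' n)) (t n)) \<longlonglongrightarrow> 0"
      by (rule P.Q_lim_zero[OF P.cau_sub[OF s s'(1)] t weak[OF P.cau_sub[OF s s'(1)]]])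
        (simp_all add: pt_sub s s')
    have 2: "(\<lambda>n. pre_ip k (P.sub (t n) (t' n)) (s' n)) \<longlonglongrightarrow> 0"
      by (rule P.Q_lim_zero[OF P.cau_sub[OF t t'(1)] s'(1) weak[OF P.cau_sub[OF t t'(1)]]])
        (simp_all add: pt_sub t t')
    have 3: "(\<lambda>n. pre_ip k (s' n) (P.sub (t n) (t' n))) \<longlonglongrightarrow> 0"
      using tendsto_cnj[OF 2] P.Q_comm[of "P.sub (t _) (t' _)" "s' _"]
        P.cauV[OF s'(1)] P.cauV[OF t] P.cauV[OF t'(1)]
      by (simp add: P.sub_in)
    have 4: "(\<lambda>n. pre_ip k (s' n) (t' n)) \<longlonglongrightarrow> ip (pt s) (pt t)"
      using P.Q_convergent[OF s'(1) t'(1)]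
      by (simp add: ip_def s'_def t'_def convergent_LIMSEQ_iff)
    have "pre_ip k (s n) (t n) = pre_ip k (P.sub (s n) (s' n)) (t n)
        + pre_ip k (s' n) (P.sub (t n) (t' n)) + pre_ip k (s' n) (t' n)" for n
      using P.cauV[OF s'(1)] P.cauV[OF t] P.cauV[OF t'(1)] P.cauV[OF s]
      by (simp add: P.Q_sub P.Q_sub_r)
    then show ?thesis using tendsto_add[OF tendsto_add[OF 1 3] 4] by simp
  qed
  have HE: "\<exists>s. P.cau s \<and> f = pt s" if "f \<in> H" for f using that by (auto simp: H_def)
  interpret R: semi_ip H "\<lambda>f g x. f x + g x" "\<lambda>c f x. c * f x" ip
  proof
    fix f g assume "f \<in> H" "g \<in> H"
    obtain s where "P.cau s" "f = pt s" using HE[OF \<open>f \<in> H\<close>] by blast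
    moreover obtain t where "P.cau t" "g = pt t" using HE[OF \<open>g \<in> H\<close>] by blast
    ultimately have st: "P.cau s" "f = pt s" "P.cau t" "g = pt t" by auto
    show "(\<lambda>x. f x + g x) \<in> H"
      using pt_H[OF P.cau_add[OF st(1,3)]] by (simp only: pt_add[OF st(1,3)] st(2,4))
    show "(\<lambda>x. c * f x) \<in> H" for c
      using pt_H[OF P.cau_scl[OF st(1)]] by (simp only: pt_scl[OF st(1)] st(2))
    note sV = P.cauV[OF st(1)] and tV = P.cauV[OF st(3)]
    show "ip (\<lambda>x. c * f x) g = c * ip f g" for c
      using ip_lim[OF P.cau_scl[OF st(1), of c] st(3)] tendsto_mult_left[OF ip_lim[OF st(1,3)], of c]
      unfolding P.Q_scl[OF sV tV] pt_scl[OF st(1)] st(2,4)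
      by (rule LIMSEQ_unique)
    show "ip g f = cnj (ip f g)"
      using ip_lim[OF st(3,1)] tendsto_cnj[OF ip_lim[OF st(1,3)]]
      unfolding P.Q_comm[OF sV tV, symmetric] st(2,4)
      by (rule LIMSEQ_unique)
    show "0 \<le> Re (ip f f)"
    proof (rule tendsto_lowerbound)
      show "(\<lambda>n. Re (pre_ip k (s n) (s n))) \<longlonglongrightarrow> Re (ip f f)"
        using tendsto_Re[OF ip_lim[OF st(1,1)]] by (simp only: st(2))
      show "\<forall>\<^sub>F n in sequentially. 0 \<le> Re (pre_ip k (s n) (s n))"
        by (rule always_eventually) (rule allI, rule P.Q_nonneg[OF sV])
    qed simp
    fix h assume "h \<in> H"
    then obtain r where r: "P.cau r" "h = pt r" using HE by blast
    show "ip (\<lambda>x. f x + g x) h = ip f h + ip g h"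
      using ip_lim[OF P.cau_add[OF st(1,3)] r(1)]
        tendsto_add[OF ip_lim[OF st(1) r(1)] ip_lim[OF st(3) r(1)]]
      unfolding P.Q_add[OF sV tV P.cauV[OF r(1)]] pt_add[OF st(1,3)] st(2,4) r(2)
      by (rule LIMSEQ_unique)
  qed
  have Rsub: "R.sub f g = (\<lambda>x. f x - g x)" for f g by (simp add: R.sub_def fun_eq_iff)
  have kf: "kernel_fun X k w = pt (\<lambda>_. [(1, w)])" if "w \<in> X" for w
    by (auto simp: kernel_fun_def pt_def pre_ip_def)
  have repro: "f w = ip f (kernel_fun X k w)" if "f \<in> H" "w \<in> X" for f w
  proof -
    obtain s where s: "P.cau s" "f = pt s" using HE[OF \<open>f \<in> H\<close>] by blast
    show ?thesis
      using pt_lim[OF s(1) that(2)] ip_lim[OF s(1) P.cau_const[OF deltaV[OF that(2)]]]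
      unfolding kf[OF that(2)] s(2)
      by (rule LIMSEQ_unique)
  qed
  have kerH: "kernel_fun X k w \<in> H" if "w \<in> X" for w
    using pt_H P.cau_const[OF deltaV[OF that]] kf[OF that] by simp
  have nrm_lim: "(\<lambda>n. P.nrm (s n)) \<longlonglongrightarrow> R.nrm (pt s)" if "P.cau s" for s
    unfolding P.nrm_def R.nrm_def by (rule tendsto_real_sqrt[OF tendsto_Re[OF ip_lim[OF that that]]])
  have off: "f x = 0" if "f \<in> H" "x \<notin> X" for f x
    using HE[OF that(1)] that(2) by (auto simp: pt_def)
  have "is_rkhs X k H ip"
  proof
    show "(\<lambda>_. 0) \<in> H"
      using pt_H[OF P.cau_const[OF nilV]] by (simp add: pt_def pre_ip_def if_distrib cong: if_cong)
  next
    fix f assume f: "f \<in> H" "ip f f = 0"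
    show "f = (\<lambda>_. 0)"
    proof
      fix x show "f x = 0"
      proof (cases "x \<in> X")
        case True
        have "cmod (f x) \<le> R.nrm f * R.nrm (kernel_fun X k x)"
          using R.cauchy_schwarz[OF f(1) kerH[OF True]] repro[OF f(1) True] by simp
        then show ?thesis using f by (simp add: R.nrm_def)
      qed (use off f in auto)
    qed
  next
    fix F :: "nat \<Rightarrow> 'a \<Rightarrow> complex"
    assume FH: "\<And>n. F n \<in> H"
      and cauF: "\<And>e. e > 0 \<Longrightarrow> \<exists>M. \<forall>m\<ge>M. \<forall>n\<ge>M.
           sqrt (Re (ip (\<lambda>x. F m x - F n x) (\<lambda>x. F m x - F n x))) < e"
    have cF: "\<exists>M. \<forall>m\<ge>M. \<forall>n\<ge>M. R.nrm (R.sub (F m) (F n)) < e" if "e > 0" for e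
      using cauF[OF that] by (simp add: R.nrm_def Rsub)
    have "\<exists>v\<in>V. R.nrm (R.sub (F m) (pt (\<lambda>_. v))) \<le> inverse (real (Suc m))" for m
    proof -
      obtain s where s: "P.cau s" "F m = pt s" using HE[OF FH] by blast
      have "inverse (real (Suc m)) > 0" by simp
      then obtain M where M: "\<And>i j. i \<ge> M \<Longrightarrow> j \<ge> M \<Longrightarrow> P.nrm (P.sub (s i) (s j)) < inverse (real (Suc m))"
        using P.cauD[OF s(1)] by blast
      have c: "P.cau (\<lambda>_. s M)" by (rule P.cau_const[OF P.cauV[OF s(1)]])
      have "R.nrm (R.sub (F m) (pt (\<lambda>_. s M))) \<le> inverse (real (Suc m))"
      proof (rule tendsto_upperbound[OF nrm_lim[OF P.cau_sub[OF s(1) c], unfolded pt_sub[OF s(1) c],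
              folded Rsub s(2)]])
        show "\<forall>\<^sub>F i in sequentially. P.nrm (P.sub (s i) (s M)) \<le> inverse (real (Suc m))"
          unfolding eventually_sequentially using M[of _ M] by (metis less_imp_le order_refl)
      qed simp
      then show ?thesis using P.cauV[OF s(1)] by blast
    qed
    then obtain v where vV: "\<And>m. v m \<in> V"
      and v: "\<And>m. R.nrm (R.sub (F m) (pt (\<lambda>_. v m))) \<le> inverse (real (Suc m))" by metis
    have pc: "P.cau (\<lambda>_. v m)" for m by (rule P.cau_const[OF vV])
    have ptv: "pt (\<lambda>_. v m) \<in> H" for m by (rule pt_H[OF pc])
    have nv: "P.nrm (P.sub (v m) (v n)) = R.nrm (R.sub (pt (\<lambda>_. v m)) (pt (\<lambda>_. v n)))" for m n
      using tendsto_const nrm_lim[OF P.cau_sub[OF pc[of m] pc[of n]]]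
      unfolding pt_sub[OF pc pc] Rsub
      by (rule LIMSEQ_unique)
    have "P.cau v" unfolding P.cau_def
    proof (intro conjI allI impI vV)
      fix e :: real assume e: "e > 0"
      obtain M where M: "\<And>i j. i \<ge> M \<Longrightarrow> j \<ge> M \<Longrightarrow> R.nrm (R.sub (F i) (F j)) < e / 3"
        using cF[of "e/3"] e by auto
      obtain N where N: "inverse (real (Suc N)) < e / 3"
        using reals_Archimedean[of "e/3"] e by auto
      have "P.nrm (P.sub (v m) (v n)) < e" if "m \<ge> max M N" "n \<ge> max M N" for m n
      proof -
        have inv: "inverse (real (Suc i)) < e / 3" if "i \<ge> max M N" for i
          using N that by (intro le_less_trans[OF _ N] le_imp_inverse_le) auto
        have "P.nrm (P.sub (v m) (v n)) \<le> R.nrm (R.sub (pt (\<lambda>_. v m)) (F m)) + R.nrm (R.sub (F m) (pt (\<lambda>_. v n)))"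
          unfolding nv by (rule R.nrm_sub_tri[OF ptv FH ptv])
        also have "R.nrm (R.sub (F m) (pt (\<lambda>_. v n))) \<le> R.nrm (R.sub (F m) (F n)) + R.nrm (R.sub (F n) (pt (\<lambda>_. v n)))"
          by (rule R.nrm_sub_tri[OF FH FH ptv])
        finally show ?thesis
          using v[of m] v[of n] inv[OF that(1)] inv[OF that(2)] M[of m n] that
            R.nrm_sub_comm[OF ptv[of m] FH[of m]] by linarith
      qed
      then show "\<exists>M. \<forall>m\<ge>M. \<forall>n\<ge>M. P.nrm (P.sub (v m) (v n)) < e" by blast
    qed
    note cv = this
    have vlim: "(\<lambda>m. R.nrm (R.sub (pt (\<lambda>_. v m)) (pt v))) \<longlonglongrightarrow> 0"
    proof (rule LIMSEQ_I)
      fix e :: real assume e: "e > 0"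
      obtain M where M: "\<And>i j. i \<ge> M \<Longrightarrow> j \<ge> M \<Longrightarrow> P.nrm (P.sub (v i) (v j)) < e / 2"
        using P.cauD[OF cv, of "e/2"] e by auto
      have "norm (R.nrm (R.sub (pt (\<lambda>_. v m)) (pt v)) - 0) < e" if "m \<ge> M" for m
      proof -
        have "R.nrm (R.sub (pt (\<lambda>_. v m)) (pt v)) \<le> e / 2"
        proof (rule tendsto_upperbound[OF nrm_lim[OF P.cau_sub[OF pc cv], unfolded pt_sub[OF pc cv],
                folded Rsub]])
          show "\<forall>\<^sub>F i in sequentially. P.nrm (P.sub (v m) (v i)) \<le> e / 2"
            unfolding eventually_sequentially using M[OF that] by (metis less_imp_le)
        qed simp
        then show ?thesis using e R.nrm_nonneg[OF R.sub_in[OF ptv pt_H[OF cv]]] by simp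
      qed
      then show "\<exists>no. \<forall>m\<ge>no. norm (R.nrm (R.sub (pt (\<lambda>_. v m)) (pt v)) - 0) < e" by blast
    qed
    have "(\<lambda>n. R.nrm (R.sub (F n) (pt v))) \<longlonglongrightarrow> 0"
    proof (rule tendsto_sandwich[OF _ _ tendsto_const])
      show "\<forall>\<^sub>F n in sequentially. 0 \<le> R.nrm (R.sub (F n) (pt v))"
        using R.nrm_nonneg[OF R.sub_in[OF FH pt_H[OF cv]]] by simp
      show "\<forall>\<^sub>F n in sequentially. R.nrm (R.sub (F n) (pt v))
          \<le> inverse (real (Suc n)) + R.nrm (R.sub (pt (\<lambda>_. v n)) (pt v))"
      proof (intro always_eventually allI)
        fix n
        show "R.nrm (R.sub (F n) (pt v))
            \<le> inverse (real (Suc n)) + R.nrm (R.sub (pt (\<lambda>_. v n)) (pt v))"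
          using R.nrm_sub_tri[OF FH[of n] ptv[of n] pt_H[OF cv]] v[of n] by linarith
      qed
      show "(\<lambda>n. inverse (real (Suc n)) + R.nrm (R.sub (pt (\<lambda>_. v n)) (pt v))) \<longlonglongrightarrow> 0"
        using tendsto_add[OF LIMSEQ_inverse_real_of_nat vlim] by simp
    qed
    then show "\<exists>f\<in>H. (\<lambda>n. sqrt (Re (ip (\<lambda>x. F n x - f x) (\<lambda>x. F n x - f x)))) \<longlonglongrightarrow> 0"
      using pt_H[OF cv] by (auto simp: R.nrm_def Rsub)
  qed ((rule off R.add_in R.scl_in R.Q_add R.Q_scl R.Q_comm R.Q_nonneg repro kerH; assumption)+)
  then show ?thesis by blast
qed

theorem is_rkhs_rkhs:
  assumes "kernel_on X k"
  shows "is_rkhs X k (rkhs X k) (rkhs_ip X k)"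
proof -
  have "\<exists>p. is_rkhs X k (fst p) (snd p)" using kernel_on_imp_ex_rkhs[OF assms] by simp
  from someI_ex[OF this] show ?thesis
    by (simp add: rkhs_def rkhs_ip_def rkhs_space_ip_def)
qed

end

theory Submission
  imports Defs "HOL-Complex_Analysis.Conformal_Mappings"
begin

text \<open>
  Write \<open>u\<^sub>a = \<Sum>\<^bsub>b \<ge> a\<^esub> c\<^bsub>b - a\<^esub> v\<^sub>b\<close>. After rescaling its rows and columns, the block matrix of the data
  \<open>c\<close> is a contraction iff
  \<open>\<Sum>\<^sub>a k\<^sub>a |u\<^sub>a|\<^sup>2 \<le> \<Sum>\<^sub>b l\<^sub>b |v\<^sub>b|\<^sup>2\<close> for all \<open>v\<close> supported in \<open>F\<close>. This form shows that the map
  \<open>v \<mapsto> u\<close> commutes with all backward shifts \<open>v\<^sub>b \<mapsto> v\<^bsub>b + s\<^esub>\<close>, and a certificate \<open>t\<close> is made to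
  exploit this.

  \<^bold>\<open>Extending the data.\<close> Let \<open>b\<close> be a minimal index outside \<open>F\<close>. If \<open>v\<close> is supported in
  \<open>F \<union> {b}\<close>, then each of its shifts by \<open>s \<noteq> 0\<close> is supported in \<open>F\<close>, so the inequality for \<open>F\<close>
  applies to it. Adding these inequalities with the weights \<open>t\<^sub>s\<close> replaces \<open>k\<close> by \<open>k t\<close> and \<open>l\<close> by
  \<open>l t\<close>. The two positivity conditions of the certificate say \<open>l t \<le> l\<close> and, off the constant term,
  \<open>k \<le> k t\<close>; hence \<open>\<Sum>\<^bsub>a \<noteq> 0\<^esub> k\<^sub>a |u\<^sub>a|\<^sup>2 \<le> \<Sum>\<^sub>b l\<^sub>b |v\<^sub>b|\<^sup>2\<close> (\<open>toep_certificate_ineq\<close>). This is the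
  enlarged matrix without its row \<open>0\<close>. The unknown block \<open>c\<^sub>b\<close> occurs only where row \<open>0\<close> meets column \<open>b\<close>, and
  without column \<open>b\<close> the matrix is contractive by assumption. Parrott's theorem on the completion of
  a corner therefore supplies \<open>c\<^sub>b\<close> (\<open>toep_one_step\<close>); here it comes down to an orthogonal projection for
  the positive semidefinite form \<open>\<Sum>\<^sub>b l\<^sub>b |v\<^sub>b|\<^sup>2 - \<Sum>\<^bsub>a \<noteq> 0\<^esub> k\<^sub>a |u\<^sub>a|\<^sup>2\<close>. Repeating the step along an
  enumeration of the multi-indices gives data on all of them whose finite sections are contractive
  (\<open>toep_extend\<close>).

  \<^bold>\<open>From coefficients to multipliers.\<close> On coefficients, multiplication by \<open>\<Phi>\<close> is the adjoint of
  \<open>v \<mapsto> u\<close>. So the theorem follows once the Hilbert space of a diagonal kernel is known to be the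
  weighted sequence space with squared norm \<open>\<Sum>\<^sub>a |f\<^sub>a|\<^sup>2 / k\<^sub>a\<close>, realised by power series converging on all of
  \<open>\<Omega>\<close>. Two facts are needed for that.

  First, the series of the kernel must converge to it on the whole domain, although it is only given
  near the origin and \<open>\<Omega>\<close> is an arbitrary domain. Positivity of the coefficients forces this: for \<open>p\<close>
  on the boundary of the part where it is known, the function \<open>\<zeta> \<mapsto> k(\<zeta> s, \<tau> s)\<close> of one variable
  \<open>\<zeta>\<close>, with \<open>s\<close> near \<open>p\<close> and \<open>\<tau> \<ge> 1\<close>, has a series with nonnegative coefficients and is holomorphic in a
  disc of fixed size about \<open>\<tau>\<close>, and Pringsheim's argument lets its series converge past \<open>p\<close>
  (\<open>diagonal_kernel_global_series\<close>).

  Secondly, the monomials must lie in the space. Averages of kernel functions over grids of roots of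
  unity on a small torus form a Cauchy sequence whose limit is a multiple of a monomial
  (\<open>monomial_mem_and_ip\<close>). Since the kernel functions are expansions in monomials, these form an
  orthogonal basis, with a Bessel inequality and a Riesz--Fischer theorem.
\<close>

unbundle no fps_syntax

section \<open>Multi-indices and co-invariant sets\<close>

lemma vec_add_diff: "(a :: nat ^ 'n::finite) + t - t = a" by (simp add: vec_eq_iff)
lemma vec_diff_add: "t \<le> e \<Longrightarrow> (e :: nat ^ 'n::finite) - t + t = e"
  by (simp add: vec_eq_iff less_eq_vec_def)
lemma vec_le_add: "(a :: nat ^ 'n::finite) \<le> a + t" "(a :: nat ^ 'n::finite) \<le> t + a" by (simp_all add: less_eq_vec_def)
lemma vec_diff_diff: "t \<le> e \<Longrightarrow> (e :: nat ^ 'n::finite) - (e - t) = t"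
  by (simp add: vec_eq_iff less_eq_vec_def)
lemma vec_minus_zero: "(a :: nat ^ 'n::finite) - 0 = a" by (simp add: vec_eq_iff)
lemma vec_zero_le: "(0 :: nat ^ 'n::finite) \<le> a" by (simp add: less_eq_vec_def)
lemma vec_diff_le: "(a :: nat ^ 'n::finite) - t \<le> a" by (simp add: less_eq_vec_def)
lemma vec_add_le: "(a :: nat ^ 'n::finite) + t \<le> b + t \<longleftrightarrow> a \<le> b" by (simp add: less_eq_vec_def)

lemma co_invariantD: "co_invariant F \<Longrightarrow> b \<in> F \<Longrightarrow> a \<le> b \<Longrightarrow> a \<in> F"
  by (auto simp: co_invariant_def)

lemma co_invariant_zero: "co_invariant F \<Longrightarrow> 0 \<in> F"
  using vec_zero_le by (fastforce simp: co_invariant_def)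

lemma finite_subset_co_invariant:
  assumes "finite (G :: (nat ^ 'n::finite) set)"
  obtains D where "finite D" "co_invariant D" "G \<subseteq> D"
proof (rule that[of "{a. a \<le> 0} \<union> (\<Union>b\<in>G. {a. a \<le> b})"])
  show "finite ({a. a \<le> 0} \<union> (\<Union>b\<in>G. {a. a \<le> b}))" using assms finite_multiindex_le by auto
  show "co_invariant ({a. a \<le> 0} \<union> (\<Union>b\<in>G. {a. a \<le> b}))"
    unfolding co_invariant_def by (auto intro: order_trans)
qed auto

section \<open>Contractive block Toeplitz matrices\<close>

text \<open>
  Blocks below the diagonal vanish, so only the indices \<open>b \<ge> a\<close> enter. The
  weights \<open>k\<close> and \<open>l\<close> are kept out of the matrix, which makes it commute
  with shifts.
\<close>

definition toep :: "(nat ^ 'n \<Rightarrow> nat \<Rightarrow> nat \<Rightarrow> complex) \<Rightarrow> nat \<Rightarrow> (nat ^ 'n) set \<Rightarrow>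
    ((nat ^ 'n) \<times> nat \<Rightarrow> complex) \<Rightarrow> nat ^ 'n::finite \<Rightarrow> nat \<Rightarrow> complex" where
  "toep c J F v a i = (\<Sum>b | b \<in> F \<and> a \<le> b. \<Sum>j<J. c (b - a) i j * v (b, j))"

definition toep_contractive :: "('n::finite) mps \<Rightarrow> 'n mps \<Rightarrow> nat \<Rightarrow> (nat ^ 'n) set \<Rightarrow>
    (nat ^ 'n \<Rightarrow> nat \<Rightarrow> nat \<Rightarrow> complex) \<Rightarrow> bool" where
  "toep_contractive kc lc J F c \<longleftrightarrow>
     (\<forall>v. (\<Sum>a\<in>F. kc a * (\<Sum>i<J. (cmod (toep c J F v a i))\<^sup>2))
        \<le> (\<Sum>b\<in>F. lc b * (\<Sum>j<J. (cmod (v (b, j)))\<^sup>2)))"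

text \<open>
  The substitution \<open>v\<^sub>b \<mapsto> v\<^sub>b / \<surd>l\<^sub>b\<close> is a bijection
  of the test vectors; it moves the weights from the matrix entries into the norms.
\<close>

lemma contraction_matrix_caratheodory_iff:
  fixes kc lc :: "('n::finite) mps"
  assumes "\<And>a. kc a > 0" "\<And>a. lc a > 0" "finite F"
  shows "contraction_matrix (F \<times> {..<J}) (caratheodory_matrix kc lc c) \<longleftrightarrow> toep_contractive kc lc J F c"
proof -
  define I where "I = F \<times> {..<J}"
  let ?C = "caratheodory_matrix kc lc c"
  define s where "s = (\<lambda>v (b, j). complex_of_real (1 / sqrt (lc b)) * (v (b::nat^'n, j::nat) :: complex))"
  have row: "(\<Sum>q\<in>I. ?C (a, i) q * v q) = complex_of_real (sqrt (kc a)) * toep c J F (s v) a i" for a i v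
  proof -
    have "(\<Sum>q\<in>I. ?C (a, i) q * v q) = (\<Sum>b\<in>F. \<Sum>j<J. ?C (a, i) (b, j) * v (b, j))"
      by (simp add: I_def sum.cartesian_product case_prod_unfold)
    also have "\<dots> = (\<Sum>b\<in>F. if a \<le> b then complex_of_real (sqrt (kc a)) * (\<Sum>j<J. c (b - a) i j * s v (b, j)) else 0)"
      by (intro sum.cong refl)
        (auto simp: caratheodory_matrix_def s_def sum_distrib_left real_sqrt_divide intro!: sum.cong)
    also have "\<dots> = complex_of_real (sqrt (kc a)) * toep c J F (s v) a i"
      using assms(3) by (simp add: toep_def sum.If_cases sum_distrib_left Int_def)
    finally show ?thesis .
  qed
  have L: "(\<Sum>p\<in>I. (cmod (\<Sum>q\<in>I. ?C p q * v q))\<^sup>2)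
      = (\<Sum>a\<in>F. kc a * (\<Sum>i<J. (cmod (toep c J F (s v) a i))\<^sup>2))" for v
  proof -
    have "(\<Sum>p\<in>I. (cmod (\<Sum>q\<in>I. ?C p q * v q))\<^sup>2) = (\<Sum>a\<in>F. \<Sum>i<J. (cmod (\<Sum>q\<in>I. ?C (a, i) q * v q))\<^sup>2)"
      by (subst (2) I_def) (simp add: sum.cartesian_product case_prod_unfold)
    also have "\<dots> = (\<Sum>a\<in>F. kc a * (\<Sum>i<J. (cmod (toep c J F (s v) a i))\<^sup>2))"
      using assms(1) by (simp add: row norm_mult power_mult_distrib sum_distrib_left less_imp_le)
    finally show ?thesis .
  qed
  have R: "(\<Sum>q\<in>I. (cmod (v q))\<^sup>2) = (\<Sum>b\<in>F. lc b * (\<Sum>j<J. (cmod (s v (b, j)))\<^sup>2))" for v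
  proof -
    have "(\<Sum>q\<in>I. (cmod (v q))\<^sup>2) = (\<Sum>b\<in>F. \<Sum>j<J. (cmod (v (b, j)))\<^sup>2)"
      by (simp add: I_def sum.cartesian_product case_prod_unfold)
    also have "\<dots> = (\<Sum>b\<in>F. lc b * (\<Sum>j<J. (cmod (s v (b, j)))\<^sup>2))"
      using assms(2)
      by (intro sum.cong refl)
        (simp add: s_def sum_distrib_left norm_mult norm_divide power_mult_distrib power_divide less_imp_le less_imp_neq[symmetric])
    finally show ?thesis .
  qed
  have surj: "\<exists>v. s v = v'" for v'
  proof -
    have "s (\<lambda>(b, j). complex_of_real (sqrt (lc b)) * v' (b, j)) = v'"
    proof
      fix x show "s (\<lambda>(b, j). complex_of_real (sqrt (lc b)) * v' (b, j)) x = v' x"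
        using assms(2)[of "fst x"] by (cases x) (simp add: s_def)
    qed
    then show ?thesis by blast
  qed
  have "contraction_matrix I ?C \<longleftrightarrow>
     (\<forall>v. (\<Sum>p\<in>I. (cmod (\<Sum>q\<in>I. ?C p q * v q))\<^sup>2) \<le> (\<Sum>q\<in>I. (cmod (v q))\<^sup>2))"
    by (simp add: contraction_matrix_def)
  also have "\<dots> \<longleftrightarrow> toep_contractive kc lc J F c"
    unfolding L R toep_contractive_def
  proof (intro iffI allI)
    fix v' assume *: "\<forall>v. (\<Sum>a\<in>F. kc a * (\<Sum>i<J. (cmod (toep c J F (s v) a i))\<^sup>2))
        \<le> (\<Sum>b\<in>F. lc b * (\<Sum>j<J. (cmod (s v (b, j)))\<^sup>2))"
    obtain v where "s v = v'" using surj by blast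
    then show "(\<Sum>a\<in>F. kc a * (\<Sum>i<J. (cmod (toep c J F v' a i))\<^sup>2))
        \<le> (\<Sum>b\<in>F. lc b * (\<Sum>j<J. (cmod (v' (b, j)))\<^sup>2))" using *[rule_format, of v] by simp
  qed (erule spec)
  finally show ?thesis by (simp add: I_def)
qed

section \<open>The inequality of a Shimorin certificate\<close>

text \<open>
  Puts both positivity conditions of a certificate into the form in which the convolution with
  \<open>t\<close> is compared with the series itself.
\<close>

lemma mps_mult_minus_one:
  "mps_mult f (mps_minus mps_one t) e = f e - (\<Sum>s | s \<le> e. f (e - s) * t s)"
proof -
  have "mps_mult f (mps_minus mps_one t) e
      = (\<Sum>b | b \<le> e. f b * (if e - b = 0 then 1 else 0)) - (\<Sum>b | b \<le> e. f b * t (e - b))"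
    by (simp add: mps_mult_def mps_minus_def mps_one_def right_diff_distrib sum_subtractf)
  also have "(\<Sum>b | b \<le> e. f b * (if e - b = 0 then 1 else 0)) = (\<Sum>b | b \<le> e. if b = e then f b else 0)"
  proof (intro sum.cong refl)
    fix b assume "b \<in> {b. b \<le> e}"
    then have "e - b = 0 \<longleftrightarrow> b = e"
      by (auto simp: vec_eq_iff less_eq_vec_def intro: le_antisym)
    then show "f b * (if e - b = 0 then 1 else 0) = (if b = e then f b else 0)" by simp
  qed
  also have "\<dots> = f e" by (simp add: finite_multiindex_le)
  also have "(\<Sum>b | b \<le> e. f b * t (e - b)) = (\<Sum>s | s \<le> e. f (e - s) * t s)"
  proof (rule sum.reindex_bij_witness[of _ "\<lambda>s. e - s" "\<lambda>s. e - s"])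
    fix b assume "b \<in> {b. b \<le> e}"
    then show "e - (e - b) = b" "e - b \<in> {s. s \<le> e}" "f (e - (e - b)) * t (e - b) = f b * t (e - b)"
      by (simp_all add: vec_diff_diff vec_diff_le)
  qed (simp_all add: vec_diff_diff vec_diff_le)
  finally show ?thesis .
qed

text \<open>
  An entry of the matrix depends only on the difference of its indices, so shifting the vector
  shifts its image. The hypothesis on \<open>F\<close> says that shifted vectors live on
  \<open>F\<close>: this is how contractivity on the smaller set \<open>F\<close> gives
  information about vectors on \<open>G\<close>.
\<close>

lemma toep_shift:
  assumes G: "co_invariant G" "finite G" and F: "\<And>e. e \<in> G \<Longrightarrow> t \<le> e \<Longrightarrow> e - t \<in> F" "F \<subseteq> G"
  shows "toep c J F (\<lambda>(b, j). if b + t \<in> G then v (b + t, j) else 0) a i = toep c J G v (a + t) i"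
proof -
  have fF: "finite F" using F(2) G(2) by (rule finite_subset)
  have "toep c J F (\<lambda>(b, j). if b + t \<in> G then v (b + t, j) else 0) a i
      = (\<Sum>b | b \<in> F \<and> a \<le> b. if b + t \<in> G then \<Sum>j<J. c (b - a) i j * v (b + t, j) else 0)"
    unfolding toep_def by (intro sum.cong refl) simp
  also have "\<dots> = (\<Sum>b | b \<in> F \<and> a \<le> b \<and> b + t \<in> G. \<Sum>j<J. c (b - a) i j * v (b + t, j))"
    using fF by (simp add: sum.If_cases Int_def conj_assoc)
  also have "\<dots> = (\<Sum>e | e \<in> G \<and> a + t \<le> e. \<Sum>j<J. c (e - (a + t)) i j * v (e, j))"
  proof (rule sum.reindex_bij_witness[of _ "\<lambda>e. e - t" "\<lambda>b. b + t"])
    fix e assume "e \<in> {e \<in> G. a + t \<le> e}"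
    then have e: "e \<in> G" "a + t \<le> e" "t \<le> e" using vec_le_add(2) order_trans by blast+
    then show "e - t + t = e" "e - t \<in> {b \<in> F. a \<le> b \<and> b + t \<in> G}"
      using F(1)[of e] vec_add_le[of a t "e - t"] by (simp_all add: vec_diff_add)
  next
    fix b assume "b \<in> {b \<in> F. a \<le> b \<and> b + t \<in> G}"
    then show "b + t - t = b" "b + t \<in> {e \<in> G. a + t \<le> e}"
      by (simp_all add: vec_add_diff vec_add_le)
    have "b + t - (a + t) = b - a" by (simp add: vec_eq_iff)
    then show "(\<Sum>j<J. c (b + t - (a + t)) i j * v (b + t, j)) = (\<Sum>j<J. c (b - a) i j * v (b + t, j))"
      by simp
  qed
  finally show ?thesis by (simp add: toep_def)
qed

text \<open>
  Contractivity on \<open>F\<close>, applied to the vector shifted by \<open>t\<close> and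
  reindexed by the original positions \<open>e = a + t\<close>.
\<close>

lemma toep_shift_ineq:
  assumes G: "co_invariant G" "finite G" and F: "\<And>e. e \<in> G \<Longrightarrow> t \<le> e \<Longrightarrow> e - t \<in> F" "F \<subseteq> G"
    and contr: "toep_contractive kc lc J F c"
    and u: "\<And>e. u e = (\<Sum>i<J. (cmod (toep c J G v e i))\<^sup>2)"
    and w: "\<And>e. w e = (\<Sum>j<J. (cmod (v (e, j)))\<^sup>2)"
  shows "(\<Sum>e | e \<in> G \<and> t \<le> e. kc (e - t) * u e) \<le> (\<Sum>e | e \<in> G \<and> t \<le> e. lc (e - t) * w e)"
proof -
  have fF: "finite F" using F(2) G(2) by (rule finite_subset)
  define v' where "v' = (\<lambda>(b, j). if b + t \<in> G then v (b + t, j) else 0)"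
  have re: "(\<Sum>a\<in>F. f a * g (a + t)) = (\<Sum>e | e \<in> G \<and> t \<le> e. f (e - t) * g e)"
    if "\<And>e. e \<notin> G \<Longrightarrow> g e = 0" for f g :: "nat ^ 'a \<Rightarrow> real"
  proof -
    have "(\<Sum>a\<in>F. f a * g (a + t)) = (\<Sum>a | a \<in> F \<and> a + t \<in> G. f a * g (a + t))"
      using fF that by (intro sum.mono_neutral_right) auto
    also have "\<dots> = (\<Sum>e | e \<in> G \<and> t \<le> e. f (e - t) * g e)"
    proof (rule sum.reindex_bij_witness[of _ "\<lambda>e. e - t" "\<lambda>b. b + t"])
      fix a show "a + t - t = a" for a :: "nat ^ 'a" by (simp add: vec_add_diff)
      then show "f (a + t - t) * g (a + t) = f a * g (a + t)" by simp
      show "a + t \<in> {e \<in> G. t \<le> e}" if "a \<in> {a \<in> F. a + t \<in> G}"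
        using that by (simp add: vec_le_add)
    next
      fix e assume "e \<in> {e \<in> G. t \<le> e}"
      then show "e - t + t = e" "e - t \<in> {a \<in> F. a + t \<in> G}" using F(1) by (auto simp: vec_diff_add)
    qed
    finally show ?thesis .
  qed
  have u0: "u e = 0" if "e \<notin> G" for e
  proof -
    have "{b. b \<in> G \<and> e \<le> b} = {}" using that G(1) by (auto dest: co_invariantD)
    then show ?thesis by (simp only: u toep_def) simp
  qed
  have "(\<Sum>e | e \<in> G \<and> t \<le> e. kc (e - t) * u e) = (\<Sum>a\<in>F. kc a * (\<Sum>i<J. (cmod (toep c J F v' a i))\<^sup>2))"
    using re[where f = kc and g = u, OF u0] by (simp add: v'_def toep_shift[OF G F] u)
  also have "\<dots> \<le> (\<Sum>b\<in>F. lc b * (\<Sum>j<J. (cmod (v' (b, j)))\<^sup>2))"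
    using contr by (simp add: toep_contractive_def)
  also have "\<dots> = (\<Sum>b\<in>F. lc b * (if b + t \<in> G then w (b + t) else 0))"
    by (intro sum.cong refl) (simp add: v'_def w)
  also have "\<dots> = (\<Sum>e | e \<in> G \<and> t \<le> e. lc (e - t) * w e)"
    by (subst re[where f = lc and g = "\<lambda>e. if e \<in> G then w e else 0"]) auto
  finally show ?thesis .
qed

text \<open>
  The heart of the matter: the contractivity inequalities of all nonzero shifts, weighted by the
  coefficients of the certificate, add up to contractivity on the larger set \<open>G\<close> of
  the matrix without row \<open>0\<close>. Row \<open>0\<close> is lost because a certificate does
  not give \<open>k \<le> k t\<close> at the constant term.
\<close>

lemma toep_certificate_ineq:
  fixes kc lc t :: "('n::finite) mps"
  assumes cert: "shimorin_certificate kc lc t"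
    and G: "co_invariant G" "finite G"
    and F: "\<And>e s. e \<in> G \<Longrightarrow> s \<le> e \<Longrightarrow> s \<noteq> 0 \<Longrightarrow> e - s \<in> F" "F \<subseteq> G"
    and contr: "toep_contractive kc lc J F c"
  shows "(\<Sum>a\<in>G - {0}. kc a * (\<Sum>i<J. (cmod (toep c J G v a i))\<^sup>2))
      \<le> (\<Sum>b\<in>G. lc b * (\<Sum>j<J. (cmod (v (b, j)))\<^sup>2))"
proof -
  define u where "u e = (\<Sum>i<J. (cmod (toep c J G v e i))\<^sup>2)" for e
  define w where "w e = (\<Sum>j<J. (cmod (v (e, j)))\<^sup>2)" for e
  have un: "u e \<ge> 0" and wn: "w e \<ge> 0" for e by (auto simp: u_def w_def sum_nonneg)
  have t0: "t 0 = 0" "\<And>a. t a \<ge> 0" using cert by (auto simp: shimorin_certificate_def)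
  have l: "(\<Sum>s | s \<le> e. lc (e - s) * t s) \<le> lc e" for e
    using cert unfolding shimorin_certificate_def mps_mult_minus_one by (auto simp: algebra_simps)
  have k: "kc e \<le> (\<Sum>s | s \<le> e. kc (e - s) * t s)" if "e \<noteq> 0" for e
  proof -
    have "0 \<le> mps_minus mps_one (mps_mult kc (mps_minus mps_one t)) e"
      using cert by (simp add: shimorin_certificate_def)
    then show ?thesis using that unfolding mps_minus_def[of mps_one "mps_mult _ _"] mps_mult_minus_one
      by (simp add: mps_one_def)
  qed
  have swap: "(\<Sum>s\<in>G. t s * (\<Sum>e | e \<in> G \<and> s \<le> e. f (e - s) * g e)) = (\<Sum>e\<in>G. (\<Sum>s | s \<le> e. f (e - s) * t s) * g e)"
    for f g :: "nat ^ 'n \<Rightarrow> real"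
  proof -
    have "(\<Sum>s\<in>G. t s * (\<Sum>e | e \<in> G \<and> s \<le> e. f (e - s) * g e)) = (\<Sum>s\<in>G. \<Sum>e | e \<in> G \<and> s \<le> e. f (e - s) * t s * g e)"
      by (simp add: sum_distrib_left mult_ac)
    also have "\<dots> = (\<Sum>e\<in>G. \<Sum>s | s \<in> G \<and> s \<le> e. f (e - s) * t s * g e)"
      using sum.swap_restrict[OF G(2) G(2), of "\<lambda>s e. f (e - s) * t s * g e" "(\<le>)"] by simp
    also have "\<dots> = (\<Sum>e\<in>G. \<Sum>s | s \<le> e. f (e - s) * t s * g e)"
      using G(1) by (intro sum.cong refl Collect_cong) (auto dest: co_invariantD)
    finally show ?thesis by (simp add: sum_distrib_right)
  qed
  have "(\<Sum>a\<in>G - {0}. kc a * u a) \<le> (\<Sum>a\<in>G - {0}. (\<Sum>s | s \<le> a. kc (a - s) * t s) * u a)"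
    using k un by (intro sum_mono mult_right_mono) auto
  also have "\<dots> = (\<Sum>a\<in>G. (\<Sum>s | s \<le> a. kc (a - s) * t s) * u a)"
  proof (rule sum.mono_neutral_left)
    have "{s :: nat ^ 'n. s \<le> 0} = {0}" by (auto simp: less_eq_vec_def vec_eq_iff)
    then show "\<forall>a\<in>G - (G - {0}). (\<Sum>s | s \<le> a. kc (a - s) * t s) * u a = 0" using t0 by auto
  qed (use G in auto)
  also have "\<dots> = (\<Sum>s\<in>G. t s * (\<Sum>e | e \<in> G \<and> s \<le> e. kc (e - s) * u e))" by (rule swap[symmetric])
  also have "\<dots> \<le> (\<Sum>s\<in>G. t s * (\<Sum>e | e \<in> G \<and> s \<le> e. lc (e - s) * w e))"
  proof (rule sum_mono)
    fix s assume "s \<in> G"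
    show "t s * (\<Sum>e | e \<in> G \<and> s \<le> e. kc (e - s) * u e) \<le> t s * (\<Sum>e | e \<in> G \<and> s \<le> e. lc (e - s) * w e)"
    proof (cases "s = 0")
      case False
      show ?thesis
        by (rule mult_left_mono[OF toep_shift_ineq[OF G _ F(2) contr u_def w_def] t0(2)])
          (use F(1) False in blast)
    qed (simp add: t0)
  qed
  also have "\<dots> = (\<Sum>e\<in>G. (\<Sum>s | s \<le> e. lc (e - s) * t s) * w e)" by (rule swap)
  also have "\<dots> \<le> (\<Sum>e\<in>G. lc e * w e)" using l wn by (intro sum_mono mult_right_mono) auto
  finally show ?thesis by (simp add: u_def w_def)
qed

section \<open>Extending the data by one coefficient\<close>

lemma toep_add: "toep c J F (\<lambda>x. v x + w x) a i = toep c J F v a i + toep c J F w a i"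
  by (simp add: toep_def algebra_simps sum.distrib)

lemma toep_scale: "toep c J F (\<lambda>x. s * v x) a i = s * toep c J F v a i"
  by (simp add: toep_def sum_distrib_left mult_ac)

lemma toep_sum: "finite S \<Longrightarrow>
    toep c J F (\<lambda>x. \<Sum>j\<in>S. s j * h j x) a i = (\<Sum>j\<in>S. s j * toep c J F (h j) a i)"
proof (induction S rule: finite_induct)
  case empty
  then show ?case by (simp add: toep_def)
qed (simp add: toep_add toep_scale)

lemma toep_cong:
  assumes "\<And>b j. b \<in> F \<Longrightarrow> a \<le> b \<Longrightarrow> j < J \<Longrightarrow> c (b - a) i j * v (b, j) = c' (b - a) i j * v' (b, j)"
  shows "toep c J F v a i = toep c' J F v' a i"
  using assms by (auto simp: toep_def intro!: sum.cong)

lemma toep_insert: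
  assumes "finite F" "b \<notin> F"
  shows "toep c J (insert b F) v a i =
    toep c J F v a i + (if a \<le> b then \<Sum>j<J. c (b - a) i j * v (b, j) else 0)"
proof (cases "a \<le> b")
  case True
  then have "{b'. b' \<in> insert b F \<and> a \<le> b'} = insert b {b'. b' \<in> F \<and> a \<le> b'}" by auto
  then show ?thesis using assms True by (simp only: toep_def) simp
next
  case False
  then have "{b'. b' \<in> insert b F \<and> a \<le> b'} = {b'. b' \<in> F \<and> a \<le> b'}" by auto
  then show ?thesis using False by (simp only: toep_def) simp
qed

text \<open>
  Orthogonal projection onto a coordinate subspace of finite dimension, by Gram--Schmidt on the
  coordinates. The form may be degenerate: a direction \<open>d\<close> of length zero is
  orthogonal to everything by the Cauchy--Schwarz inequality, and then the quotient defining
  \<open>\<alpha>\<close> has the default value \<open>0\<close>, as needed.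
\<close>

lemma semi_ip_projection:
  fixes Q :: "('i \<Rightarrow> complex) \<Rightarrow> ('i \<Rightarrow> complex) \<Rightarrow> complex"
  assumes Q: "semi_ip UNIV (\<lambda>u v x. u x + v x) (\<lambda>c v x. c * v x) Q"
    and "finite E"
  shows "\<exists>p. (\<forall>x. x \<notin> E \<longrightarrow> p x = 0) \<and>
             (\<forall>w. (\<forall>x. x \<notin> E \<longrightarrow> w x = 0) \<longrightarrow> Q (\<lambda>x. e x - p x) w = 0)"
  using \<open>finite E\<close>
proof (induction E arbitrary: e rule: finite_induct)
  interpret Q: semi_ip UNIV "\<lambda>u v x. u x + v x" "\<lambda>c v x. c * v x" Q by (rule Q)
  case empty
  have "Q (\<lambda>x. e x - 0) w = 0" if "\<forall>x. w x = (0::complex)" for w :: "'i \<Rightarrow> complex"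
  proof -
    have "w = (\<lambda>x. 0 * e x)" using that by (simp add: fun_eq_iff)
    then show ?thesis using Q.Q_scl_r[of e e 0] by simp
  qed
  then show ?case by (intro exI[of _ "\<lambda>_. 0"]) simp
next
  interpret Q: semi_ip UNIV "\<lambda>u v x. u x + v x" "\<lambda>c v x. c * v x" Q by (rule Q)
  case (insert i E)
  define \<delta> :: "'i \<Rightarrow> complex" where "\<delta> x = (if x = i then 1 else 0)" for x
  obtain p0 where p0: "\<And>x. x \<notin> E \<Longrightarrow> p0 x = 0"
    "\<And>w. (\<forall>x. x \<notin> E \<longrightarrow> w x = 0) \<Longrightarrow> Q (\<lambda>x. \<delta> x - p0 x) w = 0"
    using insert.IH[of \<delta>] by blast
  obtain pe where pe: "\<And>x. x \<notin> E \<Longrightarrow> pe x = 0"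
    "\<And>w. (\<forall>x. x \<notin> E \<longrightarrow> w x = 0) \<Longrightarrow> Q (\<lambda>x. e x - pe x) w = 0"
    using insert.IH[of e] by blast
  define d where "d x = \<delta> x - p0 x" for x
  define e' where "e' x = e x - pe x" for x
  define \<alpha> where "\<alpha> = Q e' d / Q d d"
  have \<alpha>: "Q e' d = \<alpha> * Q d d"
  proof (cases "Q d d = 0")
    case True
    then have "Q e' d = 0" using Q.cauchy_schwarz[of e' d] by (simp add: Q.nrm_def)
    then show ?thesis using True by simp
  qed (simp add: \<alpha>_def)
  have d0: "Q d w = 0" if "\<forall>x. x \<notin> E \<longrightarrow> w x = 0" for w using p0(2)[OF that] by (simp add: d_def[abs_def])
  have e0: "Q e' w = 0" if "\<forall>x. x \<notin> E \<longrightarrow> w x = 0" for w using pe(2)[OF that] by (simp add: e'_def[abs_def])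
  have di: "d i = 1" "\<And>x. x \<notin> insert i E \<Longrightarrow> d x = 0"
    using p0(1) insert.hyps by (auto simp: d_def \<delta>_def)
  have split: "Q u w = Q u (\<lambda>x. w x - w i * d x) + cnj (w i) * Q u d" for u w
    using Q.Q_add_r[of "\<lambda>x. w x - w i * d x" "\<lambda>x. w i * d x" u] Q.Q_scl_r[of u d "w i"] by simp
  show ?case
  proof (intro exI conjI allI impI)
    show "pe x + \<alpha> * d x = 0" if "x \<notin> insert i E" for x using that pe(1) di by simp
    fix w :: "'i \<Rightarrow> complex" assume w: "\<forall>x. x \<notin> insert i E \<longrightarrow> w x = 0"
    have w': "\<forall>x. x \<notin> E \<longrightarrow> w x - w i * d x = 0" using w di by (metis insertE mult.right_neutral mult_zero_right diff_self)
    have "Q (\<lambda>x. e x - (pe x + \<alpha> * d x)) w = Q e' w - \<alpha> * Q d w"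
      using Q.Q_add[of e' "\<lambda>x. (- \<alpha>) * d x" w] Q.Q_scl[of d w "- \<alpha>"]
      by (simp add: e'_def algebra_simps)
    also have "\<dots> = 0"
      unfolding split[of e' w] split[of d w] using d0[OF w'] e0[OF w'] \<alpha> by simp
    finally show "Q (\<lambda>x. e x - (pe x + \<alpha> * d x)) w = 0" .
  qed
qed

text \<open>
  Parrott's completion argument. Let \<open>Q\<close> be the form that
  \<open>toep_certificate_ineq\<close> makes positive semidefinite. Row \<open>0\<close> is a
  functional bounded by \<open>Q\<close> on the vectors supported in \<open>F\<close>; composing
  it with the \<open>Q\<close>-orthogonal projection onto these vectors extends it, with the same
  bound, to the vectors that also charge \<open>b\<close>, and its values on the coordinate
  vectors at \<open>b\<close> are the entries of the new block.
\<close>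

lemma toep_one_step:
  fixes kc lc t :: "('n::finite) mps"
  assumes k0: "kc 0 = 1" and cert: "shimorin_certificate kc lc t"
    and F: "co_invariant F" "finite F" and G: "co_invariant (insert b F)" and bF: "b \<notin> F"
    and contr: "toep_contractive kc lc J F c"
  shows "\<exists>X. toep_contractive kc lc J (insert b F) (c(b := X))"
proof -
  let ?G = "insert b F"
  have G': "finite ?G" using F by simp
  have b0: "b \<noteq> 0" using bF co_invariant_zero[OF F(1)] by auto
  \<comment> \<open>By co-invariance of \<open>F\<close>, the new index \<open>b\<close> is maximal in \<open>insert b F\<close>.\<close>
  have maxb: "e = b" if "e \<in> ?G" "b \<le> e" for e
    using that bF co_invariantD[OF F(1)] by auto
  have GF: "e - s \<in> F" if "e \<in> ?G" "s \<le> e" "s \<noteq> 0" for e s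
  proof -
    have "e - s \<in> ?G" using co_invariantD[OF G that(1) vec_diff_le] .
    moreover have "e - s \<noteq> b"
    proof
      assume *: "e - s = b"
      then have "b \<le> e" using vec_diff_le[of e s] by simp
      then have "e = b" using maxb that(1) by blast
      then have "b + s = b" using vec_diff_add[OF that(2)] * by simp
      then show False using that(3) by simp
    qed
    ultimately show ?thesis by simp
  qed
  define Q where "Q v w = (\<Sum>e\<in>?G. complex_of_real (lc e) * (\<Sum>j<J. v (e, j) * cnj (w (e, j))))
      - (\<Sum>a\<in>?G - {0}. complex_of_real (kc a) * (\<Sum>i<J. toep c J ?G v a i * cnj (toep c J ?G w a i)))" for v w
  have Qvv: "Q v v = complex_of_real ((\<Sum>e\<in>?G. lc e * (\<Sum>j<J. (cmod (v (e, j)))\<^sup>2))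
      - (\<Sum>a\<in>?G - {0}. kc a * (\<Sum>i<J. (cmod (toep c J ?G v a i))\<^sup>2)))" for v
    by (simp add: Q_def complex_norm_square del: of_real_power)
  have semi: "semi_ip UNIV (\<lambda>u v x. u x + v x) (\<lambda>c v x. c * v x) Q"
  proof
    show "Q (\<lambda>x. u x + v x) w = Q u w + Q v w" for u v w
      by (simp add: Q_def toep_add algebra_simps sum.distrib)
    show "Q (\<lambda>x. s * u x) v = s * Q u v" for s u v
      by (simp add: Q_def toep_scale algebra_simps sum_distrib_left)
    show "Q v u = cnj (Q u v)" for u v by (simp add: Q_def mult.commute)
    show "0 \<le> Re (Q u u)" for u
      unfolding Qvv using toep_certificate_ineq[OF cert G G' GF _ contr, of u] by (simp del: sum.insert) auto
  qed auto
  interpret Q: semi_ip UNIV "\<lambda>u v x. u x + v x" "\<lambda>c v x. c * v x" Q by (rule semi)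
  let ?E = "F \<times> {..<J}"
  define \<delta> :: "nat \<Rightarrow> (nat ^ 'n) \<times> nat \<Rightarrow> complex" where "\<delta> j x = (if x = (b, j) then 1 else 0)" for j x
  have "\<forall>j. \<exists>p. (\<forall>x. x \<notin> ?E \<longrightarrow> p x = 0) \<and> (\<forall>w. (\<forall>x. x \<notin> ?E \<longrightarrow> w x = 0) \<longrightarrow> Q (\<lambda>x. \<delta> j x - p x) w = 0)"
    by (rule allI, rule semi_ip_projection[OF semi]) (use F in simp)
  then obtain p where "\<forall>j. (\<forall>x. x \<notin> ?E \<longrightarrow> p j x = 0) \<and> (\<forall>w. (\<forall>x. x \<notin> ?E \<longrightarrow> w x = 0) \<longrightarrow> Q (\<lambda>x. \<delta> j x - p j x) w = 0)"
    by (rule choice[THEN exE])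
  then have p: "\<And>j x. x \<notin> ?E \<Longrightarrow> p j x = 0"
    "\<And>j w. (\<forall>x. x \<notin> ?E \<longrightarrow> w x = 0) \<Longrightarrow> Q (\<lambda>x. \<delta> j x - p j x) w = 0"
    by blast+
  define X where "X i j = toep c J F (p j) 0 i" for i j
  let ?c = "c(b := X)"
  have "(\<Sum>a\<in>?G. kc a * (\<Sum>i<J. (cmod (toep ?c J ?G v a i))\<^sup>2))
        \<le> (\<Sum>e\<in>?G. lc e * (\<Sum>j<J. (cmod (v (e, j)))\<^sup>2))" for v
  proof -
    define v1 where "v1 x = (if x \<in> ?G \<times> {..<J} then v x else 0)" for x
    \<comment> \<open>\<open>w\<close> is the projection of \<open>v1\<close>, and \<open>r\<close> is the orthogonal remainder.\<close>
    define w where "w x = (if x \<in> ?E then v x else 0) + (\<Sum>j<J. v (b, j) * p j x)" for x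
    define r where "r x = (\<Sum>j<J. v (b, j) * (\<delta> j x - p j x))" for x
    have wE: "w x = 0" if "x \<notin> ?E" for x using that p(1) by (simp add: w_def)
    have v1: "v1 = (\<lambda>x. w x + r x)"
    proof
      fix x
      have "(\<Sum>j<J. v (b, j) * \<delta> j x) = (\<Sum>j<J. if (b, j) = x then v x else 0)"
        by (intro sum.cong) (auto simp: \<delta>_def)
      also have "\<dots> = (if x \<in> {b} \<times> {..<J} then v x else 0)"
      proof (cases x)
        case (Pair e i)
        then show ?thesis by (cases "e = b") (auto simp: if_distrib cong: if_cong)
      qed
      finally show "v1 x = w x + r x"
        using bF by (auto simp: v1_def w_def r_def right_diff_distrib sum_subtractf)
    qed
    have Qsum: "Q (\<lambda>x. \<Sum>j\<in>S. g j * h j x) u = (\<Sum>j\<in>S. g j * Q (h j) u)" if "finite S" for S u and g :: "nat \<Rightarrow> complex" and h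
      using that
    proof (induction S rule: finite_induct)
      case empty
      then show ?case using Q.Q_scl[of u u 0] by simp
    next
      case (insert x S)
      then show ?case using Q.Q_add[of "\<lambda>y. g x * h x y" "\<lambda>y. \<Sum>j\<in>S. g j * h j y" u] Q.Q_scl[of "h x" u "g x"] by simp
    qed
    have rw: "Q r w = 0"
      using Qsum[of "{..<J}" "\<lambda>j. v (b, j)" "\<lambda>j x. \<delta> j x - p j x" w] p(2)[of w] wE
      by (simp add: r_def[abs_def])
    have "Re (Q v1 v1) = Re (Q w w) + Re (Q r r)"
      using rw Q.Q_comm[of r w] unfolding v1 by (simp add: Q.Q_add Q.Q_add_r)
    then have Qge: "Re (Q w w) \<le> Re (Q v1 v1)" using Q.Q_nonneg[of r] by simp
    have toepw: "toep c J ?G w a i = toep c J F w a i" for a i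
      using wE bF F by (simp add: toep_insert)
    have toepwb: "toep c J F w b i = 0" for i
    proof -
      have "{b'. b' \<in> F \<and> b \<le> b'} = {}" using maxb bF by auto
      then show ?thesis by (simp only: toep_def) simp
    qed
    have Gsplit: "(\<Sum>a\<in>?G. f a) = f 0 + (\<Sum>a\<in>?G - {0}. f a)" for f :: "nat ^ 'n \<Rightarrow> real"
      using co_invariant_zero[OF G] G' by (rule sum.remove[rotated])
    have "(\<Sum>i<J. (cmod (toep c J F w 0 i))\<^sup>2) + (\<Sum>a\<in>?G - {0}. kc a * (\<Sum>i<J. (cmod (toep c J ?G w a i))\<^sup>2))
        = (\<Sum>a\<in>?G. kc a * (\<Sum>i<J. (cmod (toep c J F w a i))\<^sup>2))"
      using Gsplit[of "\<lambda>a. kc a * (\<Sum>i<J. (cmod (toep c J F w a i))\<^sup>2)"] by (simp only: k0 toepw mult_1)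
    also have "\<dots> = (\<Sum>a\<in>F. kc a * (\<Sum>i<J. (cmod (toep c J F w a i))\<^sup>2))"
      using F bF by (simp add: toepwb)
    also have "\<dots> \<le> (\<Sum>e\<in>F. lc e * (\<Sum>j<J. (cmod (w (e, j)))\<^sup>2))"
      using contr by (simp add: toep_contractive_def)
    also have "\<dots> = (\<Sum>e\<in>?G. lc e * (\<Sum>j<J. (cmod (w (e, j)))\<^sup>2))"
      using F bF wE by simp
    finally have "(\<Sum>i<J. (cmod (toep c J F w 0 i))\<^sup>2) \<le> Re (Q w w)" unfolding Qvv by simp
    with Qge have main: "(\<Sum>i<J. (cmod (toep c J F w 0 i))\<^sup>2) \<le> Re (Q v1 v1)" by simp
    have t0: "toep ?c J ?G v 0 i = toep c J F w 0 i" for i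
    proof -
      have "toep c J F w 0 i = toep c J F (\<lambda>x. if x \<in> ?E then v x else 0) 0 i + (\<Sum>j<J. v (b, j) * X i j)"
        unfolding w_def toep_add toep_sum[OF finite_lessThan] X_def by simp
      also have "toep c J F (\<lambda>x. if x \<in> ?E then v x else 0) 0 i = toep ?c J F v 0 i"
        
        proof (rule toep_cong)
          fix e j assume "e \<in> F" "j < J"
          moreover have "e - 0 = e" by (simp add: vec_eq_iff)
          ultimately show "c (e - 0) i j * (if (e, j) \<in> ?E then v (e, j) else 0) = ?c (e - 0) i j * v (e, j)"
            using bF by auto
        qed
      finally show ?thesis using F bF by (simp add: toep_insert vec_zero_le mult.commute vec_minus_zero)
    qed
    have ta: "toep ?c J ?G v a i = toep c J ?G v1 a i" if "a \<in> ?G - {0}" for a i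
    proof (rule toep_cong)
      fix e j assume e: "e \<in> ?G" "a \<le> e" "j < J"
      then have "e - a \<noteq> b" using GF[of e a] that bF by auto
      then show "?c (e - a) i j * v (e, j) = c (e - a) i j * v1 (e, j)" using e by (simp add: v1_def)
    qed
    have "(\<Sum>a\<in>?G. kc a * (\<Sum>i<J. (cmod (toep ?c J ?G v a i))\<^sup>2)) =
       (\<Sum>i<J. (cmod (toep c J F w 0 i))\<^sup>2) + (\<Sum>a\<in>?G - {0}. kc a * (\<Sum>i<J. (cmod (toep c J ?G v1 a i))\<^sup>2))"
      unfolding Gsplit t0 k0 using ta by (simp del: fun_upd_apply)
    also have "\<dots> \<le> (\<Sum>e\<in>?G. lc e * (\<Sum>j<J. (cmod (v1 (e, j)))\<^sup>2))"
      using main unfolding Qvv by simp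
    also have "\<dots> = (\<Sum>e\<in>?G. lc e * (\<Sum>j<J. (cmod (v (e, j)))\<^sup>2))"
      by (intro sum.cong refl) (auto simp: v1_def)
    finally show ?thesis .
  qed
  then show ?thesis by (auto simp: toep_contractive_def)
qed

section \<open>Extending the data to all multi-indices\<close>

text \<open>
  A minimal element of \<open>D - F\<close> can be added to \<open>F\<close> without leaving the
  co-invariant sets.
\<close>

lemma toep_extend_finite:
  fixes kc lc t :: "('n::finite) mps"
  assumes k0: "kc 0 = 1" and cert: "shimorin_certificate kc lc t"
    and D: "co_invariant D" "finite D"
    and "co_invariant F" "F \<subseteq> D" "toep_contractive kc lc J F c"
  shows "\<exists>c'. (\<forall>a\<in>F. c' a = c a) \<and> toep_contractive kc lc J D c'"
  using assms(5-)
proof (induction "card (D - F)" arbitrary: F c)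
  case 0
  then have "D = F" using D(2) by auto
  then show ?case using 0 by blast
next
  case (Suc n)
  have "0 < card (D - F)" using Suc(2) by simp
  then have "D - F \<noteq> {}" "finite (D - F)" unfolding card_gt_0_iff by blast+
  then obtain b where b: "b \<in> D - F" and bmin: "\<And>a. a \<in> D - F \<Longrightarrow> a \<le> b \<Longrightarrow> b = a"
    using finite_has_minimal[of "D - F"] by blast
  have fF: "finite F" using Suc.prems D by (auto intro: finite_subset)
  have co: "co_invariant (insert b F)"
    unfolding co_invariant_def
  proof (intro conjI ballI allI impI)
    fix e a assume e: "e \<in> insert b F" "a \<le> e"
    show "a \<in> insert b F"
    proof (cases "e = b")
      case True
      then show ?thesis using bmin[of a] b e co_invariantD[OF D(1), of b a] by blast
    qed (use e co_invariantD[OF Suc.prems(1)] in blast)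
  qed simp
  obtain X where X: "toep_contractive kc lc J (insert b F) (c(b := X))"
    using toep_one_step[OF k0 cert Suc.prems(1) fF co _ Suc.prems(3)] b by blast
  have "n = card (D - insert b F)"
    using Suc(2) b D(2) by (simp add: Diff_insert[of D b F])
  then obtain c' where "\<forall>a\<in>insert b F. c' a = (c(b := X)) a" "toep_contractive kc lc J D c'"
    using Suc.hyps(1)[OF _ co _ X] b Suc.prems(2) by auto
  then show ?case using b by (intro exI[of _ c']) auto
qed

lemma toep_contractive_cong:
  assumes "co_invariant D" "\<And>a. a \<in> D \<Longrightarrow> c a = c' a"
  shows "toep_contractive kc lc J D c \<longleftrightarrow> toep_contractive kc lc J D c'"
proof -
  have "toep c J D v a i = toep c' J D v a i" for v a i
    by (rule toep_cong) (use assms co_invariantD[OF assms(1) _ vec_diff_le] in simp)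
  then show ?thesis by (simp add: toep_contractive_def)
qed

lemma toep_contractive_subset:
  fixes kc lc :: "('n::finite) mps"
  assumes "toep_contractive kc lc J D c" "G \<subseteq> D" "finite D" "\<And>a. kc a \<ge> 0"
  shows "toep_contractive kc lc J G c"
  unfolding toep_contractive_def
proof
  fix v :: "(nat ^ 'n) \<times> nat \<Rightarrow> complex"
  define w where "w x = (if fst x \<in> G then v x else 0)" for x
  have eq: "toep c J D w a i = toep c J G v a i" for a i
  proof -
    have "toep c J D w a i = (\<Sum>b | b \<in> G \<and> a \<le> b. \<Sum>j<J. c (b - a) i j * w (b, j))"
      unfolding toep_def using assms(2,3) by (intro sum.mono_neutral_right) (auto simp: w_def intro!: sum.neutral split: if_splits)
    then show ?thesis by (simp add: toep_def w_def)
  qed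
  have "(\<Sum>a\<in>G. kc a * (\<Sum>i<J. (cmod (toep c J G v a i))\<^sup>2)) \<le> (\<Sum>a\<in>D. kc a * (\<Sum>i<J. (cmod (toep c J D w a i))\<^sup>2))"
    unfolding eq using assms by (intro sum_mono2) (auto intro!: mult_nonneg_nonneg sum_nonneg)
  also have "\<dots> \<le> (\<Sum>b\<in>D. lc b * (\<Sum>j<J. (cmod (w (b, j)))\<^sup>2))"
    using assms(1) by (simp add: toep_contractive_def)
  also have "\<dots> = (\<Sum>b\<in>G. lc b * (\<Sum>j<J. (cmod (v (b, j)))\<^sup>2))"
    using assms(2,3) by (intro sum.mono_neutral_cong_right) (auto simp: w_def)
  finally show "(\<Sum>a\<in>G. kc a * (\<Sum>i<J. (cmod (toep c J G v a i))\<^sup>2)) \<le> \<dots>" .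
qed

text \<open>
  The finite extensions are chosen one after the other along the sets \<open>D\<^sub>n\<close>
  generated by \<open>F\<close> and the first \<open>n\<close> multi-indices; every coefficient is
  eventually constant.
\<close>

lemma toep_extend:
  fixes kc lc t :: "('n::finite) mps"
  assumes k0: "kc 0 = 1" and kn: "\<And>a. kc a \<ge> 0" and cert: "shimorin_certificate kc lc t"
    and F: "co_invariant F" "finite F" and contr: "toep_contractive kc lc J F c"
  shows "\<exists>c'. (\<forall>a\<in>F. c' a = c a) \<and> (\<forall>G. finite G \<longrightarrow> co_invariant G \<longrightarrow> toep_contractive kc lc J G c')"
proof -
  define D where "D n = F \<union> (\<Union>m<n. {a. a \<le> (from_nat m :: nat ^ 'n)})" for n
  have D: "co_invariant (D n)" "finite (D n)" for n
  proof -
    show "co_invariant (D n)"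
      using F(1) unfolding co_invariant_def D_def by (auto intro: order_trans)
    show "finite (D n)" using F(2) finite_multiindex_le by (auto simp: D_def)
  qed
  have mono: "D m \<subseteq> D n" if "m \<le> n" for m n using that by (auto simp: D_def)
  have cover: "a \<in> D (Suc (to_nat a))" for a by (auto simp: D_def intro!: bexI[of _ "to_nat a"])
  obtain cs where cs: "\<And>n. toep_contractive kc lc J (D n) (cs n)"
    "\<And>n. \<forall>a\<in>D n. cs (Suc n) a = cs n a" "cs 0 = c"
  proof -
    have "\<exists>cs. \<forall>n. (toep_contractive kc lc J (D n) (cs n) \<and> (n = 0 \<longrightarrow> cs n = c)) \<and>
        (\<forall>a\<in>D n. cs (Suc n) a = cs n a)"
    proof (rule dependent_nat_choice)
      show "\<exists>x. toep_contractive kc lc J (D 0) x \<and> (0 = 0 \<longrightarrow> x = c)"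
        using contr by (simp add: D_def)
    next
      fix x n assume "toep_contractive kc lc J (D n) x \<and> (n = 0 \<longrightarrow> x = c)"
      then show "\<exists>y. (toep_contractive kc lc J (D (Suc n)) y \<and> (Suc n = 0 \<longrightarrow> y = c)) \<and> (\<forall>a\<in>D n. y a = x a)"
        using toep_extend_finite[OF k0 cert D(1)[of "Suc n"] D(2)[of "Suc n"] D(1)[of n] mono, of J x] by auto
    qed
    then show ?thesis using that by blast
  qed
  have stable: "cs m a = cs n a" if "n \<le> m" "a \<in> D n" for n m a
    using that(1)
  proof (induction m rule: dec_induct)
    case (step m)
    have "a \<in> D m" using mono[OF step.hyps(1)] that(2) by blast
    then show ?case using cs(2)[of m] step.IH by simp
  qed simp
  define c' where "c' a = cs (Suc (to_nat a)) a" for a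
  have c': "c' a = cs n a" if "a \<in> D n" for n a
    using stable[of n "max n (Suc (to_nat a))" a] stable[OF _ cover, of a "max n (Suc (to_nat a))"] that
    by (simp add: c'_def)
  show ?thesis
  proof (intro exI[of _ c'] conjI ballI allI impI)
    fix a assume "a \<in> F"
    then show "c' a = c a" using c'[of a 0] cs(3) by (simp add: D_def)
  next
    fix G :: "(nat ^ 'n) set" assume G: "finite G" "co_invariant G"
    define N where "N = Max ((\<lambda>a. Suc (to_nat a)) ` G)"
    have "G \<subseteq> D N"
    proof
      fix a assume "a \<in> G"
      then have "Suc (to_nat a) \<le> N" using G(1) by (simp add: N_def)
      then show "a \<in> D N" using mono cover by blast
    qed
    moreover have "toep_contractive kc lc J (D N) c'"
      using cs(1)[of N] toep_contractive_cong[OF D(1), of N c' "cs N"] c' by blast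
    ultimately show "toep_contractive kc lc J G c'"
      using toep_contractive_subset D(2) kn by blast
  qed
qed

section \<open>Power series with nonnegative coefficients\<close>

lemma binomial_has_sum:
  fixes x y :: "'a :: {comm_ring_1, topological_comm_monoid_add}"
  shows "((\<lambda>m. of_nat (n choose m) * x ^ (n - m) * y ^ m) has_sum (x + y) ^ n) UNIV"
  by (rule has_sum_finite_neutralI[of "{..n}"])
    (auto simp: binomial_ring add.commute[of x y] binomial_eq_0 mult_ac intro!: sum.cong)

text \<open>
  Pringsheim's argument for a series of nonnegative terms, indexed by an arbitrary set and with
  exponents \<open>n a\<close>. Re-expanding about the positive point \<open>\<tau>\<close> gives
  a power series with nonnegative coefficients \<open>g\<^sub>m\<close>. It is the Taylor series
  of \<open>G\<close>, hence converges in the whole disc where \<open>G\<close> is holomorphic,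
  and positivity permits changing the order of summation back.
\<close>

lemma pringsheim_extension:
  fixes B :: "'a \<Rightarrow> real" and n :: "'a \<Rightarrow> nat" and \<tau> \<eta> :: real and G :: "complex \<Rightarrow> complex"
  assumes B: "\<And>a. B a \<ge> 0" and \<tau>: "\<tau> \<ge> 0" and \<eta>: "\<eta> > 0"
    and hol: "G holomorphic_on ball (of_real \<tau>) \<eta>" and \<rho>: "\<rho> > 0"
    and ser: "\<And>u. dist (of_real \<tau>) u < \<rho> \<Longrightarrow> ((\<lambda>a. of_real (B a) * u ^ n a) has_sum G u) UNIV"
    and x: "0 \<le> x" "x < \<eta>"
  shows "(\<lambda>a. B a * (\<tau> + x) ^ n a) summable_on UNIV"
proof -
  \<comment> \<open>The double series of the binomial expansions of \<open>B a * (\<tau> + y) ^ n a\<close>.\<close>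
  define f where "f y = (\<lambda>(a, m). B a * (of_nat (n a choose m) * \<tau> ^ (n a - m) * y ^ m))" for y :: real
  define g where "g m = (\<Sum>\<^sub>\<infinity>a. B a * (of_nat (n a choose m) * \<tau> ^ (n a - m)))" for m
  have f_nonneg: "f y p \<ge> 0" if "y \<ge> 0" for y p using B \<tau> that by (cases p) (simp add: f_def)
  have f_row: "((\<lambda>m. f y (a, m)) has_sum B a * (\<tau> + y) ^ n a) UNIV" for y a
    unfolding f_def by (simp add: has_sum_cmult_right binomial_has_sum)
  define r where "r = \<rho> / 2"
  have r: "0 < r" "r < \<rho>" using \<rho> by (auto simp: r_def)
  have "(\<lambda>a. B a * (\<tau> + r) ^ n a) summable_on UNIV"
  proof -
    have "dist (complex_of_real \<tau>) (of_real (\<tau> + r)) < \<rho>" using r by (simp add: dist_norm)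
    from has_sum_Re[OF ser[OF this]] have "((\<lambda>a. B a * (\<tau> + r) ^ n a) has_sum Re (G (of_real (\<tau> + r)))) UNIV"
      by (simp flip: of_real_add of_real_power of_real_mult)
    then show ?thesis by (rule has_sum_imp_summable)
  qed
  then have fr: "f r summable_on UNIV \<times> UNIV"
    by (intro summable_on_SigmaI[OF f_row]) (use f_nonneg r in auto)
  have g_summable: "(\<lambda>a. B a * (of_nat (n a choose m) * \<tau> ^ (n a - m))) summable_on UNIV" for m
  proof -
    have "(\<lambda>(m, a). f r (a, m)) summable_on UNIV \<times> UNIV" using fr by (subst (asm) summable_on_swap)
    then have "(\<lambda>a. f r (a, m)) summable_on UNIV" by (rule summable_on_SigmaD1) simp
    then have "(\<lambda>a. f r (a, m) * inverse (r ^ m)) summable_on UNIV" by (rule summable_on_cmult_left)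
    moreover have "f r (a, m) * inverse (r ^ m) = B a * (of_nat (n a choose m) * \<tau> ^ (n a - m))" for a
      using r by (simp add: f_def field_simps)
    ultimately show ?thesis by simp
  qed
  have f_col: "((\<lambda>a. f y (a, m)) has_sum g m * y ^ m) UNIV" for y m
    using has_sum_cmult_left[OF has_sum_infsum[OF g_summable[of m]], of "y ^ m"]
    by (simp add: f_def g_def mult_ac)
  define F where "F = Abs_fps (\<lambda>m. complex_of_real (g m))"
  have sums: "(\<lambda>m. complex_of_real (g m) * \<mu> ^ m) sums G (of_real \<tau> + \<mu>)" if \<mu>: "norm \<mu> < r" for \<mu>
  proof -
    define h where "h = (\<lambda>(a, m). complex_of_real (B a) * (of_nat (n a choose m) * of_real \<tau> ^ (n a - m) * \<mu> ^ m))"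
    have "norm (h p) \<le> f r p" for p
      using B \<tau> \<mu> by (cases p)
        (auto simp: h_def f_def norm_mult norm_power intro!: mult_left_mono power_mono)
    then have h: "h summable_on UNIV \<times> UNIV"
      using fr by (intro abs_summable_summable[OF summable_on_comparison_test[OF fr]]) auto
    have "((\<lambda>m. h (a, m)) has_sum of_real (B a) * (of_real \<tau> + \<mu>) ^ n a) UNIV" for a
      unfolding h_def by (simp add: has_sum_cmult_right binomial_has_sum)
    moreover have "((\<lambda>a. of_real (B a) * (of_real \<tau> + \<mu>) ^ n a) has_sum G (of_real \<tau> + \<mu>)) UNIV"
      using \<mu> r by (intro ser) (simp add: dist_norm)
    ultimately have "(h has_sum G (of_real \<tau> + \<mu>)) (UNIV \<times> UNIV)"
      using h by (intro has_sum_SigmaI) auto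
    then have "((\<lambda>(m, a). h (a, m)) has_sum G (of_real \<tau> + \<mu>)) (UNIV \<times> UNIV)"
      by (subst (asm) has_sum_swap)
    moreover have "((\<lambda>a. h (a, m)) has_sum of_real (g m) * \<mu> ^ m) UNIV" for m
      using has_sum_cmult_left[OF has_sum_of_real[OF has_sum_infsum[OF g_summable[of m]]], of "\<mu> ^ m"]
      by (simp add: h_def g_def mult_ac)
    ultimately have "((\<lambda>m. of_real (g m) * \<mu> ^ m) has_sum G (of_real \<tau> + \<mu>)) UNIV"
      by (intro has_sum_SigmaD[of "\<lambda>(m, a). h (a, m)"]) auto
    then show ?thesis by (rule has_sum_imp_sums)
  qed
  have F_radius: "fps_conv_radius F > 0"
  proof -
    have "norm (complex_of_real (r / 2)) < r" using r by simp
    from sums_summable[OF sums[OF this]] have "summable (\<lambda>m. fps_nth F m * of_real (r / 2) ^ m)"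
      by (simp add: F_def)
    from conv_radius_geI[OF this] show ?thesis using r
      by (auto simp: fps_conv_radius_def zero_ereal_def intro: less_le_trans[rotated])
  qed
  have G0: "(\<lambda>\<mu>. G (of_real \<tau> + \<mu>)) holomorphic_on ball 0 \<eta>"
  proof -
    have "(G \<circ> (\<lambda>\<mu>. of_real \<tau> + \<mu>)) holomorphic_on ball 0 \<eta>"
      by (rule holomorphic_on_compose_gen[OF _ hol]) (auto intro!: holomorphic_intros simp: dist_norm)
    then show ?thesis by (simp add: o_def)
  qed
  let ?E = "fps_expansion (\<lambda>\<mu>. G (of_real \<tau> + \<mu>)) 0"
  have E_radius: "fps_conv_radius ?E \<ge> \<eta>"
    using conv_radius_fps_expansion[of "\<lambda>\<mu>. G (of_real \<tau> + \<mu>)" 0 "ereal \<eta>"] G0 by simp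
  have "F = ?E"
  proof (rule eval_fps_eqD)
    show "fps_conv_radius ?E > 0" using E_radius \<eta> by (auto simp: zero_ereal_def intro: less_le_trans[rotated])
    have "eventually (\<lambda>z. z \<in> ball 0 (min r \<eta>)) (nhds (0::complex))"
      using r \<eta> by (intro eventually_nhds_in_open) auto
    then show "eventually (\<lambda>z. eval_fps F z = eval_fps ?E z) (nhds 0)"
    proof eventually_elim
      case (elim z)
      have "eval_fps ?E z = G (of_real \<tau> + z)"
        using eval_fps_expansion[of "\<lambda>\<mu>. G (of_real \<tau> + \<mu>)" 0 "ereal \<eta>" z] G0 elim by simp
      moreover have "eval_fps F z = G (of_real \<tau> + z)"
        using sums_unique[OF sums[of z]] elim by (simp add: eval_fps_def F_def)
      ultimately show ?case by simp
    qed
  qed (rule F_radius)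
  then have "ereal (norm (complex_of_real x)) < fps_conv_radius F"
    using E_radius x by (auto intro: less_le_trans[rotated])
  then have "summable (\<lambda>m. norm (fps_nth F m * of_real x ^ m))"
    unfolding fps_conv_radius_def by (rule abs_summable_in_conv_radius)
  moreover have gn: "g m \<ge> 0" for m
    unfolding g_def using B \<tau> by (intro infsum_nonneg) simp
  ultimately have "summable (\<lambda>m. g m * x ^ m)" using x by (simp add: F_def norm_mult norm_power)
  then have "(\<lambda>m. g m * x ^ m) summable_on UNIV"
    using gn x by (intro summable_nonneg_imp_summable_on) simp_all
  then have "(\<lambda>(m, a). f x (a, m)) summable_on UNIV \<times> UNIV"
    using f_col f_nonneg x by (intro summable_on_SigmaI[where g = "\<lambda>m. g m * x ^ m"]) auto
  then have "f x summable_on UNIV \<times> UNIV" by (subst summable_on_swap)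
  then have "(\<lambda>a. infsum (\<lambda>m. f x (a, m)) UNIV) summable_on UNIV"
    by (rule summable_on_SigmaD) (use f_row has_sum_imp_summable in blast)
  then show ?thesis using infsumI[OF f_row] by simp
qed

section \<open>The identity theorem along complex lines\<close>

text \<open>
  The part of holomorphy in several variables that the identity theorem uses; limits of
  polynomials are easily seen to have it.
\<close>

definition linewise_holomorphic :: "(complex ^ 'n \<Rightarrow> complex) \<Rightarrow> (complex ^ 'n) set \<Rightarrow> bool" where
  "linewise_holomorphic f U \<longleftrightarrow> (\<forall>x v. (\<lambda>s. f (x + s *s v)) holomorphic_on {s. x + s *s v \<in> U})"

lemma has_derivative_line:
  "((\<lambda>s. x + s *s v) has_derivative (\<lambda>s. s *s v)) (at (s0 :: complex) within S)"
proof -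
  have "bounded_linear (\<lambda>s::complex. s *s v)"
    by (rule linear_conv_bounded_linear[THEN iffD1])
      (auto intro!: linearI simp: vec_eq_iff algebra_simps)
  then have "((\<lambda>s. s *s v) has_derivative (\<lambda>s. s *s v)) (at s0 within S)"
    by (rule bounded_linear_imp_has_derivative)
  then show ?thesis using has_derivative_add[OF has_derivative_const] by force
qed

lemma continuous_line: "continuous_on S (\<lambda>s::complex. x + s *s v)"
  by (rule differentiable_imp_continuous_on) (auto simp: differentiable_on_def differentiable_def intro: has_derivative_line)

lemma open_line_preimage: "open U \<Longrightarrow> open {s::complex. x + s *s v \<in> U}"
  using open_vimage[of U "\<lambda>s. x + s *s v"] continuous_line[of UNIV x v]
  by (simp add: vimage_def)

lemma holomorphic_on_vec_imp_linewise:
  assumes "holomorphic_on_vec f U"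
  shows "linewise_holomorphic f U"
  unfolding linewise_holomorphic_def holomorphic_on_def
proof (intro allI ballI)
  fix x v :: "complex ^ 'a" and s assume "s \<in> {s. x + s *s v \<in> U}"
  then obtain f' where f': "(f has_derivative f') (at (x + s *s v))" "\<And>c v. f' (c *s v) = c * f' v"
    using assms by (auto simp: holomorphic_on_vec_def)
  have "((\<lambda>s. f (x + s *s v)) has_derivative (\<lambda>s. f' (s *s v))) (at s within {s. x + s *s v \<in> U})"
    by (rule has_derivative_compose[OF has_derivative_line f'(1)])
  then have "((\<lambda>s. f (x + s *s v)) has_field_derivative f' v) (at s within {s. x + s *s v \<in> U})"
    unfolding has_field_derivative_def f'(2) by (simp add: mult.commute[of _ "f' v"])
  then show "(\<lambda>s. f (x + s *s v)) field_differentiable (at s within {s. x + s *s v \<in> U})"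
    unfolding field_differentiable_def by blast
qed

lemma linewise_holomorphic_subset: "linewise_holomorphic f U \<Longrightarrow> V \<subseteq> U \<Longrightarrow> linewise_holomorphic f V"
  unfolding linewise_holomorphic_def by (blast intro: holomorphic_on_subset)

text \<open>
  The complex line through \<open>y\<close> and \<open>x\<close> meets \<open>B\<close> in a
  convex open set, on which the identity theorem in one variable applies.
\<close>

lemma linewise_identity_convex:
  assumes f: "linewise_holomorphic f B" and g: "linewise_holomorphic g B"
    and B: "open B" "convex B" and y: "y \<in> B" and e: "e > 0" "\<And>z. z \<in> ball y e \<Longrightarrow> f z = g z"
    and x: "x \<in> B"
  shows "f x = g x"
proof -
  define L where "L = {s::complex. y + s *s (x - y) \<in> B}"
  define N where "N = {s::complex. y + s *s (x - y) \<in> B \<inter> ball y e}"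
  have "f (y + 1 *s (x - y)) = g (y + 1 *s (x - y))"
  proof (rule analytic_continuation_open[of N L "\<lambda>s. f (y + s *s (x - y))" "\<lambda>s. g (y + s *s (x - y))" 1])
    show "open N" "open L" unfolding N_def L_def using B by (intro open_line_preimage; simp add: open_Int)+
    have "0 \<in> N" using y e by (simp add: N_def)
    then show "N \<noteq> {}" by blast
    have "convex L"
    proof (rule convexI)
      fix s t and a b :: real assume *: "s \<in> L" "t \<in> L" "0 \<le> a" "0 \<le> b" "a + b = 1"
      have "y + (a *\<^sub>R s + b *\<^sub>R t) *s (x - y) = a *\<^sub>R (y + s *s (x - y)) + b *\<^sub>R (y + t *s (x - y))"
      proof -
        have b: "b = 1 - a" using *(5) by simp
        show ?thesis unfolding b vec_eq_iff
          by (simp only: vector_add_component vector_scaleR_component vector_smult_component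
              vector_minus_component) (simp add: scaleR_conv_of_real algebra_simps)
      qed
      then show "a *\<^sub>R s + b *\<^sub>R t \<in> L" using * convexD[OF B(2)] by (auto simp: L_def)
    qed
    then show "connected L" by (rule convex_connected)
    show "N \<subseteq> L" "1 \<in> L" using x by (auto simp: N_def L_def)
    show "(\<lambda>s. f (y + s *s (x - y))) holomorphic_on L" "(\<lambda>s. g (y + s *s (x - y))) holomorphic_on L"
      using f g unfolding linewise_holomorphic_def L_def by blast+
    show "f (y + s *s (x - y)) = g (y + s *s (x - y))" if "s \<in> N" for s using that e by (simp add: N_def)
  qed
  then show ?thesis by simp
qed

text \<open>
  The set of points near which \<open>f\<close> and \<open>g\<close> agree is open, and by the
  case of balls so is its complement.
\<close>

lemma linewise_identity:
  assumes f: "linewise_holomorphic f U" and g: "linewise_holomorphic g U"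
    and U: "open U" "connected U" and y: "y \<in> U" and e: "e > 0" "\<And>z. z \<in> ball y e \<Longrightarrow> f z = g z"
    and x: "x \<in> U"
  shows "f x = g x"
proof -
  define Z where "Z = {z. \<exists>e>0. \<forall>w\<in>ball z e. f w = g w}"
  have "open Z"
  proof (subst open_subopen, rule ballI)
    fix z assume "z \<in> Z"
    then obtain e where e: "e > 0" "\<And>w. w \<in> ball z e \<Longrightarrow> f w = g w" by (auto simp: Z_def)
    have "ball z e \<subseteq> Z"
    proof
      fix w assume "w \<in> ball z e"
      then obtain d where d: "d > 0" "ball w d \<subseteq> ball z e" using open_contains_ball[of "ball z e"] by blast
      then have "\<forall>u\<in>ball w d. f u = g u" using e(2) by blast
      then show "w \<in> Z" using d(1) by (auto simp: Z_def)
    qed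
    then show "\<exists>T. open T \<and> z \<in> T \<and> T \<subseteq> Z" using e(1) by (intro exI[of _ "ball z e"]) auto
  qed
  moreover have "open (U - Z)"
  proof (subst open_subopen, rule ballI)
    fix p assume p: "p \<in> U - Z"
    then obtain d where d: "d > 0" "ball p d \<subseteq> U" using U(1) open_contains_ball by blast
    have "w \<notin> Z" if w: "w \<in> ball p d" for w
    proof
      assume "w \<in> Z"
      then obtain e where e: "e > 0" "\<And>z. z \<in> ball w e \<Longrightarrow> f z = g z" by (auto simp: Z_def)
      have "f z = g z" if "z \<in> ball p d" for z
        using linewise_identity_convex[OF linewise_holomorphic_subset[OF f d(2)]
            linewise_holomorphic_subset[OF g d(2)] open_ball convex_ball w e that] .
      then show False using p d(1) by (auto simp: Z_def)
    qed
    then show "\<exists>T. open T \<and> p \<in> T \<and> T \<subseteq> U - Z" using d by (intro exI[of _ "ball p d"]) auto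
  qed
  moreover have "y \<in> Z" using e by (auto simp: Z_def)
  ultimately have "U \<subseteq> Z" using U(2) y connectedD[of U Z "U - Z"] by blast
  then have "x \<in> Z" using x by blast
  then show ?thesis by (auto simp: Z_def)
qed

section \<open>Convergence of a diagonal series on the whole domain\<close>

lemma norm_mpow: "cmod (mpow z a) = (\<Prod>i\<in>UNIV. cmod (z $ i) ^ (a $ i))"
  by (simp add: mpow_def prod_norm[symmetric] norm_power)

lemma norm_mpow_mono: "(\<And>i. cmod (y $ i) \<le> cmod (q $ i)) \<Longrightarrow> cmod (mpow y a) \<le> cmod (mpow q a)"
  unfolding norm_mpow by (intro prod_mono) (auto intro: power_mono)

lemma mpow_smult: "mpow (s *s z) a = s ^ (\<Sum>i\<in>UNIV. a $ i) * mpow z a"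
  by (simp add: mpow_def power_mult_distrib prod.distrib power_sum)

definition conv_set :: "('n::finite) mps \<Rightarrow> (complex ^ 'n) set" where
  "conv_set kc = {z. (\<lambda>a. kc a * (cmod (mpow z a))\<^sup>2) summable_on UNIV}"

text \<open>
  A subset of the interior of \<open>conv_set\<close> on which domination by a larger point gives
  locally uniform convergence.
\<close>

definition conv_interior :: "('n::finite) mps \<Rightarrow> (complex ^ 'n) set" where
  "conv_interior kc = {y. \<exists>q\<in>conv_set kc. \<forall>i. cmod (y $ i) < cmod (q $ i)}"

definition diag_series :: "('n::finite) mps \<Rightarrow> complex ^ 'n \<Rightarrow> complex ^ 'n \<Rightarrow> complex" where
  "diag_series kc z w = (\<Sum>\<^sub>\<infinity>a. of_real (kc a) * mpow z a * cnj (mpow w a))"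

lemma open_conv_interior: "open (conv_interior kc)"
proof -
  have "conv_interior kc = (\<Union>q\<in>conv_set kc. \<Inter>i. {y. cmod (y $ i) < cmod (q $ i)})"
    by (auto simp: conv_interior_def)
  moreover have "open (\<Inter>i. {y :: complex ^ 'n. cmod (y $ i) < cmod (q $ i)})" for q :: "complex ^ 'n"
    by (intro open_INT) (auto intro!: open_Collect_less continuous_intros)
  ultimately show ?thesis by auto
qed

lemma diag_series_cnj: "diag_series kc w z = cnj (diag_series kc z w)"
  unfolding diag_series_def infsum_cnj[symmetric] by (simp add: mult_ac)

lemma conv_interior_mono:
  assumes "q \<in> conv_interior kc" "\<And>i. cmod (y $ i) \<le> cmod (q $ i)"
  shows "y \<in> conv_interior kc"
  using assms unfolding conv_interior_def by (blast intro: le_less_trans)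

context
  fixes kc :: "('n::finite) mps"
  assumes kn: "\<And>a. kc a \<ge> 0"
begin

text \<open>
  The set of convergence only depends on the moduli of the coordinates.
\<close>

lemma conv_set_mono:
  assumes "q \<in> conv_set kc" "\<And>i. cmod (y $ i) \<le> cmod (q $ i)"
  shows "y \<in> conv_set kc"
proof -
  have "kc a * (cmod (mpow y a))\<^sup>2 \<le> kc a * (cmod (mpow q a))\<^sup>2" for a
    by (intro mult_left_mono power_mono norm_mpow_mono assms kn) simp
  then show ?thesis using assms(1) kn unfolding conv_set_def
    by (auto intro: summable_on_comparison_test)
qed

lemma conv_interior_subset: "conv_interior kc \<subseteq> conv_set kc"
  unfolding conv_interior_def using conv_set_mono less_imp_le by blast

lemma conv_set_abs_summable:
  assumes "z \<in> conv_set kc" "w \<in> conv_set kc"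
  shows "(\<lambda>a. kc a * cmod (mpow z a) * cmod (mpow w a)) summable_on UNIV"
proof (rule summable_on_comparison_test)
  show "(\<lambda>a. kc a * (cmod (mpow z a))\<^sup>2 + kc a * (cmod (mpow w a))\<^sup>2) summable_on UNIV"
    using assms by (intro summable_on_add) (auto simp: conv_set_def)
  fix a
  have "cmod (mpow z a) * cmod (mpow w a) \<le> (cmod (mpow z a))\<^sup>2 + (cmod (mpow w a))\<^sup>2"
    using sum_squares_bound[of "cmod (mpow z a)" "cmod (mpow w a)"]
      mult_nonneg_nonneg[OF norm_ge_zero[of "mpow z a"] norm_ge_zero[of "mpow w a"]] by linarith
  then show "kc a * cmod (mpow z a) * cmod (mpow w a) \<le> kc a * (cmod (mpow z a))\<^sup>2 + kc a * (cmod (mpow w a))\<^sup>2"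
    using mult_left_mono[OF _ kn] by (fastforce simp: mult.assoc distrib_left[symmetric])
qed (use kn in auto)

lemma diag_series_has_sum:
  assumes "z \<in> conv_set kc" "w \<in> conv_set kc"
  shows "((\<lambda>a. of_real (kc a) * mpow z a * cnj (mpow w a)) has_sum diag_series kc z w) UNIV"
  unfolding diag_series_def
  by (rule has_sum_infsum, rule abs_summable_summable)
    (use conv_set_abs_summable[OF assms] kn in \<open>simp add: norm_mult\<close>)

text \<open>
  Near any point the terms are dominated by those at a fixed point with larger coordinates, so the
  partial sums converge uniformly.
\<close>

lemma diag_series_linewise:
  assumes w: "w \<in> conv_set kc"
  shows "linewise_holomorphic (\<lambda>z. diag_series kc z w) (conv_interior kc)"
  unfolding linewise_holomorphic_def
proof (intro allI)
  fix x v :: "complex ^ 'n"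
  let ?L = "{s. x + s *s v \<in> conv_interior kc}"
  let ?f = "\<lambda>s. diag_series kc (x + s *s v) w"
  have oL: "open ?L" by (intro open_line_preimage open_conv_interior)
  have "?f field_differentiable at s0" if s0: "s0 \<in> ?L" for s0
  proof -
    obtain q where q: "q \<in> conv_set kc" "\<And>i. cmod ((x + s0 *s v) $ i) < cmod (q $ i)"
      using s0 by (auto simp: conv_interior_def)
    define P where "P = {y :: complex ^ 'n. \<forall>i. cmod (y $ i) < cmod (q $ i)}"
    have "P = (\<Inter>i. {y. cmod (y $ i) < cmod (q $ i)})" by (auto simp: P_def)
    then have "open P" by (auto intro!: open_INT open_Collect_less continuous_intros)
    then have "open {s. x + s *s v \<in> P}" by (rule open_line_preimage)
    moreover have "s0 \<in> {s. x + s *s v \<in> P}" using q(2) by (simp add: P_def)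
    ultimately obtain r where r: "r > 0" "cball s0 r \<subseteq> {s. x + s *s v \<in> P}"
      using open_contains_cball by blast
    have "?f holomorphic_on ball s0 r"
    proof (rule holomorphic_uniform_limit)
      show "uniform_limit (cball s0 r)
          (\<lambda>X s. \<Sum>a\<in>X. of_real (kc a) * mpow (x + s *s v) a * cnj (mpow w a)) ?f (finite_subsets_at_top UNIV)"
        unfolding diag_series_def
      proof (rule Weierstrass_m_test_general)
        show "(\<lambda>a. kc a * cmod (mpow q a) * cmod (mpow w a)) summable_on UNIV"
          by (rule conv_set_abs_summable[OF q(1) w])
        fix a s assume "s \<in> cball s0 r"
        then have "cmod (mpow (x + s *s v) a) \<le> cmod (mpow q a)"
          using r(2) by (intro norm_mpow_mono) (auto simp: P_def less_imp_le)
        then show "cmod (of_real (kc a) * mpow (x + s *s v) a * cnj (mpow w a)) \<le> kc a * cmod (mpow q a) * cmod (mpow w a)"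
          using kn by (auto simp: norm_mult intro!: mult_mono)
      qed
      have "(\<lambda>s. mpow (x + s *s v) a) holomorphic_on A" for a A
        unfolding mpow_def by (auto intro!: holomorphic_intros)
      then have h: "(\<lambda>s. \<Sum>a\<in>X. of_real (kc a) * mpow (x + s *s v) a * cnj (mpow w a)) holomorphic_on A" for X A
        by (intro holomorphic_intros)
      show "\<forall>\<^sub>F X in finite_subsets_at_top UNIV.
          continuous_on (cball s0 r) (\<lambda>s. \<Sum>a\<in>X. of_real (kc a) * mpow (x + s *s v) a * cnj (mpow w a)) \<and>
          (\<lambda>s. \<Sum>a\<in>X. of_real (kc a) * mpow (x + s *s v) a * cnj (mpow w a)) holomorphic_on ball s0 r"
        by (intro always_eventually allI conjI h holomorphic_on_imp_continuous_on)
    qed auto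
    then show ?thesis using r(1) by (simp add: holomorphic_on_imp_differentiable_at)
  qed
  then show "?f holomorphic_on ?L"
    unfolding holomorphic_on_def by (blast intro: field_differentiable_at_within)
qed

end

text \<open>
  Moving along the diagonal direction \<open>(1, \<dots>, 1)\<close>, only finitely many positions
  make some coordinate vanish.
\<close>

lemma exists_nonzero_coordinates:
  fixes A :: "(complex ^ 'n::finite) set"
  assumes "open A" "a \<in> A"
  shows "\<exists>s\<in>A. \<forall>i. s $ i \<noteq> 0"
proof -
  obtain \<epsilon> where \<epsilon>: "\<epsilon> > 0" "ball a \<epsilon> \<subseteq> A" using assms open_contains_ball by blast
  define \<delta> where "\<delta> = \<epsilon> / (norm (1 :: complex ^ 'n) + 1)"
  have n1: "norm (1 :: complex ^ 'n) + 1 > 0" by (simp add: add_nonneg_pos)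
  have \<delta>: "\<delta> > 0" using \<epsilon>(1) n1 by (simp add: \<delta>_def)
  have "infinite ({0<..<\<delta>} - range (\<lambda>i. Re (- (a $ i))))"
    using \<delta> by (intro Diff_infinite_finite) simp_all
  then have "{0<..<\<delta>} - range (\<lambda>i. Re (- (a $ i))) \<noteq> {}" by (rule infinite_imp_nonempty)
  then obtain t where "t \<in> {0<..<\<delta>} - range (\<lambda>i. Re (- (a $ i)))" by blast
  then have t: "0 < t" "t < \<delta>" "\<And>i. t \<noteq> Re (- (a $ i))" by auto
  have "norm (t *\<^sub>R (1 :: complex ^ 'n)) \<le> t * (norm (1 :: complex ^ 'n) + 1)" using t by simp
  also have "\<dots> < \<delta> * (norm (1 :: complex ^ 'n) + 1)" using t n1 by (intro mult_strict_right_mono)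
  also have "\<dots> = \<epsilon>" using n1 by (simp add: \<delta>_def)
  finally have "a + t *\<^sub>R 1 \<in> A" using \<epsilon>(2) by (intro subsetD[OF \<epsilon>(2)]) (simp add: dist_norm)
  moreover have "(a + t *\<^sub>R 1) $ i \<noteq> 0" for i
  proof
    assume "(a + t *\<^sub>R 1) $ i = 0"
    then have "Re (a $ i) + t = 0" by (simp add: complex_eq_iff)
    then show False using t(3)[of i] by simp
  qed
  ultimately show ?thesis by blast
qed

lemma of_real_smult: "complex_of_real t *s v = t *\<^sub>R v"
  by (simp add: vec_eq_iff scaleR_conv_of_real[where 'a = complex])

lemma convex_polydisc: "convex {y :: complex ^ 'n::finite. \<forall>i. cmod (y $ i) < c i}"
proof -
  have "{y :: complex ^ 'n. \<forall>i. cmod (y $ i) < c i} = (\<Inter>i. (\<lambda>y. y $ i) -` ball 0 (c i))" by auto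
  then show ?thesis
    by (auto intro!: convex_INT convex_linear_vimage bounded_linear.linear[OF bounded_linear_vec_nth])
qed

text \<open>
  Along the ray through \<open>s\<close> the kernel has a series with nonnegative coefficients.
  The kernel is evaluated at \<open>(\<zeta> s, \<tau> s)\<close>, so convergence for
  \<open>\<zeta> = \<tau> + x\<close> is convergence of the diagonal series at the geometric mean
  of the two factors.
\<close>

lemma diag_series_radial_extension:
  fixes kc :: "('n::finite) mps"
  assumes kn: "\<And>a. kc a \<ge> 0"
    and hol: "(\<lambda>u. k (u *s s) (complex_of_real \<tau> *s s)) holomorphic_on ball (of_real \<tau>) \<eta>"
    and S: "open S" "S \<subseteq> conv_set kc" "complex_of_real \<tau> *s s \<in> S"
    and eq: "\<And>z w. z \<in> S \<Longrightarrow> w \<in> S \<Longrightarrow> k z w = diag_series kc z w"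
    and \<tau>: "\<tau> \<ge> 0" and x: "0 \<le> x" "x < \<eta>"
  shows "sqrt (\<tau> * (\<tau> + x)) *\<^sub>R s \<in> conv_set kc"
proof -
  define n where "n a = (\<Sum>i\<in>UNIV. a $ i)" for a :: "nat ^ 'n"
  define B where "B a = kc a * (cmod (mpow s a))\<^sup>2 * \<tau> ^ n a" for a
  have "open {u. 0 + u *s s \<in> S}" by (rule open_line_preimage[OF S(1)])
  moreover have "complex_of_real \<tau> \<in> {u. 0 + u *s s \<in> S}" using S(3) by simp
  ultimately obtain \<rho> where \<rho>: "\<rho> > 0" "ball (complex_of_real \<tau>) \<rho> \<subseteq> {u. 0 + u *s s \<in> S}"
    using open_contains_ball by blast
  have "(\<lambda>a. B a * (\<tau> + x) ^ n a) summable_on UNIV"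
  proof (rule pringsheim_extension[OF _ \<tau> _ hol \<rho>(1) _ x])
    show "B a \<ge> 0" for a using kn \<tau> by (simp add: B_def)
    show "\<eta> > 0" using x by simp
    fix u assume "dist (complex_of_real \<tau>) u < \<rho>"
    then have u: "u *s s \<in> S" using \<rho>(2) by auto
    have "((\<lambda>a. of_real (kc a) * mpow (u *s s) a * cnj (mpow (complex_of_real \<tau> *s s) a))
        has_sum k (u *s s) (complex_of_real \<tau> *s s)) UNIV"
      unfolding eq[OF u S(3)] using u S by (intro diag_series_has_sum kn) auto
    moreover have "of_real (kc a) * mpow (u *s s) a * cnj (mpow (complex_of_real \<tau> *s s) a) = of_real (B a) * u ^ n a" for a
      using complex_norm_square[of "mpow s a"] by (simp add: mpow_smult B_def n_def mult_ac)
    ultimately show "((\<lambda>a. of_real (B a) * u ^ n a) has_sum k (u *s s) (complex_of_real \<tau> *s s)) UNIV"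
      by simp
  qed
  moreover have "B a * (\<tau> + x) ^ n a = kc a * (cmod (mpow (sqrt (\<tau> * (\<tau> + x)) *\<^sub>R s) a))\<^sup>2" for a
  proof -
    have "(sqrt (\<tau> * (\<tau> + x)) ^ n a)\<^sup>2 = (\<tau> * (\<tau> + x)) ^ n a"
      using \<tau> x by (simp add: power_even_eq[symmetric] power_mult[symmetric] mult.commute[of _ 2] power_mult[of _ 2])
    then show ?thesis
      using \<tau> x unfolding of_real_smult[symmetric] mpow_smult
      by (simp add: B_def n_def norm_mult norm_power power_mult_distrib)
  qed
  ultimately show ?thesis by (simp add: conv_set_def)
qed

text \<open>
  Pick \<open>s\<close> in the good set \<open>S\<close> so close to the boundary point
  \<open>p\<close> that a slight dilation \<open>\<mu> s\<close> exceeds \<open>p\<close> in every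
  coordinate and stays in a ball about \<open>p\<close> inside \<open>\<Omega>\<close>. The radius
  of the disc in which the kernel is holomorphic along the ray is bounded below on the segment
  from \<open>s\<close> to \<open>\<mu> s\<close> by compactness. So each application of
  \<open>diag_series_radial_extension\<close> gains a fixed amount and \<open>\<mu> s\<close> is
  reached; the series then converges in a polydisc containing \<open>p\<close>.
\<close>

lemma diagonal_kernel_boundary_step:
  fixes kc :: "('n::finite) mps"
  assumes kn: "\<And>a. kc a \<ge> 0"
    and hol: "\<And>w. w \<in> \<Omega> \<Longrightarrow> linewise_holomorphic (\<lambda>z. k z w) \<Omega>"
    and S: "open S" "S = connected_component_set (\<Omega> \<inter> conv_interior kc) 0"
    and eq: "\<And>z w. z \<in> S \<Longrightarrow> w \<in> S \<Longrightarrow> k z w = diag_series kc z w"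
    and \<Omega>: "open \<Omega>" and p: "p \<in> \<Omega>" "p \<in> closure S"
  shows "p \<in> S"
proof -
  have SU: "S \<subseteq> \<Omega> \<inter> conv_interior kc" unfolding S(2) by (rule connected_component_subset)
  have grow: "T \<subseteq> S" if "connected T" "T \<subseteq> \<Omega> \<inter> conv_interior kc" "x \<in> T" "x \<in> S" for T x
  proof -
    have "S = connected_component_set (\<Omega> \<inter> conv_interior kc) x"
      using that(4) S(2) connected_component_eq by metis
    then show ?thesis using connected_component_maximal[OF that(3,1,2)] by simp
  qed
  obtain e where e: "e > 0" "ball p e \<subseteq> \<Omega>" using \<Omega> p(1) open_contains_ball by blast
  define m where "m = norm p + 1"
  define \<mu> where "\<mu> = 1 + (e / 2) / m"
  have np: "m > 0" "norm p \<le> m" by (simp_all add: m_def add_nonneg_pos)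
  have \<mu>: "\<mu> > 1" using e np by (simp add: \<mu>_def)
  have "dist p (\<mu> *\<^sub>R p) = (\<mu> - 1) * norm p"
  proof -
    have "p - \<mu> *\<^sub>R p = (1 - \<mu>) *\<^sub>R p" by (simp add: scaleR_left_diff_distrib)
    then show ?thesis using \<mu> by (simp add: dist_norm)
  qed
  also have "\<dots> \<le> (\<mu> - 1) * m" using \<mu> np by simp
  also have "\<dots> = e / 2" using np by (simp add: \<mu>_def)
  also have "\<dots> < e" using e by simp
  finally have \<mu>p: "\<mu> *\<^sub>R p \<in> ball p e" by simp
  \<comment> \<open>Where \<open>p\<close> has a zero coordinate, the comparison with \<open>\<mu> s\<close> holds as soon as \<open>s\<close> has a nonzero one.\<close>
  define W where "W = ball p e \<inter> (\<lambda>s. \<mu> *\<^sub>R s) -` ball p e \<inter>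
      (\<Inter>i\<in>{i. p $ i \<noteq> 0}. {s. cmod (p $ i) < \<mu> * cmod (s $ i)})"
  have "open W" unfolding W_def
    by (intro open_Int open_INT open_vimage open_ball ballI finite)
      (auto intro!: open_Collect_less continuous_intros)
  moreover have "p \<in> W" using e \<mu>p \<mu> by (auto simp: W_def)
  ultimately have "S \<inter> W \<noteq> {}" using p(2) closure_iff_nhds_not_empty[of p S] by blast
  then obtain s where s: "s \<in> S \<inter> W" "\<And>i. s $ i \<noteq> 0"
    using exists_nonzero_coordinates[of "S \<inter> W"] S(1) \<open>open W\<close> by blast
  have sb: "s \<in> ball p e" "\<mu> *\<^sub>R s \<in> ball p e" using s by (auto simp: W_def)
  have ps: "cmod (p $ i) < \<mu> * cmod (s $ i)" for i
    using s \<mu> by (cases "p $ i = 0") (auto simp: W_def)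
  have ss: "cmod (s $ i) < \<mu> * cmod (s $ i)" for i using s(2)[of i] \<mu> by simp
  have seg: "\<tau> *\<^sub>R s \<in> ball p e" if "1 \<le> \<tau>" "\<tau> \<le> \<mu>" for \<tau>
  proof -
    have "convex ((\<lambda>t. t *\<^sub>R s) -` ball p e)"
      by (intro convex_linear_vimage convex_ball bounded_linear.linear bounded_linear_scaleR_left)
    then show ?thesis using sb that mem_is_interval_1_I[of "(\<lambda>t. t *\<^sub>R s) -` ball p e" 1 \<mu> \<tau>]
      by (simp add: is_interval_convex_1)
  qed
  have "\<mu> *\<^sub>R s \<in> conv_set kc"
  proof -
    define R where "R = {\<tau>. 1 \<le> \<tau> \<and> \<tau> \<le> \<mu> \<and> \<tau> *\<^sub>R s \<in> conv_interior kc}"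
    have R1: "1 \<in> R" using s SU \<mu> by (auto simp: R_def)
    have RS: "\<tau> *\<^sub>R s \<in> S" if \<tau>: "\<tau> \<in> R" for \<tau>
    proof -
      have "(\<lambda>t. t *\<^sub>R s) ` {1..\<tau>} \<subseteq> S"
      proof (rule grow)
        show "connected ((\<lambda>t. t *\<^sub>R s) ` {1..\<tau>})"
          by (intro connected_continuous_image continuous_intros) simp
        have "t *\<^sub>R s \<in> \<Omega> \<inter> conv_interior kc" if "t \<in> {1..\<tau>}" for t
        proof -
          have "cmod ((t *\<^sub>R s) $ i) \<le> cmod ((\<tau> *\<^sub>R s) $ i)" for i
            using that \<tau> by (simp add: R_def mult_right_mono)
          moreover have "\<tau> *\<^sub>R s \<in> conv_interior kc" using \<tau> by (simp add: R_def)
          ultimately have "t *\<^sub>R s \<in> conv_interior kc" by (rule conv_interior_mono[rotated])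
          then show ?thesis using seg[of t] that \<tau> e(2) by (auto simp: R_def)
        qed
        then show "(\<lambda>t. t *\<^sub>R s) ` {1..\<tau>} \<subseteq> \<Omega> \<inter> conv_interior kc" by blast
        show "1 *\<^sub>R s \<in> (\<lambda>t. t *\<^sub>R s) ` {1..\<tau>}" using \<tau> by (intro imageI) (simp add: R_def)
        show "1 *\<^sub>R s \<in> S" using s by simp
      qed
      then show ?thesis using imageI[of \<tau> "{1..\<tau>}" "\<lambda>t. t *\<^sub>R s"] \<tau> by (auto simp: R_def)
    qed
    have "compact (complex_of_real ` {1..\<mu>})"
      by (intro compact_continuous_image continuous_intros) simp
    moreover have "open {u. 0 + u *s s \<in> ball p e}" by (intro open_line_preimage) simp
    moreover have "complex_of_real ` {1..\<mu>} \<subseteq> {u. 0 + u *s s \<in> ball p e}"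
      using seg by (auto simp: of_real_smult)
    ultimately obtain \<eta>0 where \<eta>0: "\<eta>0 > 0" "(\<Union>x\<in>complex_of_real ` {1..\<mu>}. ball x \<eta>0) \<subseteq> {u. 0 + u *s s \<in> ball p e}"
      by (rule compact_subset_open_imp_ball_epsilon_subset)
    \<comment> \<open>The bound by \<open>1\<close> keeps the step small compared with \<open>\<rho> \<ge> 1\<close> in the estimate of \<open>\<rho>\<^sup>2\<close> below.\<close>
    define \<eta> where "\<eta> = min 1 \<eta>0"
    have \<eta>: "0 < \<eta>" "\<eta> \<le> 1" using \<eta>0(1) by (auto simp: \<eta>_def)
    have step: "sqrt (\<tau> * (\<tau> + \<eta> / 2)) *\<^sub>R s \<in> conv_set kc" if \<tau>: "\<tau> \<in> R" for \<tau>
    proof (rule diag_series_radial_extension[OF kn _ S(1) _ _ eq])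
      have "ball (of_real \<tau>) \<eta> \<subseteq> {u. 0 + u *s s \<in> \<Omega>}"
      proof
        fix u assume "u \<in> ball (complex_of_real \<tau>) \<eta>"
        then have "u \<in> (\<Union>x\<in>complex_of_real ` {1..\<mu>}. ball x \<eta>0)" using \<tau> by (auto simp: R_def \<eta>_def)
        then show "u \<in> {u. 0 + u *s s \<in> \<Omega>}" using \<eta>0(2) e(2) by blast
      qed
      moreover have "(\<lambda>u. k (0 + u *s s) (of_real \<tau> *s s)) holomorphic_on {u. 0 + u *s s \<in> \<Omega>}"
        using hol[of "of_real \<tau> *s s"] RS[OF \<tau>] SU unfolding linewise_holomorphic_def of_real_smult by blast
      ultimately show "(\<lambda>u. k (u *s s) (of_real \<tau> *s s)) holomorphic_on ball (of_real \<tau>) \<eta>"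
        using holomorphic_on_subset by simp
      show "S \<subseteq> conv_set kc" using SU conv_interior_subset[where kc = kc, OF kn] by blast
      show "of_real \<tau> *s s \<in> S" using RS[OF \<tau>] by (simp add: of_real_smult)
    qed (use \<tau> \<eta> in \<open>auto simp: R_def\<close>)
    define \<rho> where "\<rho> = Sup R"
    have bdd: "bdd_above R" by (auto simp: R_def bdd_above_def)
    have \<rho>: "1 \<le> \<rho>" unfolding \<rho>_def by (rule cSup_upper[OF R1 bdd])
    have "\<rho> - \<eta> / 8 < Sup R" using \<eta> by (simp add: \<rho>_def)
    then obtain \<tau> where \<tau>: "\<tau> \<in> R" "\<rho> - \<eta> / 8 < \<tau>"
      using less_cSup_iff[OF _ bdd] R1 by blast
    \<comment> \<open>One step from a \<open>\<tau>\<close> this close to the supremum \<open>\<rho>\<close> leads beyond \<open>\<rho>\<close>.\<close>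
    define \<sigma> where "\<sigma> = sqrt (\<tau> * (\<tau> + \<eta> / 2))"
    have "\<rho>\<^sup>2 < (\<rho> - \<eta> / 8) * (\<rho> - \<eta> / 8 + \<eta> / 2)"
    proof -
      have "(\<rho> - \<eta> / 8) * (\<rho> - \<eta> / 8 + \<eta> / 2) = \<rho>\<^sup>2 + (\<eta> / 8) * (2 * \<rho> - 3 * (\<eta> / 8))"
        by (simp add: power2_eq_square field_simps)
      moreover have "(\<eta> / 8) * (2 * \<rho> - 3 * (\<eta> / 8)) > 0" using \<eta> \<rho> by (intro mult_pos_pos) auto
      ultimately show ?thesis by linarith
    qed
    also have "\<dots> \<le> \<tau> * (\<tau> + \<eta> / 2)" using \<tau>(2) \<eta> \<rho> by (intro mult_mono) auto
    finally have \<rho>\<sigma>: "\<rho> < \<sigma>" unfolding \<sigma>_def using \<rho> by (intro real_less_rsqrt)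
    have \<sigma>s: "\<sigma> *\<^sub>R s \<in> conv_set kc" unfolding \<sigma>_def by (rule step[OF \<tau>(1)])
    have "\<mu> \<le> \<sigma>"
    proof (rule ccontr)
      assume "\<not> \<mu> \<le> \<sigma>"
      define t where "t = (\<rho> + \<sigma>) / 2"
      have t: "\<rho> < t" "t < \<sigma>" using \<rho>\<sigma> by (auto simp: t_def)
      have "t *\<^sub>R s \<in> conv_interior kc"
        unfolding conv_interior_def using \<sigma>s s(2) t \<rho> by (auto intro!: bexI[of _ "\<sigma> *\<^sub>R s"])
      then have "t \<in> R" using t \<rho> \<open>\<not> \<mu> \<le> \<sigma>\<close> by (auto simp: R_def)
      then have "t \<le> \<rho>" unfolding \<rho>_def by (rule cSup_upper[OF _ bdd])
      then show False using t by simp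
    qed
    then show ?thesis
      using \<mu> by (intro conv_set_mono[where kc = kc, OF kn \<sigma>s]) (auto intro: mult_right_mono)
  qed
  then have poly: "{y. \<forall>i. cmod (y $ i) < \<mu> * cmod (s $ i)} \<subseteq> conv_interior kc"
    using \<mu> by (auto simp: conv_interior_def intro!: bexI[of _ "\<mu> *\<^sub>R s"])
  have "ball p e \<inter> {y. \<forall>i. cmod (y $ i) < \<mu> * cmod (s $ i)} \<subseteq> S"
  proof (rule grow)
    show "connected (ball p e \<inter> {y. \<forall>i. cmod (y $ i) < \<mu> * cmod (s $ i)})"
      by (intro convex_connected convex_Int convex_ball convex_polydisc)
    show "s \<in> ball p e \<inter> {y. \<forall>i. cmod (y $ i) < \<mu> * cmod (s $ i)}" using sb ss by blast
  qed (use e(2) poly s in auto)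
  then show ?thesis using e(1) ps by auto
qed

text \<open>
  Let \<open>S\<close> be the component of the origin in the part of \<open>\<Omega>\<close> where
  the series converges locally uniformly. The identity theorem, used in each variable in turn,
  identifies the kernel with its series on \<open>S \<times> S\<close>, and
  \<open>diagonal_kernel_boundary_step\<close> shows that \<open>S\<close> is closed in
  \<open>\<Omega>\<close>.
\<close>

theorem diagonal_kernel_global_series:
  fixes kc :: "('n::finite) mps"
  assumes "diagonal_holomorphic_kernel \<Omega> k kc"
  shows "\<Omega> \<subseteq> conv_set kc" "\<And>z w. z \<in> \<Omega> \<Longrightarrow> w \<in> \<Omega> \<Longrightarrow> k z w = diag_series kc z w"
proof -
  have \<Omega>: "open \<Omega>" "connected \<Omega>" "0 \<in> \<Omega>"
    and h1: "\<And>w. w \<in> \<Omega> \<Longrightarrow> linewise_holomorphic (\<lambda>z. k z w) \<Omega>"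
    and h2: "\<And>z. z \<in> \<Omega> \<Longrightarrow> linewise_holomorphic (\<lambda>w. cnj (k z w)) \<Omega>"
    and kp: "\<And>a. kc a > 0"
    using assms by (auto simp: diagonal_holomorphic_kernel_def is_domain_def intro: holomorphic_on_vec_imp_linewise)
  have kn: "\<And>a. kc a \<ge> 0" using kp less_imp_le by blast
  obtain r where r: "r > 0" "ball 0 r \<subseteq> \<Omega>"
    and ser: "\<And>z w. z \<in> ball 0 r \<Longrightarrow> w \<in> ball 0 r \<Longrightarrow>
        ((\<lambda>a. complex_of_real (kc a) * mpow z a * cnj (mpow w a)) has_sum k z w) UNIV"
    using assms unfolding diagonal_holomorphic_kernel_def by blast
  have rC: "ball 0 r \<subseteq> conv_set kc"
  proof
    fix z :: "complex ^ 'n" assume "z \<in> ball 0 r"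
    from has_sum_Re[OF ser[OF this this]]
    have "((\<lambda>a. kc a * (cmod (mpow z a))\<^sup>2) has_sum Re (k z z)) UNIV"
      by (simp add: mult.assoc complex_norm_square[symmetric] flip: of_real_mult)
    then show "z \<in> conv_set kc" by (auto simp: conv_set_def intro: has_sum_imp_summable)
  qed
  have "0 \<in> conv_interior kc"
  proof -
    obtain q :: "complex ^ 'n" where "q \<in> ball 0 r" "\<forall>i. q $ i \<noteq> 0"
      using exists_nonzero_coordinates[of "ball 0 r" 0] r by auto
    then show ?thesis using rC by (auto simp: conv_interior_def intro!: bexI[of _ q])
  qed
  define S where "S = connected_component_set (\<Omega> \<inter> conv_interior kc) 0"
  have S: "open S" "connected S" "0 \<in> S" "S \<subseteq> \<Omega>" "S \<subseteq> conv_interior kc"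
    using \<Omega> open_conv_interior[of kc] \<open>0 \<in> conv_interior kc\<close> connected_component_subset[of "\<Omega> \<inter> conv_interior kc" 0]
    by (auto simp: S_def intro!: open_connected_component)
  have SC: "S \<subseteq> conv_set kc" using S(5) conv_interior_subset[where kc = kc, OF kn] by blast
  have eq1: "k z w = diag_series kc z w" if "z \<in> S" "w \<in> ball 0 r" for z w
  proof (rule linewise_identity[OF _ _ S(1,2,3) r(1) _ that(1)])
    show "linewise_holomorphic (\<lambda>z. k z w) S"
      using h1 r(2) that(2) S(4) linewise_holomorphic_subset by blast
    show "linewise_holomorphic (\<lambda>z. diag_series kc z w) S"
      using diag_series_linewise[where kc = kc, OF kn] rC that(2) S(5) linewise_holomorphic_subset by blast
    show "k z w = diag_series kc z w" if "z \<in> ball 0 r" for z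
      using has_sum_unique[OF ser[OF that \<open>w \<in> ball 0 r\<close>] diag_series_has_sum[where kc = kc, OF kn]] that \<open>w \<in> ball 0 r\<close> rC by blast
  qed
  have eq: "k z w = diag_series kc z w" if "z \<in> S" "w \<in> S" for z w
  proof -
    have "cnj (k z w) = diag_series kc w z"
    proof (rule linewise_identity[OF _ _ S(1,2,3) r(1) _ that(2)])
      show "linewise_holomorphic (\<lambda>w. cnj (k z w)) S"
        using h2 that(1) S(4) linewise_holomorphic_subset by blast
      show "linewise_holomorphic (\<lambda>w. diag_series kc w z) S"
        using diag_series_linewise[where kc = kc, OF kn] SC that(1) S(5) linewise_holomorphic_subset by blast
      show "cnj (k z w) = diag_series kc w z" if "w \<in> ball 0 r" for w
        using eq1[OF \<open>z \<in> S\<close> that] diag_series_cnj[of kc w z] by simp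
    qed
    then show ?thesis using diag_series_cnj[of kc z w] by (metis complex_cnj_cnj)
  qed
  have "\<Omega> - S = \<Omega> - closure S"
    using diagonal_kernel_boundary_step[OF kn h1 S(1) S_def eq \<Omega>(1)] closure_subset[of S] by blast
  then have "open (\<Omega> - S)" using \<Omega>(1) by (simp add: open_Diff)
  then have "\<Omega> \<subseteq> S" using connectedD[OF \<Omega>(2) S(1), of "\<Omega> - S"] S(3,4) \<Omega>(3) by blast
  then show "\<Omega> \<subseteq> conv_set kc" "\<And>z w. z \<in> \<Omega> \<Longrightarrow> w \<in> \<Omega> \<Longrightarrow> k z w = diag_series kc z w"
    using SC eq by blast+
qed

section \<open>Extracting coefficients by averaging over roots of unity\<close>

text \<open>
  The mean of \<open>\<omega>\<^bsup>b - a\<^esup>\<close> over all tuples \<open>\<omega>\<close>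
  of \<open>N\<close>-th roots of unity, written as a product of one-dimensional means.
\<close>

definition root_filter :: "nat \<Rightarrow> nat ^ 'n::finite \<Rightarrow> nat ^ 'n \<Rightarrow> complex" where
  "root_filter N a b = (\<Prod>i\<in>UNIV. (\<Sum>q<N. cis (2 * pi * real q * (real (b $ i) - real (a $ i)) / real N)) / of_nat N)"

lemma root_filter_same: "N > 0 \<Longrightarrow> root_filter N a a = 1"
  by (simp add: root_filter_def)

lemma norm_root_filter_le: "N > 0 \<Longrightarrow> cmod (root_filter N a b) \<le> 1"
proof -
  assume N: "N > 0"
  have "cmod (\<Sum>q<N. cis (2 * pi * real q * (real (b $ i) - real (a $ i)) / real N)) \<le> real N" for i
    by (rule order_trans[OF norm_sum]) simp
  then show ?thesis
    unfolding root_filter_def using N by (auto simp: prod_norm[symmetric] norm_divide intro!: prod_le_1)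
qed

text \<open>
  In a coordinate where \<open>a\<close> and \<open>b\<close> differ, the mean is a full geometric
  sum of an \<open>N\<close>-th root of unity, which is not \<open>1\<close> as \<open>0 <
  |b\<^sub>i - a\<^sub>i| < N\<close>.
\<close>

lemma root_filter_vanishes:
  assumes N: "\<And>i. a $ i < N" "\<And>i. b $ i < N" and "a \<noteq> b"
  shows "root_filter N a b = 0"
proof -
  obtain i where i: "a $ i \<noteq> b $ i" using assms(3) by (auto simp: vec_eq_iff)
  define x where "x = 2 * pi * (real (b $ i) - real (a $ i)) / real N"
  have N0: "N > 0" using N(1)[of i] by simp
  have "cis x \<noteq> 1"
  proof
    assume "cis x = 1"
    then have "cos x = 1" by (simp add: complex_eq_iff)
    then obtain m :: int where "x = of_int m * 2 * pi" using cos_one_2pi_int by blast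
    then have "(2 * pi) * (real (b $ i) - real (a $ i)) = (2 * pi) * (of_int m * real N)"
      using N0 by (simp add: x_def nonzero_divide_eq_eq mult_ac)
    then have "real (b $ i) - real (a $ i) = of_int m * real N"
      unfolding mult_cancel_left by simp
    then have "real_of_int (int (b $ i) - int (a $ i)) = real_of_int (m * int N)" by simp
    then have "int (b $ i) - int (a $ i) = m * int N" by (simp only: of_int_eq_iff)
    moreover have "\<bar>int (b $ i) - int (a $ i)\<bar> < int N" using N(1)[of i] N(2)[of i] by linarith
    ultimately have lt: "\<bar>m\<bar> * int N < int N" by (simp add: abs_mult)
    have "m = 0"
    proof (rule ccontr)
      assume "m \<noteq> 0"
      then have "1 * int N \<le> \<bar>m\<bar> * int N" by (intro mult_right_mono) auto
      then show False using lt by simp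
    qed
    then show False using i \<open>int (b $ i) - int (a $ i) = m * int N\<close> by simp
  qed
  moreover have "cis x ^ N = 1"
  proof -
    have "cis x ^ N = cis (2 * pi * of_int (int (b $ i) - int (a $ i)))"
      using N0 by (simp add: Complex.DeMoivre x_def)
    then show ?thesis by (simp only: cis_multiple_2pi Ints_of_int)
  qed
  ultimately have "(\<Sum>q<N. cis x ^ q) = 0" by (simp add: geometric_sum)
  moreover have "cis (2 * pi * real q * (real (b $ i) - real (a $ i)) / real N) = cis x ^ q" for q
    by (simp add: Complex.DeMoivre x_def mult_ac)
  ultimately have "(\<Sum>q<N. cis (2 * pi * real q * (real (b $ i) - real (a $ i)) / real N)) / complex_of_nat N = 0" by simp
  then show ?thesis unfolding root_filter_def by (intro prod_zero) auto
qed

lemma root_filter_eventually: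
  assumes "finite G"
  obtains N0 where "N0 > 0" "\<And>N b. N \<ge> N0 \<Longrightarrow> b \<in> G \<Longrightarrow> b \<noteq> a \<Longrightarrow> root_filter N a b = 0"
proof -
  define N0 where "N0 = Suc (\<Sum>b\<in>insert a G. \<Sum>i\<in>UNIV. b $ i)"
  have "b $ i < N0" if "b \<in> insert a G" for b i
  proof -
    have "b $ i \<le> (\<Sum>i\<in>UNIV. b $ i)" by (rule member_le_sum) auto
    also have "\<dots> \<le> (\<Sum>b\<in>insert a G. \<Sum>i\<in>UNIV. b $ i)"
      using that assms by (intro member_le_sum) auto
    finally show ?thesis by (simp add: N0_def)
  qed
  then show ?thesis
    by (intro that[of N0]) (auto simp: N0_def intro!: root_filter_vanishes intro: less_le_trans)
qed

text \<open>
  For large \<open>N\<close> the filter removes all terms of a finite set carrying most of the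
  sum, except the term \<open>a\<close>. The extra factor \<open>V\<close> is there because norms
  of differences of averaged kernels involve two filters; the bound must be uniform in the second
  one.
\<close>

lemma root_filter_extracts:
  fixes g :: "nat ^ 'n::finite \<Rightarrow> real"
  assumes g: "g summable_on UNIV" and \<gamma>: "\<And>b. cmod (\<gamma> b) \<le> g b" and \<epsilon>: "\<epsilon> > 0"
  obtains N0 where "N0 > 0"
    "\<And>N V. N \<ge> N0 \<Longrightarrow> (\<And>b. cmod (V b) \<le> 1) \<Longrightarrow> V a = 1 \<Longrightarrow>
       cmod (infsum (\<lambda>b. \<gamma> b * root_filter N a b * V b) UNIV - \<gamma> a) \<le> \<epsilon>"
proof -
  have gn: "g b \<ge> 0" for b using \<gamma> norm_ge_zero order_trans by blast
  obtain G where G: "finite G" "dist (sum g G) (infsum g UNIV) \<le> \<epsilon>"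
    using infsum_finite_approximation[OF g \<epsilon>] by auto
  define G' where "G' = insert a G"
  have fG': "finite G'" using G by (simp add: G'_def)
  have sG: "sum g G \<le> sum g G'" using fG' gn by (intro sum_mono2) (auto simp: G'_def)
  have gs: "g summable_on A" for A using g by (rule summable_on_subset_banach) auto
  have "infsum g UNIV = infsum g (G' \<union> - G')" by simp
  also have "\<dots> = sum g G' + infsum g (- G')"
    using infsum_Un_disjoint[OF gs gs, of G' "- G'"] fG' by simp
  finally have tail: "infsum g (- G') \<le> \<epsilon>" using G(2) sG by (simp add: dist_real_def)
  obtain N0 where N0: "N0 > 0" "\<And>N b. N \<ge> N0 \<Longrightarrow> b \<in> G' \<Longrightarrow> b \<noteq> a \<Longrightarrow> root_filter N a b = 0"
    using root_filter_eventually[OF fG', of a] by blast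
  show ?thesis
  proof (rule that[OF N0(1)])
    fix N V assume N: "N \<ge> N0" and V: "\<And>b. cmod (V b) \<le> 1" "V a = 1"
    let ?h = "\<lambda>b. \<gamma> b * root_filter N a b * V b"
    have N1: "N > 0" using N N0 by simp
    have hg: "cmod (?h b) \<le> g b" for b
    proof -
      have "cmod (?h b) \<le> g b * 1 * 1"
        unfolding norm_mult using \<gamma> V norm_root_filter_le[OF N1] gn
        by (intro mult_mono) (auto intro: mult_nonneg_nonneg)
      then show ?thesis by simp
    qed
    have hs: "?h summable_on A" for A
      by (rule abs_summable_summable, rule summable_on_comparison_test[OF gs]) (use hg in auto)
    have "infsum ?h UNIV = infsum ?h (G' \<union> - G')" by simp
    also have "\<dots> = sum ?h G' + infsum ?h (- G')"
      using infsum_Un_disjoint[OF hs hs, of G' "- G'"] fG' by simp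
    also have "sum ?h G' = sum ?h {a}"
      using fG' N0(2)[OF N] by (intro sum.mono_neutral_right) (auto simp: G'_def)
    also have "\<dots> = \<gamma> a" using V N1 by (simp add: root_filter_same)
    finally have "cmod (infsum ?h UNIV - \<gamma> a) = cmod (infsum ?h (- G'))" by simp
    also have "\<dots> \<le> infsum g (- G')"
      by (rule norm_infsum_le[OF has_sum_infsum[OF hs] has_sum_infsum[OF gs]]) (use hg in auto)
    finally show "cmod (infsum ?h UNIV - \<gamma> a) \<le> \<epsilon>" using tail by simp
  qed
qed

section \<open>Reproducing kernel Hilbert spaces of diagonal kernels\<close>

lemma (in is_rkhs) is_semi_ip: "semi_ip H (\<lambda>f g x. f x + g x) (\<lambda>c f x. c * f x) ip"
  by unfold_locales (rule add_mem scale_mem ip_add ip_scale ip_commute ip_nonneg; assumption)+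

sublocale is_rkhs \<subseteq> R: semi_ip H "\<lambda>f g x. f x + g x" "\<lambda>c f x. c * f x" ip
  by (rule is_semi_ip)

context is_rkhs
begin

lemma R_sub: "R.sub f g = (\<lambda>x. f x - g x)" by (simp add: R.sub_def fun_eq_iff)

lemma diff_mem: "f \<in> H \<Longrightarrow> g \<in> H \<Longrightarrow> (\<lambda>x. f x - g x) \<in> H"
  using R.sub_in[of f g] by (simp add: R_sub)

lemma sum_mem: "finite S \<Longrightarrow> (\<And>q. q \<in> S \<Longrightarrow> h q \<in> H) \<Longrightarrow> (\<lambda>x. \<Sum>q\<in>S. c q * h q x) \<in> H"
  by (induction S rule: finite_induct) (auto intro!: zero_mem add_mem scale_mem)

lemma ip_zero: "g \<in> H \<Longrightarrow> ip (\<lambda>_. 0) g = 0"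
  using ip_scale[OF zero_mem, of g 0] by simp

lemma ip_sum_left:
  "finite S \<Longrightarrow> (\<And>q. q \<in> S \<Longrightarrow> h q \<in> H) \<Longrightarrow> g \<in> H \<Longrightarrow>
    ip (\<lambda>x. \<Sum>q\<in>S. c q * h q x) g = (\<Sum>q\<in>S. c q * ip (h q) g)"
  by (induction S rule: finite_induct) (simp_all add: ip_zero ip_add ip_scale scale_mem sum_mem)

lemma ip_sum_right:
  assumes "finite S" "\<And>q. q \<in> S \<Longrightarrow> h q \<in> H" "g \<in> H"
  shows "ip g (\<lambda>x. \<Sum>q\<in>S. c q * h q x) = (\<Sum>q\<in>S. cnj (c q) * ip g (h q))"
proof -
  have "ip g (\<lambda>x. \<Sum>q\<in>S. c q * h q x) = cnj (\<Sum>q\<in>S. c q * ip (h q) g)"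
    using ip_commute[OF sum_mem[OF assms(1,2), where c = c] assms(3)] ip_sum_left[OF assms, where c = c] by simp
  also have "\<dots> = (\<Sum>q\<in>S. cnj (c q) * ip g (h q))"
    using assms ip_commute[of _ g] by (simp add: assms(3) cong: sum.cong)
  finally show ?thesis .
qed

text \<open>
  Convergence in norm implies weak convergence by the Cauchy--Schwarz inequality, and point
  evaluations are inner products with kernel functions.
\<close>

lemma norm_tendsto_imp_pointwise:
  assumes s: "\<And>n. s n \<in> H" and f: "f \<in> H" and g: "g \<in> H"
    and lim: "(\<lambda>n. R.nrm (\<lambda>x. s n x - f x)) \<longlonglongrightarrow> 0"
  shows "(\<lambda>n. ip g (s n)) \<longlonglongrightarrow> ip g f" "\<And>z. z \<in> X \<Longrightarrow> (\<lambda>n. s n z) \<longlonglongrightarrow> f z"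
proof -
  have *: "(\<lambda>n. ip (s n) h) \<longlonglongrightarrow> ip f h" if h: "h \<in> H" for h
  proof (rule LIM_zero_cancel, rule Lim_null_comparison)
    show "\<forall>\<^sub>F n in sequentially. cmod (ip (s n) h - ip f h) \<le> R.nrm (\<lambda>x. s n x - f x) * R.nrm h"
    proof (intro always_eventually allI)
      fix n
      have "ip (s n) h - ip f h = ip (\<lambda>x. s n x - f x) h"
        using R.Q_sub[OF s f h] by (simp add: R_sub)
      then show "cmod (ip (s n) h - ip f h) \<le> R.nrm (\<lambda>x. s n x - f x) * R.nrm h"
        using R.cauchy_schwarz[OF diff_mem[OF s f] h] by simp
    qed
    show "(\<lambda>n. R.nrm (\<lambda>x. s n x - f x) * R.nrm h) \<longlonglongrightarrow> 0"
      using tendsto_mult_right[OF lim, of "R.nrm h"] by simp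
  qed
  show "(\<lambda>n. ip g (s n)) \<longlonglongrightarrow> ip g f"
    using tendsto_cnj[OF *[OF g]] ip_commute[OF s g] ip_commute[OF f g] by simp
  show "(\<lambda>n. s n z) \<longlonglongrightarrow> f z" if "z \<in> X" for z
    using *[OF kernel_mem[OF that]] reproducing[OF s that] reproducing[OF f that] by simp
qed

end


lemma has_sum_finite_sum:
  fixes f :: "'q \<Rightarrow> 'b \<Rightarrow> 'c :: topological_comm_monoid_add"
  assumes "finite Q" "\<And>q. q \<in> Q \<Longrightarrow> (f q has_sum s q) A"
  shows "((\<lambda>b. \<Sum>q\<in>Q. f q b) has_sum (\<Sum>q\<in>Q. s q)) A"
  using assms by (induction Q rule: finite_induct) (auto intro: has_sum_add)

text \<open>
  The closed polydisc of radius \<open>r\<close> contains the tori over which averages are taken.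
\<close>

locale diagonal_rkhs = is_rkhs \<Omega> k H ip
  for \<Omega> :: "(complex ^ 'n::finite) set" and k H ip +
  fixes kc :: "nat ^ 'n \<Rightarrow> real" and r :: real
  assumes kc_pos: "kc a > 0" and r_pos: "r > 0"
    and polydisc: "(\<And>i. cmod (z $ i) \<le> r) \<Longrightarrow> z \<in> \<Omega>"
    and series: "z \<in> \<Omega> \<Longrightarrow> w \<in> \<Omega> \<Longrightarrow>
      ((\<lambda>a. complex_of_real (kc a) * mpow z a * cnj (mpow w a)) has_sum k z w) UNIV"
begin

definition monomial :: "nat ^ 'n \<Rightarrow> complex ^ 'n \<Rightarrow> complex" where
  "monomial a z = (if z \<in> \<Omega> then mpow z a else 0)"

definition torus_point :: "nat \<Rightarrow> ('n \<Rightarrow> nat) \<Rightarrow> complex ^ 'n" where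
  "torus_point N q = (\<chi> i. of_real r * cis (2 * pi * real (q i) / real N))"

text \<open>
  The factor by which \<open>z\<^sup>a\<close> on the torus of radius \<open>r\<close> differs
  from \<open>z\<^sup>a\<close> on the unit torus.
\<close>

definition radius_pow :: "nat ^ 'n \<Rightarrow> real" where
  "radius_pow a = r ^ (\<Sum>i\<in>UNIV. a $ i)"

definition grid_weight :: "nat \<Rightarrow> nat ^ 'n \<Rightarrow> ('n \<Rightarrow> nat) \<Rightarrow> complex" where
  "grid_weight N a q = (\<Prod>i\<in>UNIV. cis (2 * pi * real (q i) * real (a $ i) / real N) / of_nat N)"

definition grid :: "nat \<Rightarrow> ('n \<Rightarrow> nat) set" where
  "grid N = PiE UNIV (\<lambda>_. {..<N})"

text \<open>
  A Riemann sum for the Cauchy integral over the torus of radius \<open>r\<close> whose value is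
  \<open>r\<^bsup>|a|\<^esup>\<close> times the coefficient at \<open>a\<close>.
\<close>

definition torus_average :: "nat \<Rightarrow> nat ^ 'n \<Rightarrow> (complex ^ 'n \<Rightarrow> complex) \<Rightarrow> complex" where
  "torus_average N a f = (\<Sum>q\<in>grid N. cnj (grid_weight N a q) * f (torus_point N q))"

text \<open>
  The combination of kernel functions that represents the functional \<open>torus_average N
  a\<close>.
\<close>

definition averaged_kernel :: "nat \<Rightarrow> nat ^ 'n \<Rightarrow> complex ^ 'n \<Rightarrow> complex" where
  "averaged_kernel N a = (\<lambda>z. \<Sum>q\<in>grid N. grid_weight N a q * kernel_fun \<Omega> k (torus_point N q) z)"

lemma radius_pow_pos: "radius_pow a > 0" using r_pos by (simp add: radius_pow_def)

lemma finite_grid: "finite (grid N)" by (simp add: grid_def finite_PiE)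

lemma torus_point_in: "torus_point N q \<in> \<Omega>"
  by (rule polydisc) (use r_pos in \<open>simp add: torus_point_def norm_mult\<close>)

lemma torus_average_mpow: "torus_average N a (\<lambda>z. mpow z b) = of_real (radius_pow b) * root_filter N a b"
proof -
  have "cnj (grid_weight N a q) * mpow (torus_point N q) b =
     (\<Prod>i\<in>UNIV. of_real (r ^ (b $ i)) * (cis (2 * pi * real (q i) * (real (b $ i) - real (a $ i)) / real N) / of_nat N))" for q
    unfolding grid_weight_def mpow_def torus_point_def cnj_prod prod.distrib[symmetric]
  proof (intro prod.cong refl)
    fix i
    define x where "x = 2 * pi * real (q i) * real (a $ i) / real N"
    define y where "y = 2 * pi * real (q i) / real N"
    have z: "2 * pi * real (q i) * (real (b $ i) - real (a $ i)) / real N = real (b $ i) * y - x"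
      by (simp add: x_def y_def algebra_simps diff_divide_distrib)
    have "cis (real (b $ i) * y - x) = cis (- x) * cis (real (b $ i) * y)" by (simp add: cis_mult)
    then show "cnj (cis (2 * pi * real (q i) * real (a $ i) / real N) / of_nat N) *
       (\<chi> i. of_real r * cis (2 * pi * real (q i) / real N)) $ i ^ (b $ i) =
       of_real (r ^ (b $ i)) * (cis (2 * pi * real (q i) * (real (b $ i) - real (a $ i)) / real N) / of_nat N)"
      unfolding z x_def[symmetric] vec_lambda_beta y_def[symmetric]
      by (simp add: power_mult_distrib cis_cnj) (simp add: Complex.DeMoivre)
  qed
  then have "torus_average N a (\<lambda>z. mpow z b) = (\<Sum>q\<in>grid N. \<Prod>i\<in>UNIV. of_real (r ^ (b $ i)) *
     (cis (2 * pi * real (q i) * (real (b $ i) - real (a $ i)) / real N) / of_nat N))"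
    by (simp add: torus_average_def)
  also have "\<dots> = (\<Prod>i\<in>UNIV. \<Sum>q<N. of_real (r ^ (b $ i)) *
     (cis (2 * pi * real q * (real (b $ i) - real (a $ i)) / real N) / of_nat N))"
    unfolding grid_def by (rule prod_sum_PiE[symmetric]) auto
  also have "\<dots> = (\<Prod>i\<in>UNIV. of_real (r ^ (b $ i))) * root_filter N a b"
    unfolding root_filter_def prod.distrib[symmetric] sum_divide_distrib sum_distrib_left by simp
  finally show ?thesis by (simp add: radius_pow_def power_sum)
qed

lemma torus_average_has_sum:
  assumes "\<And>z. z \<in> \<Omega> \<Longrightarrow> ((\<lambda>b. \<phi> b * mpow z b) has_sum f z) UNIV"
  shows "((\<lambda>b. \<phi> b * of_real (radius_pow b) * root_filter N a b) has_sum torus_average N a f) UNIV"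
proof -
  have "((\<lambda>b. \<Sum>q\<in>grid N. cnj (grid_weight N a q) * (\<phi> b * mpow (torus_point N q) b)) has_sum torus_average N a f) UNIV"
    unfolding torus_average_def
    by (rule has_sum_finite_sum) (auto intro!: has_sum_cmult_right assms torus_point_in finite_grid)
  moreover have "(\<Sum>q\<in>grid N. cnj (grid_weight N a q) * (\<phi> b * mpow (torus_point N q) b)) = \<phi> b * of_real (radius_pow b) * root_filter N a b" for b
    using torus_average_mpow[of N a b] by (simp add: torus_average_def sum_distrib_left[symmetric] mult.left_commute[of _ "\<phi> b"] mult.assoc)
  ultimately show ?thesis by simp
qed

lemma ip_averaged_kernel:
  assumes "f \<in> H" shows "ip f (averaged_kernel N a) = torus_average N a f"
  unfolding averaged_kernel_def torus_average_def
  by (subst ip_sum_right) (auto simp: finite_grid kernel_mem torus_point_in assms reproducing[OF assms, symmetric])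

lemma averaged_kernel_mem: "averaged_kernel N a \<in> H"
  unfolding averaged_kernel_def by (intro sum_mem finite_grid kernel_mem torus_point_in)

lemma averaged_kernel_has_sum:
  assumes "z \<in> \<Omega>"
  shows "((\<lambda>b. of_real (kc b * radius_pow b) * cnj (root_filter N a b) * mpow z b) has_sum averaged_kernel N a z) UNIV"
proof -
  have c: "((\<lambda>b. cnj (of_real (kc b) * mpow z b) * mpow w b) has_sum cnj (k z w)) UNIV" if "w \<in> \<Omega>" for w
  proof -
    have "((\<lambda>b. cnj (of_real (kc b) * mpow z b * cnj (mpow w b))) has_sum cnj (k z w)) UNIV"
      using series[OF assms that] by (simp only: has_sum_cnj_iff)
    then show ?thesis by simp
  qed
  from torus_average_has_sum[of "\<lambda>b. cnj (of_real (kc b) * mpow z b)" "\<lambda>w. cnj (k z w)", OF c, of N a]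
  have "((\<lambda>b. cnj (of_real (kc b * radius_pow b) * cnj (root_filter N a b) * mpow z b)) has_sum torus_average N a (\<lambda>w. cnj (k z w))) UNIV"
    by (simp add: mult_ac)
  moreover have "torus_average N a (\<lambda>w. cnj (k z w)) = cnj (averaged_kernel N a z)"
    using assms by (simp add: torus_average_def averaged_kernel_def kernel_fun_def)
  ultimately show ?thesis by (simp only: has_sum_cnj_iff)
qed

lemma all_r_in: "(\<chi> i. of_real r) \<in> \<Omega>"
  by (rule polydisc) (use r_pos in simp)

lemma mpow_all_r: "mpow (\<chi> i. of_real r) a = of_real (radius_pow a)"
  by (simp add: mpow_def radius_pow_def power_sum)

lemma abs_summable_at:
  fixes \<phi> :: "nat ^ 'n \<Rightarrow> complex"
  assumes "((\<lambda>b. \<phi> b * mpow z b) has_sum s) UNIV"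
  shows "(\<lambda>b. cmod (\<phi> b) * cmod (mpow z b)) summable_on UNIV"
  using summable_on_iff_abs_summable_on_complex[THEN iffD1, OF has_sum_imp_summable[OF assms]]
  by (simp add: norm_mult)

lemma kernel_summable_at: "z \<in> \<Omega> \<Longrightarrow> (\<lambda>b. kc b * radius_pow b * cmod (mpow z b)) summable_on UNIV"
proof -
  assume z: "z \<in> \<Omega>"
  have "((\<lambda>b. of_real (kc b * radius_pow b) * mpow z b) has_sum k z (\<chi> i. of_real r)) UNIV"
    using series[OF z all_r_in] by (simp add: mpow_all_r mult_ac)
  from abs_summable_at[OF this] show ?thesis
    using kc_pos radius_pow_pos by (simp add: norm_mult abs_mult abs_of_pos)
qed

lemma torus_average_tendsto:
  assumes "\<And>z. z \<in> \<Omega> \<Longrightarrow> ((\<lambda>b. \<phi> b * mpow z b) has_sum f z) UNIV"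
  shows "(\<lambda>N. torus_average N a f) \<longlonglongrightarrow> \<phi> a * of_real (radius_pow a)"
proof (rule LIMSEQ_I)
  fix e :: real assume e: "e > 0"
  have 1: "(\<lambda>b. cmod (\<phi> b) * radius_pow b) summable_on UNIV"
    using abs_summable_at[OF assms[OF all_r_in]] radius_pow_pos by (simp add: mpow_all_r abs_of_pos)
  have 2: "cmod (\<phi> b * of_real (radius_pow b)) \<le> cmod (\<phi> b) * radius_pow b" for b
    using radius_pow_pos by (simp add: norm_mult abs_of_pos)
  have 3: "e / 2 > 0" using e by simp
  obtain N0 where "N0 > 0" "\<And>N V. N \<ge> N0 \<Longrightarrow> (\<And>b. cmod (V b) \<le> 1) \<Longrightarrow> V a = 1 \<Longrightarrow>
      cmod (infsum (\<lambda>b. \<phi> b * of_real (radius_pow b) * root_filter N a b * V b) UNIV - \<phi> a * of_real (radius_pow a)) \<le> e / 2"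
    by (rule root_filter_extracts[OF 1 2 3, of a]) blast
  from this(2)[of _ "\<lambda>_. 1"] have "\<forall>N\<ge>N0. norm (torus_average N a f - \<phi> a * of_real (radius_pow a)) < e"
    using infsumI[OF torus_average_has_sum[of \<phi> f, OF assms]] e by fastforce
  then show "\<exists>no. \<forall>N\<ge>no. norm (torus_average N a f - \<phi> a * of_real (radius_pow a)) < e" by blast
qed

text \<open>
  Inner products of averaged kernels are averages of averaged kernels, that is, sums
  \<open>\<Sum>\<^sub>b k\<^sub>b r\<^bsup>2|b|\<^esup>\<close> weighted by two filters. They tend
  to the term \<open>b = a\<close> as both parameters grow, so the norms of differences tend to
  \<open>0\<close>.
\<close>

lemma averaged_kernel_Cauchy:
  assumes e: "e > 0"
  shows "\<exists>N0. \<forall>M\<ge>N0. \<forall>N\<ge>N0. R.nrm (\<lambda>x. averaged_kernel M a x - averaged_kernel N a x) < e"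
proof -
  define \<gamma> where "\<gamma> = kc a * (radius_pow a)\<^sup>2"
  define e' where "e' = e\<^sup>2 / 8"
  have e': "e' > 0" using e by (simp add: e'_def)
  have 1: "(\<lambda>b. kc b * radius_pow b * radius_pow b) summable_on UNIV"
    using kernel_summable_at[OF all_r_in] radius_pow_pos by (simp add: mpow_all_r abs_of_pos)
  have 2: "cmod (of_real (kc b * radius_pow b * radius_pow b)) \<le> kc b * radius_pow b * radius_pow b" for b
    using kc_pos radius_pow_pos by (simp add: norm_mult abs_of_pos)
  obtain N0 where N0: "N0 > 0" "\<And>N V. N \<ge> N0 \<Longrightarrow> (\<And>b. cmod (V b) \<le> 1) \<Longrightarrow> V a = 1 \<Longrightarrow>
      cmod (infsum (\<lambda>b. of_real (kc b * radius_pow b * radius_pow b) * root_filter N a b * V b) UNIV - of_real (kc a * radius_pow a * radius_pow a)) \<le> e'"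
    by (rule root_filter_extracts[OF 1 2 e', of a]) blast
  have T: "cmod (ip (averaged_kernel N a) (averaged_kernel M a) - of_real \<gamma>) \<le> e'" if "M \<ge> N0" "N \<ge> N0" for M N
  proof -
    have M: "M > 0" "N > 0" using that N0(1) by auto
    have "ip (averaged_kernel N a) (averaged_kernel M a) = infsum (\<lambda>b. of_real (kc b * radius_pow b * radius_pow b) * root_filter M a b * cnj (root_filter N a b)) UNIV"
      using infsumI[OF torus_average_has_sum[OF averaged_kernel_has_sum], of N a M a] by (simp add: ip_averaged_kernel averaged_kernel_mem mult_ac)
    then show ?thesis
      using N0(2)[OF that(1), of "\<lambda>b. cnj (root_filter N a b)"] M
      by (simp add: norm_root_filter_le root_filter_same \<gamma>_def power2_eq_square mult_ac)
  qed
  have "R.nrm (\<lambda>x. averaged_kernel M a x - averaged_kernel N a x) < e" if "M \<ge> N0" "N \<ge> N0" for M N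
  proof -
    have re: "\<bar>Re (ip (averaged_kernel m a) (averaged_kernel n a)) - \<gamma>\<bar> \<le> e'" if "m \<ge> N0" "n \<ge> N0" for m n
      using abs_Re_le_cmod[of "ip (averaged_kernel m a) (averaged_kernel n a) - of_real \<gamma>"] T[OF that(2,1)] by simp
    have "(R.nrm (\<lambda>x. averaged_kernel M a x - averaged_kernel N a x))\<^sup>2 = Re (ip (averaged_kernel M a) (averaged_kernel M a)) - 2 * Re (ip (averaged_kernel M a) (averaged_kernel N a)) + Re (ip (averaged_kernel N a) (averaged_kernel N a))"
      using R.nrm_sub_sq[OF averaged_kernel_mem averaged_kernel_mem, of M a N a] by (simp add: R_sub)
    also have "\<dots> \<le> 4 * e'" using re[OF that(1,1)] re[OF that] re[OF that(2,2)] by linarith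
    also have "\<dots> < e\<^sup>2" using e by (simp add: e'_def)
    finally show ?thesis using e by (intro power2_less_imp_less[of _ e]) auto
  qed
  then show ?thesis by blast
qed

text \<open>
  The limit of the averaged kernels exists by completeness, and its values show that it is a
  multiple of the monomial. Inner products with it are the limits of the averages.
\<close>

lemma monomial_mem_and_ip:
  shows "monomial a \<in> H" "f \<in> H \<Longrightarrow> (\<lambda>N. torus_average N a f) \<longlonglongrightarrow> of_real (kc a * radius_pow a) * ip f (monomial a)"
proof -
  have "\<exists>f\<in>H. (\<lambda>n. sqrt (Re (ip (\<lambda>x. averaged_kernel n a x - f x) (\<lambda>x. averaged_kernel n a x - f x)))) \<longlonglongrightarrow> 0"
    by (rule complete[OF averaged_kernel_mem]) (use averaged_kernel_Cauchy in \<open>simp add: R.nrm_def\<close>)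
  then obtain e where e: "e \<in> H" "(\<lambda>n. R.nrm (\<lambda>x. averaged_kernel n a x - e x)) \<longlonglongrightarrow> 0"
    by (auto simp: R.nrm_def)
  have ez: "e z = of_real (kc a * radius_pow a) * monomial a z" for z
  proof (cases "z \<in> \<Omega>")
    case True
    have "(\<lambda>n. averaged_kernel n a z) \<longlonglongrightarrow> of_real (kc a * radius_pow a) * mpow z a"
    proof (rule LIMSEQ_I)
      fix d :: real assume d: "d > 0"
      have 1: "cmod (cnj (of_real (kc b * radius_pow b) * mpow z b)) \<le> kc b * radius_pow b * cmod (mpow z b)" for b
        using kc_pos radius_pow_pos by (simp add: norm_mult abs_mult abs_of_pos)
      have 2: "d / 2 > 0" using d by simp
      obtain N0 where "N0 > 0" "\<And>N V. N \<ge> N0 \<Longrightarrow> (\<And>b. cmod (V b) \<le> 1) \<Longrightarrow> V a = 1 \<Longrightarrow>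
          cmod (infsum (\<lambda>b. cnj (of_real (kc b * radius_pow b) * mpow z b) * root_filter N a b * V b) UNIV - cnj (of_real (kc a * radius_pow a) * mpow z a)) \<le> d / 2"
        by (rule root_filter_extracts[OF kernel_summable_at[OF True] 1 2, of a]) blast
      from this(2)[of _ "\<lambda>_. 1"]
      have *: "cmod (infsum (\<lambda>b. cnj (of_real (kc b * radius_pow b) * mpow z b) * root_filter N a b) UNIV - cnj (of_real (kc a * radius_pow a) * mpow z a)) \<le> d / 2"
        if "N \<ge> N0" for N using that by simp
      have "norm (averaged_kernel N a z - of_real (kc a * radius_pow a) * mpow z a) < d" if "N \<ge> N0" for N
      proof -
        have "cnj (averaged_kernel N a z) = infsum (\<lambda>b. cnj (of_real (kc b * radius_pow b) * mpow z b) * root_filter N a b) UNIV"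
          using infsumI[OF averaged_kernel_has_sum[OF True, of N a]] infsum_cnj[of "\<lambda>b. of_real (kc b * radius_pow b) * cnj (root_filter N a b) * mpow z b" UNIV]
          by (simp add: mult_ac)
        then have "cmod (cnj (averaged_kernel N a z - of_real (kc a * radius_pow a) * mpow z a)) \<le> d / 2" using *[OF that] by simp
        then show ?thesis using d by (simp only: complex_mod_cnj)
      qed
      then show "\<exists>no. \<forall>N\<ge>no. norm (averaged_kernel N a z - of_real (kc a * radius_pow a) * mpow z a) < d" by blast
    qed
    then have "e z = of_real (kc a * radius_pow a) * mpow z a"
      using norm_tendsto_imp_pointwise(2)[OF averaged_kernel_mem e(1,1,2) True] LIMSEQ_unique by blast
    then show ?thesis using True by (simp add: monomial_def)
  next
    case False
    then show ?thesis using vanish_off[OF e(1)] by (simp add: monomial_def)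
  qed
  have nz: "kc a * radius_pow a \<noteq> 0" using kc_pos radius_pow_pos by (simp add: less_imp_neq[symmetric])
  have "monomial a = (\<lambda>z. of_real (inverse (kc a * radius_pow a)) * e z)"
    unfolding ez using nz by (simp add: fun_eq_iff field_simps)
  then show m: "monomial a \<in> H" using scale_mem[OF e(1)] by simp
  have "e = (\<lambda>z. of_real (kc a * radius_pow a) * monomial a z)" using ez by (simp add: fun_eq_iff)
  then show "(\<lambda>N. torus_average N a f) \<longlonglongrightarrow> of_real (kc a * radius_pow a) * ip f (monomial a)" if f: "f \<in> H"
    using norm_tendsto_imp_pointwise(1)[OF averaged_kernel_mem e(1) f e(2)] R.Q_scl_r[OF f m, of "of_real (kc a * radius_pow a)"]
    by (simp add: ip_averaged_kernel f)
qed

text \<open>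
  Both sides are limits of torus averages of \<open>f\<close>. In particular the coefficients of
  an element of the space are determined by any power series for it.
\<close>

lemma coefficient_eq:
  assumes f: "f \<in> H" and "\<And>z. z \<in> \<Omega> \<Longrightarrow> ((\<lambda>b. \<phi> b * mpow z b) has_sum f z) UNIV"
  shows "\<phi> a = of_real (kc a) * ip f (monomial a)"
proof -
  have "\<phi> a * of_real (radius_pow a) = of_real (kc a * radius_pow a) * ip f (monomial a)"
    using LIMSEQ_unique[OF torus_average_tendsto[OF assms(2)] monomial_mem_and_ip(2)[OF f]] by simp
  then show ?thesis using radius_pow_pos[of a] by simp
qed

lemma ip_monomial: "ip (monomial b) (monomial a) = (if a = b then of_real (1 / kc a) else 0)"
proof -
  have "((\<lambda>c. (if c = b then 1 else 0) * mpow z c) has_sum monomial b z) UNIV" if "z \<in> \<Omega>" for z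
    by (rule has_sum_finite_neutralI[of "{b}"]) (use that in \<open>auto simp: monomial_def\<close>)
  from coefficient_eq[OF monomial_mem_and_ip(1) this, of a]
  show ?thesis using kc_pos[of a] by (auto simp: field_simps split: if_splits)
qed


definition coeff :: "(complex ^ 'n \<Rightarrow> complex) \<Rightarrow> nat ^ 'n \<Rightarrow> complex" where
  "coeff f a = of_real (kc a) * ip f (monomial a)"

lemma ip_coeff: "ip f (monomial a) = coeff f a / of_real (kc a)"
  using kc_pos[of a] by (simp add: coeff_def)

lemma poly_mem: "finite G \<Longrightarrow> (\<lambda>z. \<Sum>a\<in>G. \<phi> a * monomial a z) \<in> H"
  by (intro sum_mem monomial_mem_and_ip)

lemma ip_poly_right:
  assumes "finite G" "f \<in> H"
  shows "ip f (\<lambda>z. \<Sum>a\<in>G. \<phi> a * monomial a z) = (\<Sum>a\<in>G. coeff f a * cnj (\<phi> a) / of_real (kc a))"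
  using assms by (simp add: ip_sum_right monomial_mem_and_ip ip_coeff mult_ac)

lemma coeff_poly:
  assumes "finite G"
  shows "coeff (\<lambda>z. \<Sum>a\<in>G. \<phi> a * monomial a z) b = (if b \<in> G then \<phi> b else 0)"
  using assms kc_pos[of b]
  by (simp add: coeff_def ip_sum_left monomial_mem_and_ip ip_monomial if_distrib cong: if_cong)

lemma norm_poly:
  assumes "finite G"
  shows "Re (ip (\<lambda>z. \<Sum>a\<in>G. \<phi> a * monomial a z) (\<lambda>z. \<Sum>a\<in>G. \<phi> a * monomial a z)) = (\<Sum>a\<in>G. (cmod (\<phi> a))\<^sup>2 / kc a)"
proof -
  have "ip (\<lambda>z. \<Sum>a\<in>G. \<phi> a * monomial a z) (\<lambda>z. \<Sum>a\<in>G. \<phi> a * monomial a z) = (\<Sum>a\<in>G. \<phi> a * cnj (\<phi> a) / of_real (kc a))"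
    using assms by (subst ip_poly_right) (simp_all add: coeff_poly poly_mem)
  also have "\<dots> = of_real (\<Sum>a\<in>G. (cmod (\<phi> a))\<^sup>2 / kc a)"
    by (simp add: complex_norm_square del: of_real_power)
  finally show ?thesis by (simp only: Re_complex_of_real)
qed

text \<open>
  Pythagoras for the orthogonal projection onto the span of the monomials in \<open>G\<close>.
\<close>

lemma nrm_diff_poly:
  assumes "finite G" "f \<in> H"
  shows "(R.nrm (\<lambda>z. f z - (\<Sum>a\<in>G. coeff f a * monomial a z)))\<^sup>2 = (R.nrm f)\<^sup>2 - (\<Sum>a\<in>G. (cmod (coeff f a))\<^sup>2 / kc a)"
proof -
  let ?p = "\<lambda>z. \<Sum>a\<in>G. coeff f a * monomial a z"
  have "ip f ?p = of_real (\<Sum>a\<in>G. (cmod (coeff f a))\<^sup>2 / kc a)"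
    using assms by (simp add: ip_poly_right complex_norm_square del: of_real_power)
  then have "Re (ip f ?p) = (\<Sum>a\<in>G. (cmod (coeff f a))\<^sup>2 / kc a)" by (simp only: Re_complex_of_real)
  then show ?thesis
    using R.nrm_sub_sq[OF assms(2) poly_mem[OF assms(1), of "coeff f"]] norm_poly[OF assms(1), of "coeff f"]
    by (simp add: R_sub R.nrm_sq[OF assms(2)])
qed

lemma bessel:
  assumes "finite G" "f \<in> H"
  shows "(\<Sum>a\<in>G. (cmod (coeff f a))\<^sup>2 / kc a) \<le> (R.nrm f)\<^sup>2"
  using nrm_diff_poly[OF assms] by (smt (verit) zero_le_power2)

lemma bessel_infsum:
  assumes "f \<in> H"
  shows "(\<lambda>a. (cmod (coeff f a))\<^sup>2 / kc a) summable_on UNIV"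
    "infsum (\<lambda>a. (cmod (coeff f a))\<^sup>2 / kc a) UNIV \<le> (R.nrm f)\<^sup>2"
proof -
  show s: "(\<lambda>a. (cmod (coeff f a))\<^sup>2 / kc a) summable_on UNIV"
    by (rule nonneg_bounded_partial_sums_imp_summable_on[where C = "(R.nrm f)\<^sup>2"])
      (use bessel[OF _ assms] kc_pos in \<open>auto intro!: eventually_finite_subsets_at_top_weakI simp: less_imp_le\<close>)
  show "infsum (\<lambda>a. (cmod (coeff f a))\<^sup>2 / kc a) UNIV \<le> (R.nrm f)\<^sup>2"
    by (rule infsum_le_finite_sums[OF s]) (use bessel[OF _ assms] in auto)
qed

text \<open>
  Evaluation at \<open>z\<close> is the inner product with the kernel function at
  \<open>z\<close>, whose own expansion in monomials converges in norm, because its coefficients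
  exhaust \<open>k(z, z)\<close>.
\<close>

lemma has_sum_coeff:
  assumes f: "f \<in> H" and z: "z \<in> \<Omega>"
  shows "((\<lambda>a. coeff f a * mpow z a) has_sum f z) UNIV"
proof -
  let ?K = "kernel_fun \<Omega> k z"
  have K: "?K \<in> H" by (rule kernel_mem[OF z])
  have cK: "coeff ?K a = of_real (kc a) * cnj (mpow z a)" for a
    using reproducing[OF monomial_mem_and_ip(1) z, of a] ip_commute[OF monomial_mem_and_ip(1) K, of a] z
    by (simp add: coeff_def monomial_def)
  have kcn: "kc a \<noteq> 0" for a using kc_pos[of a] by simp
  have bound: "cmod ((\<Sum>a\<in>G. coeff f a * mpow z a) - f z) \<le>
      R.nrm f * sqrt ((R.nrm ?K)\<^sup>2 - (\<Sum>a\<in>G. kc a * (cmod (mpow z a))\<^sup>2))" if G: "finite G" for G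
  proof -
    let ?p = "\<lambda>z. \<Sum>a\<in>G. coeff ?K a * monomial a z"
    have "ip f (\<lambda>x. ?K x - ?p x) = f z - (\<Sum>a\<in>G. coeff f a * mpow z a)"
      using R.Q_sub_r[OF K poly_mem[OF G] f, of "coeff ?K"] ip_poly_right[OF G f, of "coeff ?K"] reproducing[OF f z] kcn
      by (simp add: R_sub cK)
    then have le: "cmod ((\<Sum>a\<in>G. coeff f a * mpow z a) - f z) \<le> R.nrm f * R.nrm (\<lambda>x. ?K x - ?p x)"
      using R.cauchy_schwarz[OF f diff_mem[OF K poly_mem[OF G]], of "coeff ?K"] by (simp add: norm_minus_commute)
    have "(\<Sum>a\<in>G. (cmod (coeff ?K a))\<^sup>2 / kc a) = (\<Sum>a\<in>G. kc a * (cmod (mpow z a))\<^sup>2)"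
      using kcn by (intro sum.cong refl) (simp add: cK norm_mult power2_eq_square abs_of_pos[OF kc_pos])
    with nrm_diff_poly[OF G K]
    have "(R.nrm (\<lambda>x. ?K x - ?p x))\<^sup>2 = (R.nrm ?K)\<^sup>2 - (\<Sum>a\<in>G. kc a * (cmod (mpow z a))\<^sup>2)" by simp
    then have "sqrt ((R.nrm ?K)\<^sup>2 - (\<Sum>a\<in>G. kc a * (cmod (mpow z a))\<^sup>2)) = R.nrm (\<lambda>x. ?K x - ?p x)"
      by (rule real_sqrt_unique) (rule R.nrm_nonneg[OF diff_mem[OF K poly_mem[OF G]]])
    then show ?thesis using le by simp
  qed
  have "((\<lambda>a. of_real (kc a * (cmod (mpow z a))\<^sup>2)) has_sum k z z) UNIV"
    using series[OF z z] by (simp add: mult.assoc complex_norm_square del: of_real_power)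
  moreover have "k z z = of_real ((R.nrm ?K)\<^sup>2)"
    using R.Q_self[OF K] reproducing[OF K z] z by (simp add: kernel_fun_def)
  ultimately have "((\<lambda>a. kc a * (cmod (mpow z a))\<^sup>2) has_sum (R.nrm ?K)\<^sup>2) UNIV"
    by (simp only: has_sum_of_real_iff)
  then have "((\<lambda>G. \<Sum>a\<in>G. kc a * (cmod (mpow z a))\<^sup>2) \<longlongrightarrow> (R.nrm ?K)\<^sup>2) (finite_subsets_at_top UNIV)"
    by (simp add: has_sum_def)
  then have "((\<lambda>G. R.nrm f * sqrt ((R.nrm ?K)\<^sup>2 - (\<Sum>a\<in>G. kc a * (cmod (mpow z a))\<^sup>2)))
      \<longlongrightarrow> R.nrm f * sqrt ((R.nrm ?K)\<^sup>2 - (R.nrm ?K)\<^sup>2)) (finite_subsets_at_top UNIV)"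
    by (intro tendsto_intros)
  then have lim0: "((\<lambda>G. R.nrm f * sqrt ((R.nrm ?K)\<^sup>2 - (\<Sum>a\<in>G. kc a * (cmod (mpow z a))\<^sup>2)))
      \<longlongrightarrow> 0) (finite_subsets_at_top UNIV)" by simp
  show ?thesis unfolding has_sum_def
  proof (rule LIM_zero_cancel, rule Lim_null_comparison[OF _ lim0])
    show "\<forall>\<^sub>F G in finite_subsets_at_top UNIV. norm ((\<Sum>a\<in>G. coeff f a * mpow z a) - f z)
        \<le> R.nrm f * sqrt ((R.nrm ?K)\<^sup>2 - (\<Sum>a\<in>G. kc a * (cmod (mpow z a))\<^sup>2))"
      by (rule eventually_finite_subsets_at_top_weakI) (rule bound)
  qed
qed

text \<open>
  The partial sums along an enumeration of the multi-indices form a Cauchy sequence; its limit has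
  the pointwise sum of the series as its values.
\<close>

lemma riesz_fischer:
  assumes s: "(\<lambda>a. (cmod (\<phi> a))\<^sup>2 / kc a) summable_on UNIV"
  obtains f where "f \<in> H" "\<And>z. z \<in> \<Omega> \<Longrightarrow> ((\<lambda>a. \<phi> a * mpow z a) has_sum f z) UNIV"
    "(R.nrm f)\<^sup>2 \<le> infsum (\<lambda>a. (cmod (\<phi> a))\<^sup>2 / kc a) UNIV"
proof -
  define w where "w a = (cmod (\<phi> a))\<^sup>2 / kc a" for a
  define S where "S = infsum w UNIV"
  have w0: "w a \<ge> 0" for a using kc_pos[of a] by (simp add: w_def)
  have ws: "(w has_sum S) UNIV" using s unfolding S_def w_def by (rule has_sum_infsum)
  define G where "G n = {a :: nat ^ 'n. to_nat a < n}" for n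
  have fG: "finite (G n)" for n
    unfolding G_def by (rule finite_vimageI[of "{..<n}" to_nat, unfolded vimage_def lessThan_iff mem_Collect_eq]) auto
  have Glim: "filterlim G (finite_subsets_at_top UNIV) sequentially"
    unfolding filterlim_finite_subsets_at_top
  proof (intro allI impI)
    fix Y :: "(nat ^ 'n) set" assume Y: "finite Y \<and> Y \<subseteq> UNIV"
    define N where "N = Suc (Max (to_nat ` Y))"
    have "Y \<subseteq> G n" if "n \<ge> N" for n
    proof
      fix a assume "a \<in> Y"
      then have "to_nat a \<le> Max (to_nat ` Y)" using Y by simp
      then show "a \<in> G n" using that by (simp add: G_def N_def)
    qed
    then show "\<forall>\<^sub>F n in sequentially. finite (G n) \<and> Y \<subseteq> G n \<and> G n \<subseteq> UNIV"
      unfolding eventually_sequentially using fG by blast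
  qed
  define p where "p n = (\<lambda>z. \<Sum>a\<in>G n. \<phi> a * monomial a z)" for n
  have pH: "p n \<in> H" for n unfolding p_def by (rule poly_mem[OF fG])
  define W where "W n = (\<Sum>a\<in>G n. w a)" for n
  have Wlim: "W \<longlonglongrightarrow> S" unfolding W_def
    by (rule filterlim_compose[OF _ Glim]) (use ws in \<open>simp add: has_sum_def\<close>)
  have WS: "W n \<le> S" for n unfolding W_def
    by (rule finite_sum_le_has_sum[OF ws fG]) (use w0 in auto)
  have diff: "(R.nrm (\<lambda>z. p m z - p n z))\<^sup>2 = W m - W n" if "n \<le> m" for m n
  proof -
    have sub: "G n \<subseteq> G m" using that by (auto simp: G_def)
    have eq: "(\<lambda>z. p m z - p n z) = (\<lambda>z. \<Sum>a\<in>G m - G n. \<phi> a * monomial a z)"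
      unfolding p_def by (simp add: fun_eq_iff sum_diff[OF fG sub])
    show ?thesis
      using R.nrm_sq[OF diff_mem[OF pH pH], of m n] norm_poly[of "G m - G n" \<phi>] fG sum_diff[OF fG sub, of w]
      by (simp add: eq W_def w_def)
  qed
  have diff': "R.nrm (\<lambda>z. p m z - p n z) = sqrt \<bar>W m - W n\<bar>" for m n
  proof (cases "n \<le> m")
    case True
    then show ?thesis using diff[OF True] R.nrm_nonneg[OF diff_mem[OF pH pH], of m n]
      by (metis abs_of_nonneg real_sqrt_unique zero_le_power2)
  next
    case False
    then have le: "m \<le> n" by simp
    have "R.nrm (\<lambda>z. p m z - p n z) = R.nrm (\<lambda>z. p n z - p m z)"
      using R.nrm_sub_comm[OF pH pH, of m n] by (simp add: R_sub)
    also have "\<dots> = sqrt \<bar>W n - W m\<bar>"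
      using diff[OF le] R.nrm_nonneg[OF diff_mem[OF pH pH], of n m]
      by (metis abs_of_nonneg real_sqrt_unique zero_le_power2)
    finally show ?thesis by (simp add: abs_minus_commute)
  qed
  have "\<exists>f\<in>H. (\<lambda>n. sqrt (Re (ip (\<lambda>x. p n x - f x) (\<lambda>x. p n x - f x)))) \<longlonglongrightarrow> 0"
  proof (rule complete[OF pH])
    fix e :: real assume e: "e > 0"
    have "Cauchy W" using Wlim by (rule LIMSEQ_imp_Cauchy)
    then obtain M where "\<And>m n. m \<ge> M \<Longrightarrow> n \<ge> M \<Longrightarrow> norm (W m - W n) < e\<^sup>2"
      using CauchyD[of W "e\<^sup>2"] e by auto
    then have "R.nrm (\<lambda>z. p m z - p n z) < e" if "m \<ge> M" "n \<ge> M" for m n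
      unfolding diff' using that e by (auto intro!: real_less_lsqrt)
    then show "\<exists>M. \<forall>m\<ge>M. \<forall>n\<ge>M. sqrt (Re (ip (\<lambda>x. p m x - p n x) (\<lambda>x. p m x - p n x))) < e"
      unfolding R.nrm_def by blast
  qed
  then obtain f where f: "f \<in> H" "(\<lambda>n. R.nrm (\<lambda>x. p n x - f x)) \<longlonglongrightarrow> 0"
    by (auto simp: R.nrm_def)
  have "((\<lambda>a. \<phi> a * mpow z a) has_sum f z) UNIV" if z: "z \<in> \<Omega>" for z
  proof -
    have "(\<lambda>a. w a + kc a * (cmod (mpow z a))\<^sup>2) summable_on UNIV"
    proof (rule summable_on_add)
      show "w summable_on UNIV" using ws by (rule has_sum_imp_summable)
      have "((\<lambda>a. of_real (kc a * (cmod (mpow z a))\<^sup>2)) has_sum k z z) UNIV"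
        using series[OF z z] by (simp add: mult.assoc complex_norm_square del: of_real_power)
      from has_sum_Re[OF this] show "(\<lambda>a. kc a * (cmod (mpow z a))\<^sup>2) summable_on UNIV"
        by (auto intro: has_sum_imp_summable)
    qed
    then have "(\<lambda>a. \<phi> a * mpow z a) summable_on UNIV"
    proof (rule abs_summable_summable[OF summable_on_comparison_test])
      fix a
      have "2 * (cmod (\<phi> a) * cmod (mpow z a)) \<le> w a + kc a * (cmod (mpow z a))\<^sup>2"
      proof -
        have "0 \<le> (cmod (\<phi> a) - kc a * cmod (mpow z a))\<^sup>2 / kc a" using kc_pos[of a] by simp
        also have "\<dots> = w a + kc a * (cmod (mpow z a))\<^sup>2 - 2 * (cmod (\<phi> a) * cmod (mpow z a))"
          using kc_pos[of a] by (simp add: w_def power2_eq_square field_simps)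
        finally show ?thesis by simp
      qed
      then show "norm (\<phi> a * mpow z a) \<le> w a + kc a * (cmod (mpow z a))\<^sup>2"
        using mult_nonneg_nonneg[OF norm_ge_zero[of "\<phi> a"] norm_ge_zero[of "mpow z a"]]
        unfolding norm_mult by linarith
    qed simp
    then have hs: "((\<lambda>a. \<phi> a * mpow z a) has_sum infsum (\<lambda>a. \<phi> a * mpow z a) UNIV) UNIV" by simp
    have "(\<lambda>n. \<Sum>a\<in>G n. \<phi> a * mpow z a) \<longlonglongrightarrow> infsum (\<lambda>a. \<phi> a * mpow z a) UNIV"
      by (rule filterlim_compose[OF _ Glim]) (use hs in \<open>simp add: has_sum_def\<close>)
    moreover have "(\<lambda>n. \<Sum>a\<in>G n. \<phi> a * mpow z a) \<longlonglongrightarrow> f z"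
      using norm_tendsto_imp_pointwise(2)[OF pH f(1,1,2) z] z by (simp add: p_def monomial_def)
    ultimately have "infsum (\<lambda>a. \<phi> a * mpow z a) UNIV = f z" by (rule LIMSEQ_unique)
    then show ?thesis using hs by simp
  qed
  moreover have "(R.nrm f)\<^sup>2 \<le> S"
  proof -
    have S0: "S \<ge> 0" using ws w0 by (rule has_sum_nonneg)
    have "R.nrm f \<le> R.nrm (\<lambda>x. p n x - f x) + sqrt S" for n
    proof -
      have "R.nrm f \<le> R.nrm (\<lambda>x. f x - p n x) + R.nrm (p n)"
        using R.nrm_le_sub[OF f(1) pH] by (simp add: R_sub)
      moreover have "R.nrm (\<lambda>x. f x - p n x) = R.nrm (\<lambda>x. p n x - f x)"
        using R.nrm_sub_comm[OF f(1) pH] by (simp add: R_sub)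
      moreover have "R.nrm (p n) \<le> sqrt S"
        using norm_poly[OF fG, of \<phi> n] WS[of n] by (simp add: R.nrm_def p_def W_def w_def)
      ultimately show ?thesis by simp
    qed
    then have "R.nrm f \<le> 0 + sqrt S"
      by (intro LIMSEQ_le_const[OF tendsto_add[OF f(2) tendsto_const]]) auto
    then have "(R.nrm f)\<^sup>2 \<le> (sqrt S)\<^sup>2" using R.nrm_nonneg[OF f(1)] by (intro power_mono) auto
    then show ?thesis using S0 by simp
  qed
  ultimately show ?thesis using that[OF f(1)] by (simp add: S_def w_def[abs_def])
qed

end

section \<open>Multipliers and the adjoint Toeplitz matrices\<close>

text \<open>
  Coefficients of the product of \<open>\<Sum>\<^sub>a z\<^sup>a c\<^sub>a\<^sup>*\<close> with
  the vector of power series with coefficients \<open>f\<close>.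
\<close>

definition mult_coeff :: "(nat ^ 'n \<Rightarrow> nat \<Rightarrow> nat \<Rightarrow> complex) \<Rightarrow> nat \<Rightarrow>
    (nat ^ 'n \<Rightarrow> nat \<Rightarrow> complex) \<Rightarrow> nat ^ 'n::finite \<Rightarrow> nat \<Rightarrow> complex" where
  "mult_coeff c J f e i = (\<Sum>b | b \<le> e. \<Sum>j<J. cnj (c (e - b) j i) * f b j)"

text \<open>
  Multiplication is the adjoint of the Toeplitz matrix.
\<close>

lemma mult_coeff_toep_pairing:
  assumes "co_invariant G" "finite G"
  shows "(\<Sum>e\<in>G. \<Sum>i<J. mult_coeff c J f e i * cnj (v (e, i)))
       = (\<Sum>b\<in>G. \<Sum>j<J. f b j * cnj (toep c J G v b j))"
proof -
  have "(\<Sum>e\<in>G. \<Sum>i<J. mult_coeff c J f e i * cnj (v (e, i)))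
      = (\<Sum>e\<in>G. \<Sum>b | b \<in> G \<and> b \<le> e. \<Sum>i<J. \<Sum>j<J. cnj (c (e - b) j i) * f b j * cnj (v (e, i)))"
  proof (intro sum.cong refl)
    fix e assume e: "e \<in> G"
    have "{b. b \<le> e} = {b. b \<in> G \<and> b \<le> e}" using co_invariantD[OF assms(1) e] by auto
    then show "(\<Sum>i<J. mult_coeff c J f e i * cnj (v (e, i))) =
       (\<Sum>b | b \<in> G \<and> b \<le> e. \<Sum>i<J. \<Sum>j<J. cnj (c (e - b) j i) * f b j * cnj (v (e, i)))"
      by (simp add: mult_coeff_def sum_distrib_right sum.swap[of _ "{..<J}" "{b \<in> G. b \<le> e}"])
  qed
  also have "\<dots> = (\<Sum>b\<in>G. \<Sum>e | e \<in> G \<and> b \<le> e. \<Sum>i<J. \<Sum>j<J. cnj (c (e - b) j i) * f b j * cnj (v (e, i)))"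
    using sum.swap_restrict[OF assms(2,2), of "\<lambda>e b. \<Sum>i<J. \<Sum>j<J. cnj (c (e - b) j i) * f b j * cnj (v (e, i))" "\<lambda>e b. b \<le> e"]
    by simp
  also have "\<dots> = (\<Sum>b\<in>G. \<Sum>j<J. f b j * cnj (toep c J G v b j))"
  proof (intro sum.cong refl)
    fix b assume "b \<in> G"
    have "(\<Sum>e | e \<in> G \<and> b \<le> e. \<Sum>i<J. \<Sum>j<J. cnj (c (e - b) j i) * f b j * cnj (v (e, i)))
       = (\<Sum>e | e \<in> G \<and> b \<le> e. \<Sum>j<J. \<Sum>i<J. cnj (c (e - b) j i) * f b j * cnj (v (e, i)))"
      by (intro sum.cong refl sum.swap)
    also have "\<dots> = (\<Sum>j<J. \<Sum>e | e \<in> G \<and> b \<le> e. \<Sum>i<J. cnj (c (e - b) j i) * f b j * cnj (v (e, i)))"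
      by (rule sum.swap)
    finally show "(\<Sum>e | e \<in> G \<and> b \<le> e. \<Sum>i<J. \<Sum>j<J. cnj (c (e - b) j i) * f b j * cnj (v (e, i))) =
      (\<Sum>j<J. f b j * cnj (toep c J G v b j))"
      by (simp add: toep_def sum_distrib_left mult_ac)
  qed
  finally show ?thesis .
qed

lemma weighted_pairing_le:
  fixes p q :: "'b \<Rightarrow> nat \<Rightarrow> complex"
  assumes "\<And>a. w a > 0"
  shows "2 * Re (\<Sum>a\<in>G. \<Sum>i<J. p a i * cnj (q a i))
    \<le> (\<Sum>a\<in>G. (\<Sum>i<J. (cmod (p a i))\<^sup>2) / w a) + (\<Sum>a\<in>G. w a * (\<Sum>i<J. (cmod (q a i))\<^sup>2))"
proof -
  have 1: "2 * Re (x * cnj y) \<le> (cmod x)\<^sup>2 / s + s * (cmod y)\<^sup>2" if s: "s > 0" for x y s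
  proof -
    have "Re (x * cnj y) \<le> cmod x * cmod y"
      using complex_Re_le_cmod[of "x * cnj y"] by (simp add: norm_mult)
    moreover have "2 * (cmod x * cmod y) \<le> (cmod x)\<^sup>2 / s + s * (cmod y)\<^sup>2"
    proof -
      have "0 \<le> (cmod x - s * cmod y)\<^sup>2 / s" using s by simp
      also have "\<dots> = (cmod x)\<^sup>2 / s + s * (cmod y)\<^sup>2 - 2 * (cmod x * cmod y)"
        using s by (simp add: power2_eq_square field_simps)
      finally show ?thesis by simp
    qed
    ultimately show ?thesis by linarith
  qed
  have "2 * Re (\<Sum>a\<in>G. \<Sum>i<J. p a i * cnj (q a i)) = (\<Sum>a\<in>G. \<Sum>i<J. 2 * Re (p a i * cnj (q a i)))"
    by (simp add: sum_distrib_left)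
  also have "\<dots> \<le> (\<Sum>a\<in>G. \<Sum>i<J. (cmod (p a i))\<^sup>2 / w a + w a * (cmod (q a i))\<^sup>2)"
    by (intro sum_mono 1 assms)
  finally show ?thesis by (simp add: sum.distrib sum_distrib_left sum_divide_distrib)
qed

text \<open>
  A map and its adjoint have the same norm. Both directions test the pairing on the extremal
  vector and then use \<open>2 Re \<langle>p, q\<rangle> \<le> |p|\<^sup>2 + |q|\<^sup>2\<close>,
  which avoids dividing by a norm that may be zero.
\<close>

lemma toep_contractive_iff_adjoint:
  fixes kc lc :: "('n::finite) mps"
  assumes k: "\<And>a. kc a > 0" and l: "\<And>a. lc a > 0" and G: "co_invariant G" "finite G"
  shows "toep_contractive kc lc J G c \<longleftrightarrow>
    (\<forall>f. (\<Sum>e\<in>G. (\<Sum>i<J. (cmod (mult_coeff c J f e i))\<^sup>2) / lc e)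
        \<le> (\<Sum>b\<in>G. (\<Sum>j<J. (cmod (f b j))\<^sup>2) / kc b))"
proof (intro iffI allI)
  fix f assume contr: "toep_contractive kc lc J G c"
  define v where "v = (\<lambda>(e, i). mult_coeff c J f e i / complex_of_real (lc e))"
  let ?A = "\<Sum>e\<in>G. (\<Sum>i<J. (cmod (mult_coeff c J f e i))\<^sup>2) / lc e"
  have lz: "lc e \<noteq> 0" for e using l[of e] by simp
  have A: "?A = (\<Sum>e\<in>G. lc e * (\<Sum>i<J. (cmod (v (e, i)))\<^sup>2))"
    using lz by (intro sum.cong refl)
      (simp add: v_def norm_divide power_divide sum_divide_distrib[symmetric] power2_eq_square)
  have "(\<Sum>e\<in>G. \<Sum>i<J. mult_coeff c J f e i * cnj (v (e, i))) = complex_of_real ?A"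
    by (simp add: v_def sum_divide_distrib complex_norm_square del: of_real_power)
  then have "2 * ?A = 2 * Re (\<Sum>b\<in>G. \<Sum>j<J. f b j * cnj (toep c J G v b j))"
    unfolding mult_coeff_toep_pairing[OF G] by simp
  also have "\<dots> \<le> (\<Sum>b\<in>G. (\<Sum>j<J. (cmod (f b j))\<^sup>2) / kc b) + (\<Sum>a\<in>G. kc a * (\<Sum>i<J. (cmod (toep c J G v a i))\<^sup>2))"
    by (rule weighted_pairing_le[OF k])
  also have "\<dots> \<le> (\<Sum>b\<in>G. (\<Sum>j<J. (cmod (f b j))\<^sup>2) / kc b) + ?A"
    unfolding A using contr by (simp add: toep_contractive_def)
  finally show "?A \<le> (\<Sum>b\<in>G. (\<Sum>j<J. (cmod (f b j))\<^sup>2) / kc b)" by simp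
next
  assume *: "\<forall>f. (\<Sum>e\<in>G. (\<Sum>i<J. (cmod (mult_coeff c J f e i))\<^sup>2) / lc e)
        \<le> (\<Sum>b\<in>G. (\<Sum>j<J. (cmod (f b j))\<^sup>2) / kc b)"
  show "toep_contractive kc lc J G c"
    unfolding toep_contractive_def
  proof
    fix v
    define f where "f b j = complex_of_real (kc b) * toep c J G v b j" for b j
    let ?B = "\<Sum>a\<in>G. kc a * (\<Sum>i<J. (cmod (toep c J G v a i))\<^sup>2)"
    have kz: "kc e \<noteq> 0" "\<bar>kc e\<bar> = kc e" for e using k[of e] by simp_all
    have B: "?B = (\<Sum>b\<in>G. (\<Sum>j<J. (cmod (f b j))\<^sup>2) / kc b)"
      using kz by (intro sum.cong refl)
        (simp add: f_def norm_mult power_mult_distrib sum_distrib_left sum_divide_distrib power2_eq_square mult_ac)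
    have "(\<Sum>b\<in>G. \<Sum>j<J. f b j * cnj (toep c J G v b j)) = complex_of_real ?B"
      by (simp add: f_def sum_distrib_left complex_norm_square mult_ac del: of_real_power)
    then have "2 * ?B = 2 * Re (\<Sum>e\<in>G. \<Sum>i<J. mult_coeff c J f e i * cnj (v (e, i)))"
      unfolding mult_coeff_toep_pairing[OF G] by simp
    also have "\<dots> \<le> (\<Sum>e\<in>G. (\<Sum>i<J. (cmod (mult_coeff c J f e i))\<^sup>2) / lc e) + (\<Sum>e\<in>G. lc e * (\<Sum>i<J. (cmod (v (e, i)))\<^sup>2))"
      by (rule weighted_pairing_le[OF l])
    also have "\<dots> \<le> ?B + (\<Sum>e\<in>G. lc e * (\<Sum>i<J. (cmod (v (e, i)))\<^sup>2))"
      unfolding B using * by simp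
    finally show "?B \<le> (\<Sum>e\<in>G. lc e * (\<Sum>i<J. (cmod (v (e, i)))\<^sup>2))" by simp
  qed
qed

lemma mpow_add: "mpow z (a + b) = mpow z a * mpow z b"
  by (simp add: mpow_def power_add prod.distrib)

text \<open>
  Absolute convergence allows summing the double series by the total exponent \<open>e = a +
  b\<close>.
\<close>

lemma cauchy_product_has_sum:
  fixes A B :: "nat ^ 'n::finite \<Rightarrow> complex"
  assumes A: "((\<lambda>a. A a * mpow z a) has_sum S) UNIV" and B: "((\<lambda>a. B a * mpow z a) has_sum T) UNIV"
  shows "((\<lambda>e. (\<Sum>b | b \<le> e. A (e - b) * B b) * mpow z e) has_sum S * T) UNIV"
proof -
  define h where "h = (\<lambda>(a, b). (A a * mpow z a) * (B b * mpow z b))"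
  have nA: "(\<lambda>a. norm (A a * mpow z a)) summable_on UNIV"
    by (rule summable_on_iff_abs_summable_on_complex[THEN iffD1, OF has_sum_imp_summable[OF A]])
  have nB: "(\<lambda>b. norm (B b * mpow z b)) summable_on UNIV"
    by (rule summable_on_iff_abs_summable_on_complex[THEN iffD1, OF has_sum_imp_summable[OF B]])
  have "(\<lambda>p. norm (h p)) summable_on UNIV \<times> UNIV"
  proof (rule summable_on_SigmaI)
    show "((\<lambda>b. norm (h (a, b))) has_sum norm (A a * mpow z a) * infsum (\<lambda>b. norm (B b * mpow z b)) UNIV) UNIV" for a
      using has_sum_cmult_right[OF has_sum_infsum[OF nB], of "norm (A a * mpow z a)"]
      by (simp add: h_def norm_mult)
    show "(\<lambda>a. norm (A a * mpow z a) * infsum (\<lambda>b. norm (B b * mpow z b)) UNIV) summable_on UNIV"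
      by (rule summable_on_cmult_left[OF nA])
  qed simp
  then have "h summable_on UNIV \<times> UNIV" by (rule abs_summable_summable)
  then have "(h has_sum S * T) (UNIV \<times> UNIV)"
    by (rule has_sum_SigmaI[where g = "\<lambda>a. (A a * mpow z a) * T", rotated 2])
      (auto simp: h_def intro!: has_sum_cmult_right has_sum_cmult_left A B)
  moreover have "(h has_sum S * T) (UNIV \<times> UNIV) \<longleftrightarrow>
      ((\<lambda>(e, b). A (e - b) * B b * mpow z e) has_sum S * T) (Sigma UNIV (\<lambda>e. {b. b \<le> e}))"
  proof (rule has_sum_reindex_bij_witness[of _ "\<lambda>(e, b). (e - b, b)" "\<lambda>(a, b). (a + b, b)"])
    fix p assume "p \<in> Sigma UNIV (\<lambda>e. {b. b \<le> (e :: nat ^ 'n)})"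
    then show "(\<lambda>(a, b). (a + b, b)) ((\<lambda>(e, b). (e - b, b)) p) = p" by (auto simp: vec_diff_add)
  qed (auto simp: h_def mpow_add vec_add_diff vec_le_add)
  ultimately have "((\<lambda>(e, b). A (e - b) * B b * mpow z e) has_sum S * T) (Sigma UNIV (\<lambda>e. {b. b \<le> e}))" by simp
  then have "((\<lambda>e. \<Sum>b | b \<le> e. A (e - b) * B b * mpow z e) has_sum S * T) UNIV"
    by (rule has_sum_SigmaD) (auto simp: finite_multiindex_le intro: has_sum_finiteI)
  then show ?thesis by (simp add: sum_distrib_right)
qed

lemma mult_op_has_sum:
  assumes \<Phi>: "\<And>i j. i < J \<Longrightarrow> j < J \<Longrightarrow> ((\<lambda>a. mpow z a * cnj (c a j i)) has_sum \<Phi> z i j) UNIV"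
    and f: "\<And>j. j < J \<Longrightarrow> ((\<lambda>b. \<phi> b j * mpow z b) has_sum f j z) UNIV"
    and i: "i < J"
  shows "((\<lambda>e. mult_coeff c J \<phi> e i * mpow z e) has_sum (\<Sum>j<J. \<Phi> z i j * f j z)) UNIV"
proof -
  have "((\<lambda>e. \<Sum>j<J. (\<Sum>b | b \<le> e. cnj (c (e - b) j i) * \<phi> b j) * mpow z e) has_sum (\<Sum>j<J. \<Phi> z i j * f j z)) UNIV"
    using \<Phi>[OF i] f by (intro has_sum_finite_sum cauchy_product_has_sum) (auto simp: mult.commute)
  moreover have "mult_coeff c J \<phi> e i = (\<Sum>j<J. \<Sum>b | b \<le> e. cnj (c (e - b) j i) * \<phi> b j)" for e
    unfolding mult_coeff_def by (rule sum.swap)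
  ultimately show ?thesis by (simp add: sum_distrib_right)
qed

text \<open>
  Every finite set of exponents lies in a finite co-invariant one, where contractivity gives the
  bound.
\<close>

lemma mult_coeff_infsum_le:
  fixes kc lc :: "('n::finite) mps"
  assumes k: "\<And>a. kc a > 0" and l: "\<And>a. lc a > 0"
    and contr: "\<And>G. finite G \<Longrightarrow> co_invariant G \<Longrightarrow> toep_contractive kc lc J G c"
    and \<phi>: "(\<lambda>b. (\<Sum>j<J. (cmod (\<phi> b j))\<^sup>2) / kc b) summable_on UNIV"
  shows "(\<lambda>e. (\<Sum>i<J. (cmod (mult_coeff c J \<phi> e i))\<^sup>2) / lc e) summable_on UNIV"
    "infsum (\<lambda>e. (\<Sum>i<J. (cmod (mult_coeff c J \<phi> e i))\<^sup>2) / lc e) UNIV \<le> infsum (\<lambda>b. (\<Sum>j<J. (cmod (\<phi> b j))\<^sup>2) / kc b) UNIV"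
proof -
  let ?p = "\<lambda>e. (\<Sum>i<J. (cmod (mult_coeff c J \<phi> e i))\<^sup>2) / lc e"
  let ?q = "\<lambda>b. (\<Sum>j<J. (cmod (\<phi> b j))\<^sup>2) / kc b"
  have pn: "?p e \<ge> 0" and qn: "?q e \<ge> 0" for e
    using k l by (auto intro!: divide_nonneg_pos sum_nonneg)
  have bound: "sum ?p G \<le> infsum ?q UNIV" if "finite G" for G
  proof -
    obtain D where D: "finite D" "co_invariant D" "G \<subseteq> D" using finite_subset_co_invariant[OF \<open>finite G\<close>] .
    have "sum ?p G \<le> sum ?p D" using D pn by (intro sum_mono2) auto
    also have "\<dots> \<le> sum ?q D"
      using contr[OF D(1,2)] toep_contractive_iff_adjoint[where kc = kc and lc = lc, OF k l D(2,1)] by blast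
    also have "\<dots> \<le> infsum ?q UNIV" using D qn by (intro finite_sum_le_infsum[OF \<phi>]) auto
    finally show ?thesis .
  qed
  show s: "?p summable_on UNIV"
    by (rule nonneg_bounded_partial_sums_imp_summable_on[where C = "infsum ?q UNIV"])
      (use bound pn in \<open>auto intro!: eventually_finite_subsets_at_top_weakI\<close>)
  show "infsum ?p UNIV \<le> infsum ?q UNIV" by (rule infsum_le_finite_sums[OF s]) (use bound in auto)
qed

lemma diagonal_rkhs_of_kernel:
  fixes kc :: "('n::finite) mps"
  assumes "diagonal_holomorphic_kernel \<Omega> k kc"
  obtains r where "diagonal_rkhs \<Omega> k (rkhs \<Omega> k) (rkhs_ip \<Omega> k) kc r"
proof -
  have "open \<Omega>" "0 \<in> \<Omega>" and kp: "\<And>a. kc a > 0" and ker: "kernel_on \<Omega> k"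
    using assms by (auto simp: diagonal_holomorphic_kernel_def is_domain_def)
  then obtain e where e: "e > 0" "ball 0 e \<subseteq> \<Omega>" using open_contains_ball by blast
  define r where "r = e / (2 * real CARD('n))"
  have r: "r > 0" using e by (simp add: r_def)
  have "z \<in> \<Omega>" if z: "\<And>i. cmod (z $ i) \<le> r" for z :: "complex ^ 'n"
  proof -
    have "norm z \<le> (\<Sum>i\<in>UNIV. cmod (z $ i))" unfolding norm_vec_def by (rule L2_set_le_sum) simp
    also have "\<dots> \<le> (\<Sum>i\<in>(UNIV :: 'n set). r)" by (intro sum_mono z)
    also have "\<dots> = e / 2" by (simp add: r_def)
    also have "\<dots> < e" using e by simp
    finally show ?thesis using e(2) by auto
  qed
  moreover have "((\<lambda>a. complex_of_real (kc a) * mpow z a * cnj (mpow w a)) has_sum k z w) UNIV"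
    if "z \<in> \<Omega>" "w \<in> \<Omega>" for z w
    unfolding diagonal_kernel_global_series(2)[OF assms that]
    using diagonal_kernel_global_series(1)[OF assms] that kp
    by (intro diag_series_has_sum) (auto simp: less_imp_le)
  ultimately have "diagonal_rkhs \<Omega> k (rkhs \<Omega> k) (rkhs_ip \<Omega> k) kc r"
    using is_rkhs_rkhs[OF ker] kp r by (intro diagonal_rkhs.intro diagonal_rkhs_axioms.intro) auto
  then show ?thesis by (rule that)
qed

text \<open>
  The finite section is the compression of the multiplication operator to polynomials with
  exponents in \<open>F\<close>, tested on the coefficients in \<open>F\<close> of the product.
\<close>

lemma contractive_multiplier_imp_toep_contractive:
  fixes kc lc :: "('n::finite) mps"
  assumes K: "diagonal_rkhs \<Omega> k (rkhs \<Omega> k) (rkhs_ip \<Omega> k) kc r"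
    and L: "diagonal_rkhs \<Omega> l (rkhs \<Omega> l) (rkhs_ip \<Omega> l) lc s"
    and F: "finite F" "co_invariant F"
    and \<Phi>: "\<And>z i j. z \<in> \<Omega> \<Longrightarrow> i < J \<Longrightarrow> j < J \<Longrightarrow> ((\<lambda>a. mpow z a * cnj (c a j i)) has_sum \<Phi> z i j) UNIV"
    and contr: "contractive_multiplier \<Omega> k l J \<Phi>"
  shows "toep_contractive kc lc J F c"
proof -
  interpret K: diagonal_rkhs \<Omega> k "rkhs \<Omega> k" "rkhs_ip \<Omega> k" kc r by (rule K)
  interpret L: diagonal_rkhs \<Omega> l "rkhs \<Omega> l" "rkhs_ip \<Omega> l" lc s by (rule L)
  have "(\<Sum>e\<in>F. (\<Sum>i<J. (cmod (mult_coeff c J f e i))\<^sup>2) / lc e) \<le> (\<Sum>b\<in>F. (\<Sum>j<J. (cmod (f b j))\<^sup>2) / kc b)" for f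
  proof -
    define \<phi> where "\<phi> b j = (if b \<in> F then f b j else 0)" for b j
    define p where "p j = (\<lambda>z. \<Sum>b\<in>F. f b j * K.monomial b z)" for j
    have pH: "p j \<in> rkhs \<Omega> k" for j unfolding p_def by (rule K.poly_mem[OF F(1)])
    have p_sum: "((\<lambda>b. \<phi> b j * mpow z b) has_sum p j z) UNIV" if "z \<in> \<Omega>" for z j
      by (rule has_sum_finite_neutralI[OF F(1)]) (use that in \<open>auto simp: \<phi>_def p_def K.monomial_def\<close>)
    have pN: "(rkhs_norm \<Omega> k (p j))\<^sup>2 = (\<Sum>b\<in>F. (cmod (f b j))\<^sup>2 / kc b)" for j
      unfolding rkhs_norm_def real_sqrt_pow2[OF K.ip_nonneg[OF pH]] unfolding p_def by (rule K.norm_poly[OF F(1)])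
    let ?g = "mult_op \<Omega> J \<Phi> p"
    have g: "?g \<in> tensor_space \<Omega> l J" "tensor_norm \<Omega> l J ?g \<le> tensor_norm \<Omega> k J p"
      using contr pH by (auto simp: contractive_multiplier_def tensor_space_def)
    have gH: "?g i \<in> rkhs \<Omega> l" if "i < J" for i using g(1) that by (simp add: tensor_space_def)
    have gc: "L.coeff (?g i) e = mult_coeff c J f e i" if i: "i < J" and e: "e \<in> F" for i e
    proof -
      have "((\<lambda>e. mult_coeff c J \<phi> e i * mpow z e) has_sum ?g i z) UNIV" if z: "z \<in> \<Omega>" for z
        using mult_op_has_sum[of J z c \<Phi> \<phi> p i, OF \<Phi>[OF z] p_sum[OF z] i] z by (simp add: mult_op_def)
      from L.coefficient_eq[OF gH[OF i] this, of e] have "L.coeff (?g i) e = mult_coeff c J \<phi> e i"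
        by (simp add: L.coeff_def)
      also have "\<dots> = mult_coeff c J f e i"
        unfolding mult_coeff_def \<phi>_def using co_invariantD[OF F(2) e] by (intro sum.cong) auto
      finally show ?thesis .
    qed
    have "(\<Sum>e\<in>F. (\<Sum>i<J. (cmod (mult_coeff c J f e i))\<^sup>2) / lc e) = (\<Sum>i<J. \<Sum>e\<in>F. (cmod (L.coeff (?g i) e))\<^sup>2 / lc e)"
      unfolding sum_divide_distrib by (subst sum.swap) (simp add: gc)
    also have "\<dots> \<le> (\<Sum>i<J. (rkhs_norm \<Omega> l (?g i))\<^sup>2)"
      using L.bessel[OF F(1) gH] by (intro sum_mono) (simp add: rkhs_norm_def L.R.nrm_def)
    also have "\<dots> \<le> (\<Sum>j<J. (rkhs_norm \<Omega> k (p j))\<^sup>2)"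
      using g(2) by (simp add: tensor_norm_def)
    also have "\<dots> = (\<Sum>b\<in>F. (\<Sum>j<J. (cmod (f b j))\<^sup>2) / kc b)"
      unfolding pN sum_divide_distrib by (rule sum.swap)
    finally show ?thesis .
  qed
  then show ?thesis using toep_contractive_iff_adjoint[where kc = kc and lc = lc, OF K.kc_pos L.kc_pos F(2,1)] by blast
qed

text \<open>
  Multiplying a constant vector gives the columns of \<open>\<Phi>\<close>, so these lie in the
  target space and their series converge on \<open>\<Omega>\<close>. The norm bound is the limit
  of the bounds for finite sections.
\<close>

lemma toep_contractive_imp_contractive_multiplier:
  fixes kc lc :: "('n::finite) mps"
  assumes K: "diagonal_rkhs \<Omega> k (rkhs \<Omega> k) (rkhs_ip \<Omega> k) kc r"
    and L: "diagonal_rkhs \<Omega> l (rkhs \<Omega> l) (rkhs_ip \<Omega> l) lc s"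
    and contr: "\<And>G. finite G \<Longrightarrow> co_invariant G \<Longrightarrow> toep_contractive kc lc J G c"
  obtains \<Phi> where "\<And>z i j. z \<in> \<Omega> \<Longrightarrow> i < J \<Longrightarrow> j < J \<Longrightarrow> ((\<lambda>a. mpow z a * cnj (c a j i)) has_sum \<Phi> z i j) UNIV"
    "contractive_multiplier \<Omega> k l J \<Phi>"
proof -
  interpret K: diagonal_rkhs \<Omega> k "rkhs \<Omega> k" "rkhs_ip \<Omega> k" kc r by (rule K)
  interpret L: diagonal_rkhs \<Omega> l "rkhs \<Omega> l" "rkhs_ip \<Omega> l" lc s by (rule L)
  have single: "(\<lambda>e. (cmod (\<psi> e i))\<^sup>2 / lc e) summable_on UNIV"
    if "(\<lambda>e. (\<Sum>i<J. (cmod (\<psi> e i))\<^sup>2) / lc e) summable_on UNIV" "i < J" for \<psi> :: "nat ^ 'n \<Rightarrow> nat \<Rightarrow> complex" and i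
    by (rule summable_on_comparison_test[OF that(1)])
      (use L.kc_pos that(2) in \<open>auto intro!: divide_right_mono member_le_sum simp: less_imp_le\<close>)
  define \<Phi> where "\<Phi> z i j = infsum (\<lambda>a. mpow z a * cnj (c a j i)) UNIV" for z i j
  have \<Phi>: "((\<lambda>a. mpow z a * cnj (c a j i)) has_sum \<Phi> z i j) UNIV" if z: "z \<in> \<Omega>" and ij: "i < J" "j < J" for z i j
  proof -
    \<comment> \<open>The constant function equal to the \<open>j\<close>-th unit vector.\<close>
    define \<phi> :: "nat ^ 'n \<Rightarrow> nat \<Rightarrow> complex" where "\<phi> b j' = (if b = 0 \<and> j' = j then 1 else 0)" for b j'
    have "(\<lambda>b. (\<Sum>j<J. (cmod (\<phi> b j))\<^sup>2) / kc b) summable_on UNIV"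
    proof (rule finite_nonzero_values_imp_summable_on, rule finite_subset)
      show "{b \<in> UNIV. (\<Sum>j<J. (cmod (\<phi> b j))\<^sup>2) / kc b \<noteq> 0} \<subseteq> {0}"
      proof
        fix b assume "b \<in> {b \<in> UNIV. (\<Sum>j<J. (cmod (\<phi> b j))\<^sup>2) / kc b \<noteq> 0}"
        then show "b \<in> {0}" by (cases "b = 0") (simp_all add: \<phi>_def)
      qed
    qed simp
    from single[OF mult_coeff_infsum_le(1)[where kc = kc and lc = lc, OF K.kc_pos L.kc_pos contr this] ij(1)]
    obtain f where "((\<lambda>a. mult_coeff c J \<phi> a i * mpow z a) has_sum f z) UNIV"
      using L.riesz_fischer[of "\<lambda>e. mult_coeff c J \<phi> e i"] z by blast
    moreover have "mult_coeff c J \<phi> e i = cnj (c e j i)" for e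
    proof -
      have "mult_coeff c J \<phi> e i = (\<Sum>b | b \<le> e. if b = 0 then cnj (c (e - b) j i) else 0)"
        unfolding mult_coeff_def \<phi>_def using ij by (intro sum.cong refl) (simp add: if_distrib cong: if_cong)
      then show ?thesis by (simp add: finite_multiindex_le vec_zero_le vec_minus_zero)
    qed
    ultimately have "(\<lambda>a. mpow z a * cnj (c a j i)) summable_on UNIV"
      by (auto simp: mult.commute intro: has_sum_imp_summable)
    then show ?thesis unfolding \<Phi>_def by (rule has_sum_infsum)
  qed
  have "contractive_multiplier \<Omega> k l J \<Phi>"
    unfolding contractive_multiplier_def
  proof
    fix f assume "f \<in> tensor_space \<Omega> k J"
    then have f: "f j \<in> rkhs \<Omega> k" if "j < J" for j using that by (simp add: tensor_space_def)
    define \<phi> where "\<phi> b j = K.coeff (f j) b" for b j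
    let ?\<psi> = "mult_coeff c J \<phi>"
    let ?g = "mult_op \<Omega> J \<Phi> f"
    have \<phi>_sum: "((\<lambda>b. (\<Sum>j<J. (cmod (\<phi> b j))\<^sup>2) / kc b) has_sum (\<Sum>j<J. infsum (\<lambda>b. (cmod (\<phi> b j))\<^sup>2 / kc b) UNIV)) UNIV"
      unfolding sum_divide_distrib \<phi>_def
      by (intro has_sum_finite_sum has_sum_infsum K.bessel_infsum(1) f) auto
    note \<psi> = mult_coeff_infsum_le[where kc = kc and lc = lc, OF K.kc_pos L.kc_pos contr has_sum_imp_summable[OF \<phi>_sum]]
    have g: "?g i \<in> rkhs \<Omega> l \<and> (rkhs_norm \<Omega> l (?g i))\<^sup>2 \<le> infsum (\<lambda>e. (cmod (?\<psi> e i))\<^sup>2 / lc e) UNIV" if i: "i < J" for i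
    proof -
      obtain h where h: "h \<in> rkhs \<Omega> l" "\<And>z. z \<in> \<Omega> \<Longrightarrow> ((\<lambda>e. ?\<psi> e i * mpow z e) has_sum h z) UNIV"
        "(L.R.nrm h)\<^sup>2 \<le> infsum (\<lambda>e. (cmod (?\<psi> e i))\<^sup>2 / lc e) UNIV"
        using L.riesz_fischer[OF single[OF \<psi>(1) i]] by blast
      have "?g i = h"
      proof
        fix z show "?g i z = h z"
        proof (cases "z \<in> \<Omega>")
          case True
          have "((\<lambda>e. ?\<psi> e i * mpow z e) has_sum ?g i z) UNIV"
            using mult_op_has_sum[of J z c \<Phi> \<phi> f i, OF \<Phi>[OF True] _ i] K.has_sum_coeff[OF f True] True
            by (simp add: mult_op_def \<phi>_def)
          then show ?thesis using has_sum_unique h(2)[OF True] by blast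
        qed (simp add: mult_op_def L.vanish_off[OF h(1)])
      qed
      then show ?thesis using h by (simp add: rkhs_norm_def L.R.nrm_def)
    qed
    have "(\<Sum>i<J. (rkhs_norm \<Omega> l (?g i))\<^sup>2) \<le> (\<Sum>i<J. infsum (\<lambda>e. (cmod (?\<psi> e i))\<^sup>2 / lc e) UNIV)"
      using g by (intro sum_mono) auto
    also have "\<dots> = infsum (\<lambda>e. (\<Sum>i<J. (cmod (?\<psi> e i))\<^sup>2) / lc e) UNIV"
      unfolding sum_divide_distrib
      by (intro infsumI[symmetric] has_sum_finite_sum has_sum_infsum single[OF \<psi>(1)]) auto
    also have "\<dots> \<le> (\<Sum>j<J. infsum (\<lambda>b. (cmod (\<phi> b j))\<^sup>2 / kc b) UNIV)"
      using \<psi>(2) infsumI[OF \<phi>_sum] by simp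
    also have "\<dots> \<le> (\<Sum>j<J. (rkhs_norm \<Omega> k (f j))\<^sup>2)"
      unfolding \<phi>_def using K.bessel_infsum(2)[OF f] by (intro sum_mono) (simp add: rkhs_norm_def K.R.nrm_def)
    finally show "?g \<in> tensor_space \<Omega> l J \<and> tensor_norm \<Omega> l J ?g \<le> tensor_norm \<Omega> k J f"
      using g by (simp add: tensor_space_def tensor_norm_def)
  qed
  with \<Phi> show ?thesis by (rule that)
qed

section \<open>Shimorin certificates give complete Caratheodory pairs\<close>

theorem theorem5p6:
  fixes \<Omega> :: "(complex ^ 'n::finite) set"
    and k l :: "complex ^ 'n \<Rightarrow> complex ^ 'n \<Rightarrow> complex"
    and kc lc :: "nat ^ 'n \<Rightarrow> real"
  assumes "diagonal_holomorphic_kernel \<Omega> k kc" and "kc 0 = 1"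
    and "diagonal_holomorphic_kernel \<Omega> l lc" and "lc 0 = 1"
    and "\<exists>t. shimorin_certificate kc lc t"
  shows "complete_caratheodory_pair \<Omega> k kc l lc"
  unfolding complete_caratheodory_pair_def
proof (intro allI impI)
  fix J :: nat and F :: "(nat ^ 'n) set" and c :: "nat ^ 'n \<Rightarrow> nat \<Rightarrow> nat \<Rightarrow> complex"
  assume "finite F \<and> co_invariant F"
  then have F: "co_invariant F" "finite F" by auto
  obtain r where K: "diagonal_rkhs \<Omega> k (rkhs \<Omega> k) (rkhs_ip \<Omega> k) kc r"
    using diagonal_rkhs_of_kernel[OF assms(1)] .
  obtain s where L: "diagonal_rkhs \<Omega> l (rkhs \<Omega> l) (rkhs_ip \<Omega> l) lc s"
    using diagonal_rkhs_of_kernel[OF assms(3)] .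
  obtain t where t: "shimorin_certificate kc lc t" using assms(5) by blast
  have k: "\<And>a. kc a > 0" and l: "\<And>a. lc a > 0"
    using assms(1,3) by (auto simp: diagonal_holomorphic_kernel_def)
  have "toep_contractive kc lc J F c \<longleftrightarrow> (\<exists>c' \<Phi>. (\<forall>a\<in>F. c' a = c a) \<and>
            (\<forall>z\<in>\<Omega>. \<forall>i<J. \<forall>j<J. ((\<lambda>a. mpow z a * cnj (c' a j i)) has_sum \<Phi> z i j) UNIV) \<and>
            contractive_multiplier \<Omega> k l J \<Phi>)"
  proof
    assume "toep_contractive kc lc J F c"
    from toep_extend[OF assms(2) _ t F this] k
    obtain c' where c': "\<forall>a\<in>F. c' a = c a" "\<And>G. finite G \<Longrightarrow> co_invariant G \<Longrightarrow> toep_contractive kc lc J G c'"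
      using less_imp_le by metis
    from toep_contractive_imp_contractive_multiplier[OF K L c'(2)]
    obtain \<Phi> where "\<And>z i j. z \<in> \<Omega> \<Longrightarrow> i < J \<Longrightarrow> j < J \<Longrightarrow> ((\<lambda>a. mpow z a * cnj (c' a j i)) has_sum \<Phi> z i j) UNIV"
      "contractive_multiplier \<Omega> k l J \<Phi>" by blast
    with c'(1) show "\<exists>c' \<Phi>. (\<forall>a\<in>F. c' a = c a) \<and>
            (\<forall>z\<in>\<Omega>. \<forall>i<J. \<forall>j<J. ((\<lambda>a. mpow z a * cnj (c' a j i)) has_sum \<Phi> z i j) UNIV) \<and>
            contractive_multiplier \<Omega> k l J \<Phi>" by blast
  next
    assume "\<exists>c' \<Phi>. (\<forall>a\<in>F. c' a = c a) \<and>
            (\<forall>z\<in>\<Omega>. \<forall>i<J. \<forall>j<J. ((\<lambda>a. mpow z a * cnj (c' a j i)) has_sum \<Phi> z i j) UNIV) \<and>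
            contractive_multiplier \<Omega> k l J \<Phi>"
    then obtain c' \<Phi> where c': "\<forall>a\<in>F. c' a = c a" "contractive_multiplier \<Omega> k l J \<Phi>"
      "\<And>z i j. z \<in> \<Omega> \<Longrightarrow> i < J \<Longrightarrow> j < J \<Longrightarrow> ((\<lambda>a. mpow z a * cnj (c' a j i)) has_sum \<Phi> z i j) UNIV"
      by blast
    have "toep_contractive kc lc J F c'"
      by (rule contractive_multiplier_imp_toep_contractive[OF K L F(2,1) c'(3,2)])
    then show "toep_contractive kc lc J F c"
      using toep_contractive_cong[OF F(1), of c' c] c'(1) by blast
  qed
  then show "contraction_matrix (F \<times> {..<J}) (caratheodory_matrix kc lc c) \<longleftrightarrow>
         (\<exists>c' \<Phi>. (\<forall>a\<in>F. c' a = c a) \<and>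
            (\<forall>z\<in>\<Omega>. \<forall>i<J. \<forall>j<J.
               ((\<lambda>a. mpow z a * cnj (c' a j i)) has_sum \<Phi> z i j) UNIV) \<and>
            contractive_multiplier \<Omega> k l J \<Phi>)"
    using contraction_matrix_caratheodory_iff[where kc = kc and lc = lc, OF k l F(2), where J = J and c = c] by simp
qed

end
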